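(* Let $k$ be an algebraically closed field of characteristic $p \ge 0$ with $p \ne 3$, and let $E \subset \mathbb{P}^2$ be the curve over $k$ defined by $X^3+Y^3+Z^3=0$. Then there exists a morphism $\varphi: E \rightarrow \mathbb{P}^2$ such that $\varphi$ is birational onto its image, $\deg \varphi(E)=4$, and there exist two (distinct) inner Galois points for $\varphi(E)$.
   Context: Everything is over the algebraically closed field $k$. Let $\varphi: E \to \mathbb{P}^2$ be birational onto its image $\varphi(E)$. For a point $P \in \mathbb{P}^2$, let $\pi_P$ denote the projection from $P$, which sends a point $Q\neq P$ to the line $\overline{PQ}$, regarded as a point of $\mathbb{P}^1$. The point $P$ is called a Galois point for $\varphi(E)$ if the function field extension $k(\varphi(E))/\pi_P^*k(\mathbb{P}^1)$ induced by $\pi_P$ (restricted to $\varphi(E)$) is Galois. A Galois point $P$ is called inner if $P$ is a smooth point of the plane curve $\varphi(E)$. Here $\deg\varphi(E)$ is the degree of the plane curve $\varphi(E)$. *)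

theory Defs
  imports
    "HOL-Computational_Algebra.Computational_Algebra"
    "HOL-Algebra.Finite_Extensions"
    "HOL-Algebra.QuotRing"
begin

section \<open>The projective plane\<close>

text \<open>A point of the projective plane is the set of all its homogeneous coordinate triples.\<close>

type_synonym 'k point = "('k \<times> 'k \<times> 'k) set"

fun scale3 :: "'k::field \<Rightarrow> 'k \<times> 'k \<times> 'k \<Rightarrow> 'k \<times> 'k \<times> 'k" where
  "scale3 c (x, y, z) = (c * x, c * y, c * z)"

definition proj_point :: "'k::field \<times> 'k \<times> 'k \<Rightarrow> 'k point" where
  "proj_point v = {scale3 c v | c. c \<noteq> 0}"

definition P2 :: "'k::field point set" where
  "P2 = {proj_point v | v. v \<noteq> (0, 0, 0)}"

section \<open>Forms in three variables\<close>

text \<open>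
  The ring \<open>k[X,Y,Z]\<close> is represented as \<open>k[X][Y][Z]\<close>: the coefficient of
  \<open>X\<^sup>i Y\<^sup>j Z\<^sup>l\<close> in \<open>F\<close> is \<open>coeff (coeff (coeff F l) j) i\<close>.
\<close>

type_synonym 'k poly3 = "'k poly poly poly"

definition const3 :: "'k::field \<Rightarrow> 'k poly3" where "const3 c = [:[:[:c:]:]:]"
definition var_X :: "'k::field poly3" where "var_X = [:[:[:0, 1:]:]:]"
definition var_Y :: "'k::field poly3" where "var_Y = [:[:0, 1:]:]"
definition var_Z :: "'k::field poly3" where "var_Z = [:0, 1:]"

fun eval3 :: "'k::field poly3 \<Rightarrow> 'k \<times> 'k \<times> 'k \<Rightarrow> 'k" where
  "eval3 F (x, y, z) = poly (poly (poly F [:[:z:]:]) [:y:]) x"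

definition diff_X :: "'k::field poly3 \<Rightarrow> 'k poly3" where "diff_X = map_poly (map_poly pderiv)"
definition diff_Y :: "'k::field poly3 \<Rightarrow> 'k poly3" where "diff_Y = map_poly pderiv"
definition diff_Z :: "'k::field poly3 \<Rightarrow> 'k poly3" where "diff_Z = pderiv"

definition form :: "nat \<Rightarrow> 'k::field poly3 \<Rightarrow> bool" where
  "form d F \<longleftrightarrow>
    (\<forall>i j l. poly.coeff (poly.coeff (poly.coeff F l) j) i \<noteq> 0 \<longrightarrow> i + j + l = d)"

definition vanishes_at :: "'k::field poly3 \<Rightarrow> 'k point \<Rightarrow> bool" where
  "vanishes_at F P \<longleftrightarrow> (\<forall>v\<in>P. eval3 F v = 0)"

definition vanishes_on :: "'k::field poly3 \<Rightarrow> 'k point set \<Rightarrow> bool" where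
  "vanishes_on F C \<longleftrightarrow> (\<forall>P\<in>C. vanishes_at F P)"

definition zero_locus :: "'k::field poly3 \<Rightarrow> 'k point set" where
  "zero_locus F = {P \<in> P2. vanishes_at F P}"

section \<open>Plane curves\<close>

text \<open>
  Over an algebraically closed field, the equation of an irreducible plane curve is unique up to a
  nonzero constant factor, so degree and smoothness do not depend on its choice.
\<close>

definition curve_equation :: "'k::field point set \<Rightarrow> nat \<Rightarrow> 'k poly3 \<Rightarrow> bool" where
  "curve_equation C d F \<longleftrightarrow> Factorial_Ring.irreducible F \<and> form d F \<and> C = zero_locus F"

definition plane_curve_of_degree :: "'k::field point set \<Rightarrow> nat \<Rightarrow> bool" where
  "plane_curve_of_degree C d \<longleftrightarrow> (\<exists>F. curve_equation C d F)"

definition smooth_point :: "'k::field point \<Rightarrow> 'k point set \<Rightarrow> bool" where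
  "smooth_point P C \<longleftrightarrow> P \<in> C \<and>
    (\<exists>d F. curve_equation C d F \<and>
      \<not> (vanishes_at (diff_X F) P \<and> vanishes_at (diff_Y F) P \<and> vanishes_at (diff_Z F) P))"

section \<open>Morphisms and birationality\<close>

text \<open>
  A map from a (quasi-projective) set of points to the projective plane is a morphism if every
  point has an open neighbourhood, here a basic open set where a form \<open>N\<close> does not
  vanish, on which the map is given by three forms of the same degree without common zero.
\<close>

definition morphism_to_P2 :: "'k::field point set \<Rightarrow> ('k point \<Rightarrow> 'k point) \<Rightarrow> bool" where
  "morphism_to_P2 U \<phi> \<longleftrightarrow>
    (\<forall>P\<in>U. \<exists>e N d G1 G2 G3.
      form e N \<and> \<not> vanishes_at N P \<and> form d G1 \<and> form d G2 \<and> form d G3 \<and>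
      (\<forall>v. v \<noteq> (0, 0, 0) \<longrightarrow> proj_point v \<in> U \<longrightarrow> eval3 N v \<noteq> 0 \<longrightarrow>
        (eval3 G1 v, eval3 G2 v, eval3 G3 v) \<noteq> (0, 0, 0) \<and>
        \<phi> (proj_point v) = proj_point (eval3 G1 v, eval3 G2 v, eval3 G3 v)))"

text \<open>
  A morphism from the irreducible projective curve \<open>E\<close> is birational onto its image if it has an
  inverse \<open>\<psi>\<close> defined on some nonempty open subset \<open>V\<close> of the image.  Every nonempty open set
  contains a nonempty basic one, so \<open>V\<close> may be taken of the form below.
\<close>

definition birational_onto_image :: "'k::field point set \<Rightarrow> ('k point \<Rightarrow> 'k point) \<Rightarrow> bool" where
  "birational_onto_image E \<phi> \<longleftrightarrow>
    (\<exists>e N V \<psi>. form e N \<and> V = \<phi> ` E - zero_locus N \<and> V \<noteq> {} \<and>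
      morphism_to_P2 V \<psi> \<and> \<psi> ` V \<subseteq> E \<and>
      (\<forall>Q\<in>V. \<phi> (\<psi> Q) = Q) \<and> (\<forall>P\<in>E. \<phi> P \<in> V \<longrightarrow> \<psi> (\<phi> P) = P))"

section \<open>Function fields\<close>

text \<open>
  A rational function on an irreducible plane curve \<open>C\<close> is a quotient \<open>A / B\<close> of forms of the
  same degree with \<open>B\<close> not vanishing identically on \<open>C\<close>, where \<open>A / B\<close> and \<open>A' / B'\<close> are
  identified if \<open>A * B' - A' * B\<close> vanishes on \<open>C\<close>.
\<close>

definition fractions :: "'k::field point set \<Rightarrow> ('k poly3 \<times> 'k poly3) set" where
  "fractions C = {(A, B) | A B. (\<exists>d. form d A \<and> form d B) \<and> \<not> vanishes_on B C}"

definition fraction_rel ::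
    "'k::field point set \<Rightarrow> (('k poly3 \<times> 'k poly3) \<times> ('k poly3 \<times> 'k poly3)) set" where
  "fraction_rel C = {((A, B), (A', B')) | A B A' B'.
     (A, B) \<in> fractions C \<and> (A', B') \<in> fractions C \<and> vanishes_on (A * B' - A' * B) C}"

definition rat_fun :: "'k::field point set \<Rightarrow> 'k poly3 \<Rightarrow> 'k poly3 \<Rightarrow> ('k poly3 \<times> 'k poly3) set"
  where "rat_fun C A B = fraction_rel C `` {(A, B)}"

definition function_field :: "'k::field point set \<Rightarrow> ('k poly3 \<times> 'k poly3) set ring" where
  "function_field C =
    \<lparr>carrier = fractions C // fraction_rel C,
     mult = (\<lambda>f g. \<Union>(A, B)\<in>f. \<Union>(A', B')\<in>g. rat_fun C (A * A') (B * B')),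
     one = rat_fun C 1 1,
     zero = rat_fun C 0 1,
     add = (\<lambda>f g. \<Union>(A, B)\<in>f. \<Union>(A', B')\<in>g. rat_fun C (A * B' + A' * B) (B * B'))\<rparr>"

section \<open>Galois points\<close>

text \<open>A field extension is Galois if it is algebraic and its automorphisms fix only the base field.\<close>

definition galois_extension :: "('a, 'b) ring_scheme \<Rightarrow> 'a set \<Rightarrow> bool" where
  "galois_extension K F \<longleftrightarrow> field K \<and> subfield F K \<and>
    (\<forall>x\<in>carrier K. ring.algebraic K F x) \<and>
    {x \<in> carrier K. \<forall>\<sigma>\<in>ring_iso K K. (\<forall>a\<in>F. \<sigma> a = a) \<longrightarrow> \<sigma> x = x} = F"

text \<open>
  Let \<open>L1, L2\<close> be linear forms whose only common zero is \<open>P\<close>.  The lines through \<open>P\<close> form a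
  projective line, and in suitable coordinates on it the projection from \<open>P\<close> is
  \<open>Q \<mapsto> [L1(Q) : L2(Q)]\<close>.  Another choice of \<open>L1, L2\<close> only changes these coordinates.
\<close>

definition projection_forms :: "'k::field point \<Rightarrow> 'k poly3 \<Rightarrow> 'k poly3 \<Rightarrow> bool" where
  "projection_forms P L1 L2 \<longleftrightarrow>
    form 1 L1 \<and> form 1 L2 \<and> zero_locus L1 \<inter> zero_locus L2 = {P}"

text \<open>
  Binary forms in \<open>S, T\<close> are elements of \<open>k[S][T]\<close>.  The elements of the function field of the
  projective line are the quotients \<open>A / B\<close> of binary forms of the same degree, and pulling such
  an element back along the projection means substituting \<open>S = L1\<close> and \<open>T = L2\<close>.
\<close>

definition binary_form :: "nat \<Rightarrow> 'k::field poly poly \<Rightarrow> bool" where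
  "binary_form d A \<longleftrightarrow> (\<forall>i j. poly.coeff (poly.coeff A j) i \<noteq> 0 \<longrightarrow> i + j = d)"

definition subst2 :: "'k::field poly poly \<Rightarrow> 'k poly3 \<Rightarrow> 'k poly3 \<Rightarrow> 'k poly3" where
  "subst2 A L1 L2 = poly (map_poly (\<lambda>a. poly (map_poly const3 a) L1) A) L2"

definition projection_pullback ::
    "'k::field point set \<Rightarrow> 'k poly3 \<Rightarrow> 'k poly3 \<Rightarrow> ('k poly3 \<times> 'k poly3) set set" where
  "projection_pullback C L1 L2 =
    {rat_fun C (subst2 A L1 L2) (subst2 B L1 L2) | A B.
       (\<exists>d. binary_form d A \<and> binary_form d B) \<and> \<not> vanishes_on (subst2 B L1 L2) C}"

definition galois_point :: "'k::field point \<Rightarrow> 'k point set \<Rightarrow> bool" where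
  "galois_point P C \<longleftrightarrow>
    (\<exists>L1 L2. projection_forms P L1 L2 \<and>
      galois_extension (function_field C) (projection_pullback C L1 L2))"

definition inner_galois_point :: "'k::field point \<Rightarrow> 'k point set \<Rightarrow> bool" where
  "inner_galois_point P C \<longleftrightarrow> galois_point P C \<and> smooth_point P C"

end

(*
  The Fermat cubic is projectively equivalent, over a field containing a primitive ninth root of
  unity, to the twisted cubic h^3 = b^3 - 9 a^2 b - 9 a^3.  In the affine chart a = 1 put
  y = b, u = h - y and z = - h - 3 / u.  For fixed u the numbers y and z are the two roots of
  3 u Y^2 + (3 u^2 + 9) Y + u^3 + 9, so the curve has an involution exchanging y and z and fixing u.
  Its function field is cyclic of degree 3 over k(y), by h |-> omega h, and hence also over k(z).
  The map (1 : y : z) is birational onto a quartic that has degree 3 in y and in z, and the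
  projections from (0 : 0 : 1) and (0 : 1 : 0) are y and z.  (In terms of the group law, the line
  x = 0 cuts out {-2 v, v, omega v, omega^2 v} for a suitable point v; the two cyclic groups of
  order 3 permute all points of this divisor but the first or but the second.)

  Identities in the function field are verified at a generic point of the curve, with coordinates in
  an algebraic closure of k(t): a form vanishes on the curve if and only if it vanishes there.
*)
theory Submission
  imports Defs "HOL-Algebra.Algebraic_Closure_Type"
begin

section \<open>Evaluation of polynomials along ring homomorphisms\<close>

text \<open>The cubic is chosen so that \<open>h = y + u\<close> cancels \<open>y^3\<close>: for
  fixed \<open>u\<close> a quadratic in \<open>y\<close> remains, its other root is
  \<open>z\<close>, and \<open>z + u\<close> is the cube root that belongs to \<open>z\<close>. The
  discriminant of y^3 - 9y - 9 is 3^6, which is where p different from 3 enters. The inequalities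
  needed for its roots follow from integral identities whose constant is 1, 9 or 27, so they hold in
  all other characteristics at once, including 2. The obstacle is that the function field is defined
  through vanishing at all points of the image, while the automorphisms are visible only on generic
  coordinates. The bridge needs the image to be the whole quartic, including the double points (1 :
  -1 : -2) and (1 : -2 : -1) where the inverse map breaks down, and vanishing has to be tested on
  two affine pieces of the cubic, with the second chart at the base point of the first. Linear
  independence of 1, h, h^2 over k(y) comes from total ramification at a simple root of y^3 - 9y -
  9. The same ramification point makes the quartic an Eisenstein polynomial.\<close>

definition ring_map :: "('a::comm_ring_1 \<Rightarrow> 'b::comm_ring_1) \<Rightarrow> bool" where
  "ring_map f \<longleftrightarrow> f 0 = 0 \<and> f 1 = 1 \<and> (\<forall>x y. f (x + y) = f x + f y) \<and> (\<forall>x y. f (x * y) = f x * f y)"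

lemma ring_mapI:
  assumes "f 0 = 0" "f 1 = 1" "\<And>x y. f (x + y) = f x + f y" "\<And>x y. f (x * y) = f x * f y"
  shows "ring_map f"
  using assms by (simp add: ring_map_def)

lemma ring_map_simps:
  assumes "ring_map f"
  shows "f 0 = 0" "f 1 = 1" "f (x + y) = f x + f y" "f (x * y) = f x * f y"
    "f (- x) = - f x" "f (x - y) = f x - f y" "f (x ^ n) = f x ^ n" "f (numeral m) = numeral m"
proof -
  show a: "f 0 = 0" "f 1 = 1" and b: "f (x + y) = f x + f y" and c: "f (x * y) = f x * f y" for x y
    using assms by (auto simp: ring_map_def)
  show d: "f (- x) = - f x" for x using b[of x "-x"] a by (simp add: eq_neg_iff_add_eq_0 add.commute)
  show "f (x - y) = f x - f y" using b[of x "-y"] d by simp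
  show "f (x ^ n) = f x ^ n" by (induction n) (auto simp: a c)
  have "f (of_nat k) = of_nat k" for k by (induction k) (auto simp: a b)
  from this[of "numeral m"] show "f (numeral m) = numeral m" by simp
qed

lemma ring_map_sum: "ring_map f \<Longrightarrow> f (\<Sum>i\<in>A. g i) = (\<Sum>i\<in>A. f (g i))"
  by (induction A rule: infinite_finite_induct) (auto simp: ring_map_simps)

lemma ring_map_eq_0:
  fixes f :: "'a::field \<Rightarrow> 'b::field"
  assumes "ring_map f"
  shows "f x = 0 \<longleftrightarrow> x = 0"
proof
  assume "f x = 0"
  then have "f (x * inverse x) = 0" by (simp add: ring_map_simps[OF assms])
  then show "x = 0" by (cases "x = 0") (auto simp: ring_map_simps[OF assms])
qed (simp add: ring_map_simps[OF assms])

lemma ring_map_compose: "ring_map f \<Longrightarrow> ring_map g \<Longrightarrow> ring_map (\<lambda>x. f (g x))"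
  by (simp add: ring_map_def)

lemma ring_map_inverse:
  fixes f :: "'a::field \<Rightarrow> 'b::field"
  assumes "ring_map f"
  shows "f (inverse x) = inverse (f x)"
proof (cases "x = 0")
  case False
  then have "f x * f (inverse x) = 1" using assms by (simp flip: ring_map_simps(4) add: ring_map_simps(2))
  then show ?thesis by (simp add: inverse_unique)
qed (simp add: ring_map_simps[OF assms])

lemma ring_map_poly: 
  assumes "ring_map f"
  shows "f (poly p x) = poly (map_poly f p) (f x)"
  by (induction p) (auto simp: ring_map_simps[OF assms] map_poly_pCons)

lemma ring_map_poly_at: "ring_map (\<lambda>p. poly p x)"
  by (rule ring_mapI) auto

lemma ring_map_map_poly:
  assumes "ring_map f"
  shows "ring_map (map_poly f)"
proof (rule ring_mapI)
  note s = ring_map_simps[OF assms]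
  show "map_poly f 0 = 0" "map_poly f 1 = 1" by (auto simp: s)
  show "map_poly f (p + q) = map_poly f p + map_poly f q" for p q
    by (rule poly_eqI) (simp add: coeff_map_poly s)
  show "map_poly f (p * q) = map_poly f p * map_poly f q" for p q
    by (rule poly_eqI) (simp add: coeff_map_poly s coeff_mult ring_map_sum[OF assms])
qed

text \<open>Since \<open>pev g a\<close> is again a ring homomorphism, it can serve as the
  coefficient map of another \<open>pev\<close>. Nesting it gives evaluation in two or three
  variables, at points of \<open>'k\<close> and of extension fields alike.\<close>

definition pev :: "('a::comm_ring_1 \<Rightarrow> 'b::comm_ring_1) \<Rightarrow> 'b \<Rightarrow> 'a poly \<Rightarrow> 'b" where
  "pev g a p = poly (map_poly g p) a"

lemma ring_map_pev: "ring_map g \<Longrightarrow> ring_map (pev g a)"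
  unfolding pev_def by (rule ring_map_compose[OF ring_map_poly_at ring_map_map_poly])

lemma pev_pCons: "ring_map g \<Longrightarrow> pev g a (pCons c p) = g c + a * pev g a p"
  by (simp add: pev_def map_poly_pCons ring_map_simps)

lemma pev_0 [simp]: "pev g a 0 = 0"
  by (simp add: pev_def)

lemma ring_map_comp_pev:
  assumes "ring_map f" "ring_map g"
  shows "f (pev g a p) = pev (\<lambda>x. f (g x)) (f a) p"
  by (induction p) (auto simp: pev_pCons assms ring_map_compose ring_map_simps[OF assms(1)])

definition ev :: "('k::field \<Rightarrow> 'b::comm_ring_1) \<Rightarrow> 'k poly3 \<Rightarrow> 'b \<times> 'b \<times> 'b \<Rightarrow> 'b" where
  "ev g F v = (case v of (a, b, c) \<Rightarrow> pev (pev (pev g a) b) c F)"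

lemma ring_map_ev: "ring_map g \<Longrightarrow> ring_map (\<lambda>F. ev g F v)"
  by (cases v) (simp add: ev_def ring_map_pev)

lemmas ev_simps = ring_map_simps[OF ring_map_ev]

lemma ev_gens:
  assumes "ring_map g"
  shows "ev g (const3 c) (x, y, z) = g c" "ev g var_X (x, y, z) = x"
    "ev g var_Y (x, y, z) = y" "ev g var_Z (x, y, z) = z"
  using assms
  by (auto simp: ev_def const3_def var_X_def var_Y_def var_Z_def pev_pCons ring_map_pev ring_map_simps
      ring_map_simps[OF ring_map_pev])

lemma ring_map_comp_ev:
  assumes "ring_map f" "ring_map g"
  shows "f (ev g F (x, y, z)) = ev (\<lambda>c. f (g c)) F (f x, f y, f z)"
  by (simp add: ev_def ring_map_comp_pev assms ring_map_pev)

lemma ring_map_id: "ring_map (\<lambda>x. x)"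
  by (rule ring_mapI) auto

lemma ring_map_const3: "ring_map (const3 :: 'k::field \<Rightarrow> _)"
  by (rule ring_mapI) (auto simp: const3_def one_pCons)

text \<open>\<open>eval3\<close> substitutes constant polynomials and evaluates afterwards,
  \<open>ev\<close> evaluates the coefficients first. The two orders agree because evaluation of the
  inner variables is a ring homomorphism that sends the substituted constant to its value.\<close>

lemma eval3_eq_ev: "eval3 F v = ev (\<lambda>x. x) F v"
proof (cases v)
  case (fields x y z)
  have 1: "poly p x = pev (\<lambda>x. x) x p" for p :: "'a poly" by (simp add: pev_def)
  have 2: "poly (poly p [:y:]) x = pev (pev (\<lambda>x. x) x) y p" for p :: "'a poly poly"
    using ring_map_poly[OF ring_map_poly_at[of x], of p "[:y:]"] by (simp add: pev_def[abs_def])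
  have 3: "ring_map (\<lambda>p :: 'a poly poly. poly (poly p [:y:]) x)"
    unfolding 2 by (intro ring_map_pev ring_map_id)
  show ?thesis
    using ring_map_poly[OF 3, of F "[:[:z:]:]"] unfolding fields by (simp add: ev_def 2 pev_def[abs_def])
qed

lemma subst2_eq: "subst2 A L1 L2 = pev (pev const3 L1) L2 A"
  by (simp add: subst2_def pev_def[abs_def])

lemma ev_subst2:
  assumes "ring_map g"
  shows "ev g (subst2 A L1 L2) v = pev (pev g (ev g L1 v)) (ev g L2 v) A"
proof -
  have "ev g (const3 c) v = g c" for c by (cases v) (simp add: ev_gens assms)
  then show ?thesis unfolding subst2_eq
    by (simp add: ring_map_comp_pev[OF ring_map_ev[OF assms]] ring_map_const3 ring_map_pev)
qed

section \<open>Forms and points\<close>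

declare eval3.simps [simp del]

lemma pev_altdef:
  assumes "ring_map g"
  shows "pev g a p = (\<Sum>i\<le>Polynomial.degree p. g (poly.coeff p i) * a ^ i)"
proof -
  have "pev g a (\<Sum>i\<le>Polynomial.degree p. Polynomial.monom (poly.coeff p i) i) = (\<Sum>i\<le>Polynomial.degree p. g (poly.coeff p i) * a ^ i)"
    unfolding ring_map_sum[OF ring_map_pev[OF assms]]
    by (simp add: pev_def map_poly_monom ring_map_simps[OF assms] poly_monom)
  then show ?thesis by (simp add: poly_as_sum_of_monoms)
qed

abbreviation coeff3 :: "'k::field poly3 \<Rightarrow> nat \<Rightarrow> nat \<Rightarrow> nat \<Rightarrow> 'k" where
  "coeff3 F i j l \<equiv> poly.coeff (poly.coeff (poly.coeff F l) j) i"

lemma ev_altdef: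
  assumes "ring_map g"
  shows "ev g F (a, b, c) = (\<Sum>l\<le>Polynomial.degree F. \<Sum>j\<le>Polynomial.degree (poly.coeff F l).
     \<Sum>i\<le>Polynomial.degree (poly.coeff (poly.coeff F l) j). g (coeff3 F i j l) * a ^ i * b ^ j * c ^ l)"
  by (simp add: ev_def pev_altdef ring_map_pev assms sum_distrib_right)

lemma form_coeff3: "form d F \<Longrightarrow> i + j + l \<noteq> d \<Longrightarrow> coeff3 F i j l = 0"
  by (auto simp: form_def)

lemma ev_form_scale:
  assumes "ring_map g" "form d F"
  shows "ev g F (s * a, s * b, s * c) = s ^ d * ev g F (a, b, c)"
proof -
  have "g (coeff3 F i j l) * (s * a) ^ i * (s * b) ^ j * (s * c) ^ l
      = s ^ d * (g (coeff3 F i j l) * a ^ i * b ^ j * c ^ l)" for i j l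
  proof (cases "i + j + l = d")
    case True
    then show ?thesis by (auto simp: power_mult_distrib power_add)
  next
    case False
    then show ?thesis by (simp add: form_coeff3[OF assms(2)] ring_map_simps[OF assms(1)])
  qed
  then show ?thesis by (simp add: ev_altdef[OF assms(1)] sum_distrib_left)
qed

lemma form_0 [simp]: "form d 0"
  by (simp add: form_def)

lemma form_add: "form d A \<Longrightarrow> form d B \<Longrightarrow> form d (A + B)"
  by (auto simp: form_def) (metis add.right_neutral)

lemma form_uminus: "form d A \<Longrightarrow> form d (- A)"
  by (auto simp: form_def)

lemma form_diff: "form d A \<Longrightarrow> form d B \<Longrightarrow> form d (A - B)"
  using form_add[of d A "- B"] form_uminus[of d B] by simp

lemma form_sum: "(\<And>i. i \<in> I \<Longrightarrow> form d (A i)) \<Longrightarrow> form d (\<Sum>i\<in>I. A i)"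
  by (induction I rule: infinite_finite_induct) (auto intro: form_add)

lemma form_mult:
  assumes "form d A" "form e B"
  shows "form (d + e) (A * B)"
  unfolding form_def
proof (intro allI impI)
  fix i j l
  assume "coeff3 (A * B) i j l \<noteq> 0"
  then have "(\<Sum>l'\<le>l. \<Sum>j'\<le>j. \<Sum>i'\<le>i. coeff3 A i' j' l' * coeff3 B (i - i') (j - j') (l - l')) \<noteq> 0"
    by (simp add: coeff_mult coeff_sum)
  then obtain l' where "l' \<le> l" "(\<Sum>j'\<le>j. \<Sum>i'\<le>i. coeff3 A i' j' l' * coeff3 B (i - i') (j - j') (l - l')) \<noteq> 0"
    by (auto elim: sum.not_neutral_contains_not_neutral)
  moreover from this obtain j' where "j' \<le> j" "(\<Sum>i'\<le>i. coeff3 A i' j' l' * coeff3 B (i - i') (j - j') (l - l')) \<noteq> 0"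
    by (auto elim: sum.not_neutral_contains_not_neutral)
  moreover from this obtain i' where "i' \<le> i" "coeff3 A i' j' l' * coeff3 B (i - i') (j - j') (l - l') \<noteq> 0"
    by (auto elim: sum.not_neutral_contains_not_neutral)
  moreover from this(2) have "i' + j' + l' = d" "(i - i') + (j - j') + (l - l') = e"
    using assms unfolding form_def by (metis mult_zero_left, metis mult_zero_right)
  ultimately show "i + j + l = d + e" by linarith
qed

lemma form_const3: "form 0 (const3 c)"
  by (auto simp: form_def const3_def coeff_pCons split: nat.splits)

lemma form_1 [simp]: "form 0 1"
  using form_const3[of 1] by (simp add: ring_map_simps[OF ring_map_const3])

lemma form_vars [simp]: "form 1 var_X" "form 1 var_Y" "form 1 var_Z"
  by (auto simp: form_def var_X_def var_Y_def var_Z_def coeff_pCons split: nat.splits)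

lemma form_power: "form d A \<Longrightarrow> form (d * n) (A ^ n)"
proof (induction n)
  case (Suc n)
  then show ?case using form_mult[of d A "d * n" "A ^ n"] by simp
qed simp

lemma form_scale: "form d A \<Longrightarrow> form d (const3 c * A)"
  using form_mult[OF form_const3] by fastforce

lemma form_numeral [simp]: "form 0 (numeral m)"
  using form_const3[of "numeral m"] by (simp add: ring_map_simps[OF ring_map_const3])

lemma form_mult': "form d A \<Longrightarrow> form e B \<Longrightarrow> n = d + e \<Longrightarrow> form n (A * B)"
  by (simp add: form_mult)

lemma form_power': "form d A \<Longrightarrow> n = d * m \<Longrightarrow> form n (A ^ m)"
  by (simp add: form_power)

lemma eval3_simps:
  "eval3 (A + B) v = eval3 A v + eval3 B v" "eval3 (A * B) v = eval3 A v * eval3 B v"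
  "eval3 (A - B) v = eval3 A v - eval3 B v" "eval3 (- A) v = - eval3 A v"
  "eval3 (A ^ n) v = eval3 A v ^ n" "eval3 0 v = 0" "eval3 1 v = 1" "eval3 (numeral m) v = numeral m"
  by (simp_all add: eval3_eq_ev ev_simps ring_map_id)

lemma eval3_gens:
  "eval3 (const3 c) (x, y, z) = c" "eval3 var_X (x, y, z) = x"
  "eval3 var_Y (x, y, z) = y" "eval3 var_Z (x, y, z) = z"
  by (simp_all add: eval3_eq_ev ev_gens ring_map_id)

lemma eval3_form_scale: "form d F \<Longrightarrow> eval3 F (scale3 s v) = s ^ d * eval3 F v"
  by (cases v) (simp add: eval3_eq_ev ev_form_scale[OF ring_map_id])

lemma proj_point_self: "v \<in> proj_point v"
  by (cases v) (auto simp: proj_point_def intro!: exI[of _ 1])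

lemma proj_point_scale:
  assumes "c \<noteq> 0"
  shows "proj_point (scale3 c v) = proj_point v"
proof (intro equalityI subsetI)
  fix u assume "u \<in> proj_point (scale3 c v)"
  then obtain d where "d \<noteq> 0" "u = scale3 (d * c) v" by (cases v) (auto simp: proj_point_def mult.assoc)
  then show "u \<in> proj_point v" using assms by (auto simp: proj_point_def intro!: exI[of _ "d * c"])
next
  fix u assume "u \<in> proj_point v"
  then obtain d where "d \<noteq> 0" "u = scale3 d v" by (auto simp: proj_point_def)
  moreover have "scale3 d v = scale3 (d / c) (scale3 c v)" using assms by (cases v) auto
  ultimately show "u \<in> proj_point (scale3 c v)"
    using assms by (auto simp: proj_point_def intro!: exI[of _ "d / c"])
qed

lemma proj_point_eq_iff: "proj_point u = proj_point v \<longleftrightarrow> (\<exists>c. c \<noteq> 0 \<and> u = scale3 c v)"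
proof
  assume "proj_point u = proj_point v"
  then have "u \<in> proj_point v" using proj_point_self[of u] by simp
  then show "\<exists>c. c \<noteq> 0 \<and> u = scale3 c v" by (auto simp: proj_point_def)
qed (auto simp: proj_point_scale)

definition cross_zero :: "'a::field \<times> 'a \<times> 'a \<Rightarrow> 'a \<times> 'a \<times> 'a \<Rightarrow> bool" where
  "cross_zero u v = (case u of (a, b, c) \<Rightarrow> case v of (x, y, z) \<Rightarrow> 
     a * y = b * x \<and> a * z = c * x \<and> b * z = c * y)"

lemma cross_zero_imp:
  assumes "cross_zero u v" "u \<noteq> (0, 0, 0)" "v \<noteq> (0, 0, 0)"
  obtains s where "s \<noteq> 0" "u = scale3 s v"
proof -
  obtain a b c x y z where [simp]: "u = (a, b, c)" "v = (x, y, z)" by (metis prod_cases3)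
  have e: "a * y = b * x" "a * z = c * x" "b * z = c * y" using assms(1) by (auto simp: cross_zero_def)
  consider "x \<noteq> 0" | "y \<noteq> 0" | "z \<noteq> 0" using assms(3) by auto
  then show thesis
  proof cases
    case 1
    have "u = scale3 (a / x) v" using 1 e by (simp add: field_simps)
    then show ?thesis using that[of "a / x"] assms(2) 1 by auto
  next
    case 2
    have "u = scale3 (b / y) v" using 2 e by (simp add: field_simps)
    then show ?thesis using that[of "b / y"] assms(2) 2 by auto
  next
    case 3
    have "u = scale3 (c / z) v" using 3 e by (simp add: field_simps)
    then show ?thesis using that[of "c / z"] assms(2) 3 by auto
  qed
qed

lemma vanishes_at_proj_point:
  assumes "form d F"
  shows "vanishes_at F (proj_point v) \<longleftrightarrow> eval3 F v = 0"
proof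
  assume "eval3 F v = 0"
  then show "vanishes_at F (proj_point v)"
    by (auto simp: vanishes_at_def proj_point_def eval3_form_scale[OF assms] simp del: split_paired_All)
qed (auto simp: vanishes_at_def proj_point_self)

lemma proj_point_zero_locus:
  assumes "form d F" "v \<noteq> (0, 0, 0)"
  shows "proj_point v \<in> zero_locus F \<longleftrightarrow> eval3 F v = 0"
  using assms unfolding zero_locus_def P2_def vanishes_at_proj_point[OF assms(1), symmetric] by blast

lemma zero_locusE:
  assumes "form d F" "P \<in> zero_locus F"
  obtains v where "v \<noteq> (0, 0, 0)" "P = proj_point v" "eval3 F v = 0"
  using assms vanishes_at_proj_point[OF assms(1)] unfolding zero_locus_def P2_def by blast

section \<open>The quartic curve\<close>

text \<open>At the least index \<open>i\<close> where \<pi> does not divide the coefficient of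
  \<open>A\<close>, the product has a coefficient prime to \<pi>. That is possible only at the top
  of \<open>A * B\<close>, so deg(A B) <= i <= deg A.\<close>

lemma eisenstein_degree:
  fixes \<pi> :: "'a::idom"
  assumes \<pi>: "prime_elem \<pi>" 
    and lead: "\<not> \<pi> dvd Polynomial.lead_coeff (A * B)"
    and below: "\<And>i. i < Polynomial.degree (A * B) \<Longrightarrow> \<pi> dvd poly.coeff (A * B) i"
    and a0: "\<pi> dvd poly.coeff A 0" and b0: "\<not> \<pi> dvd poly.coeff B 0"
  shows "Polynomial.degree B = 0"
proof -
  have "\<not> \<pi> dvd Polynomial.lead_coeff A" using lead by (auto simp: lead_coeff_mult)
  then have ex: "\<exists>i. \<not> \<pi> dvd poly.coeff A i" by blast
  define i where "i = (LEAST i. \<not> \<pi> dvd poly.coeff A i)"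
  have i: "\<not> \<pi> dvd poly.coeff A i" unfolding i_def using ex by (rule LeastI_ex)
  have lt: "\<pi> dvd poly.coeff A j" if "j < i" for j using not_less_Least that unfolding i_def by blast
  have "poly.coeff (A * B) i = (\<Sum>j<i. poly.coeff A j * poly.coeff B (i - j)) + poly.coeff A i * poly.coeff B 0"
    by (simp add: coeff_mult lessThan_Suc_atMost [symmetric])
  moreover have "\<pi> dvd (\<Sum>j<i. poly.coeff A j * poly.coeff B (i - j))" by (auto intro!: dvd_sum dvd_mult2 lt)
  moreover have "\<not> \<pi> dvd poly.coeff A i * poly.coeff B 0" using i b0 \<pi> by (simp add: prime_elem_dvd_mult_iff)
  ultimately have "\<not> \<pi> dvd poly.coeff (A * B) i" by (simp add: dvd_add_right_iff)
  then have "i \<ge> Polynomial.degree (A * B)" using below not_less by blast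
  moreover have "i \<le> Polynomial.degree A" using i by (intro le_degree) auto
  moreover have "A \<noteq> 0" "B \<noteq> 0" using lead by auto
  ultimately show ?thesis by (simp add: degree_mult_eq)
qed

text \<open>As \<pi>^2 does not divide the constant coefficient, \<pi> divides that of exactly one
  factor, and the other factor is constant. The coefficients lie in a ring with nonunits, so a
  trivial content (\<open>prim\<close>) is what makes this constant a unit.\<close>

lemma eisenstein:
  fixes P :: "'a::idom poly"
  assumes \<pi>: "prime_elem \<pi>" 
    and lead: "\<not> \<pi> dvd Polynomial.lead_coeff P"
    and below: "\<And>i. i < Polynomial.degree P \<Longrightarrow> \<pi> dvd poly.coeff P i"
    and sq: "\<not> \<pi> ^ 2 dvd poly.coeff P 0"
    and deg: "Polynomial.degree P > 0"
    and prim: "\<And>c. (\<And>i. c dvd poly.coeff P i) \<Longrightarrow> c dvd 1"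
  shows "Factorial_Ring.irreducible P"
proof (rule Factorial_Ring.irreducibleI)
  show "P \<noteq> 0" using lead by auto
  show "\<not> P dvd 1" using deg by (auto simp: is_unit_poly_iff)
  have const: "B dvd 1" if P: "P = A * B" and B: "Polynomial.degree B = 0" for A B
  proof -
    obtain b where b: "B = [:b:]" using B degree_eq_zeroE by blast
    have "b dvd poly.coeff P i" for i by (simp add: P b)
    then have "b dvd 1" by (rule prim)
    then show ?thesis by (simp add: b is_unit_const_poly_iff)
  qed
  fix A B assume P: "P = A * B"
  have c0: "poly.coeff P 0 = poly.coeff A 0 * poly.coeff B 0" by (simp add: P coeff_mult)
  have "\<pi> dvd poly.coeff A 0 \<or> \<pi> dvd poly.coeff B 0"
    using below[OF deg] \<pi> by (simp add: c0 prime_elem_dvd_mult_iff)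
  moreover have "\<not> (\<pi> dvd poly.coeff A 0 \<and> \<pi> dvd poly.coeff B 0)"
    using sq by (auto simp: c0 power2_eq_square intro: mult_dvd_mono)
  ultimately consider "\<pi> dvd poly.coeff A 0" "\<not> \<pi> dvd poly.coeff B 0" 
    | "\<pi> dvd poly.coeff B 0" "\<not> \<pi> dvd poly.coeff A 0" by blast
  then show "A dvd 1 \<or> B dvd 1"
  proof cases
    case 1
    then have "Polynomial.degree B = 0" using eisenstein_degree[OF \<pi>, of A B] lead below by (simp add: P)
    then show ?thesis using const[OF P] by simp
  next
    case 2
    then have "Polynomial.degree A = 0" using eisenstein_degree[OF \<pi>, of B A] lead below by (simp add: P mult.commute)
    then show ?thesis using const[of B A] P by (simp add: mult.commute)
  qed
qed

text \<open>Translation of the variable is multiplicative and preserves degrees and constants, so a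
  factorization of \<open>P\<close> without units would translate to one of the shifted
  polynomial.\<close>

lemma irreducible_pcompose_shiftD:
  fixes P :: "'a::idom poly"
  assumes "Factorial_Ring.irreducible (pcompose P [:c, 1:])"
  shows "Factorial_Ring.irreducible P"
proof (rule Factorial_Ring.irreducibleI)
  have unit: "A dvd 1" if u: "pcompose A [:c, 1:] dvd 1" for A :: "'a poly"
  proof -
    obtain a where a: "pcompose A [:c, 1:] = [:a:]" "a dvd 1" using u by (auto simp: is_unit_poly_iff)
    then have "Polynomial.degree A = 0" by (metis degree_pcompose degree_pCons_0 degree_pCons_eq_if one_neq_zero mult.right_neutral One_nat_def pCons_eq_0_iff)
    then obtain b where "A = [:b:]" using degree_eq_zeroE by blast
    with a show ?thesis by (simp add: pcompose_const is_unit_const_poly_iff)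
  qed
  show "P \<noteq> 0" using assms by auto
  show "\<not> P dvd 1" using assms by (auto simp: is_unit_poly_iff pcompose_const Factorial_Ring.irreducible_def)
  fix A B assume "P = A * B"
  then have "pcompose A [:c, 1:] dvd 1 \<or> pcompose B [:c, 1:] dvd 1"
    using assms by (auto simp: pcompose_mult Factorial_Ring.irreducible_def)
  then show "A dvd 1 \<or> B dvd 1" using unit by blast
qed

text \<open>Divisibility by X - q means vanishing at q, and evaluation at q takes values in a
  domain.\<close>

lemma prime_elem_linear:
  fixes q :: "'a::idom"
  shows "prime_elem [:- q, 1:]"
  by (auto simp: prime_elem_def poly_eq_0_iff_dvd[symmetric] is_unit_poly_iff)

section \<open>The quartic and its irreducibility\<close>

text \<open>With A = (x + y)(x + z) and S = y + z + 3x this is A S (y + z) - 3 A^2 - x^2 S^2, which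
  is the relation y + z = - (u + 3 / u) after inserting u = - 3 A / (x S) and clearing
  denominators.\<close>

definition quartic :: "'k::field poly3" where
  "quartic = var_X * var_Y ^ 3 + var_X * var_Z ^ 3 + var_Y ^ 3 * var_Z + var_Y * var_Z ^ 3 - var_Y ^ 2 * var_Z ^ 2
     - 6 * (var_X ^ 2 * var_Y * var_Z) - 9 * (var_X ^ 3 * var_Y) - 9 * (var_X ^ 3 * var_Z) - 12 * var_X ^ 4"

lemma form_quartic: "form 4 quartic"
proof -
  have "form 4 (var_X * var_Y ^ 3)" "form 4 (var_X * var_Z ^ 3)" "form 4 (var_Y ^ 3 * var_Z)"
    "form 4 (var_Y * var_Z ^ 3)" "form 4 (var_Y ^ 2 * var_Z ^ 2)" "form 4 (6 * (var_X ^ 2 * var_Y * var_Z))"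
    "form 4 (9 * (var_X ^ 3 * var_Y))" "form 4 (9 * (var_X ^ 3 * var_Z))" "form 4 (12 * var_X ^ 4)"
    by (rule form_vars form_numeral form_power form_mult form_mult' form_power' | simp)+
  then show ?thesis unfolding quartic_def by (intro form_add form_diff)
qed

definition quartic_fun :: "'a::comm_ring_1 \<Rightarrow> 'a \<Rightarrow> 'a \<Rightarrow> 'a" where
  "quartic_fun x y z = x * y ^ 3 + x * z ^ 3 + y ^ 3 * z + y * z ^ 3 - y ^ 2 * z ^ 2
     - 6 * (x ^ 2 * y * z) - 9 * (x ^ 3 * y) - 9 * (x ^ 3 * z) - 12 * x ^ 4"

lemma ev_quartic: "ring_map g \<Longrightarrow> ev g quartic (x, y, z) = quartic_fun x y z"
  by (simp add: quartic_def quartic_fun_def ev_simps ev_gens)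

lemma quartic_pCons:
  fixes x y :: "'k::field poly poly"
  defines "x \<equiv> [:[:0, 1:]:]" and "y \<equiv> [:0, 1:]"
  shows "quartic = [:x * y ^ 3 - 9 * x ^ 3 * y - 12 * x ^ 4, y ^ 3 - 6 * x ^ 2 * y - 9 * x ^ 3, - (y ^ 2), x + y:]"
proof -
  have v: "var_X = [:x:]" "var_Y = [:y:]" "var_Z = [:0, 1:]" by (simp_all add: var_X_def var_Y_def var_Z_def x_def y_def)
  have c: "[:a:] * [:b:] = [:a * b:]" "[:a:] ^ n = [:a ^ n:]" for a b :: "'k poly poly" and n
    by (simp, induction n) (auto simp: one_pCons)
  show ?thesis unfolding quartic_def v numeral_poly
    by (simp add: c power2_eq_square power3_eq_cube algebra_simps)
qed


text \<open>\<rho> is a branch point of the projection to y. The condition \<rho>^2 different from 3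
  makes it a simple root, \<open>2 * \<rho> + 3\<close> is the corresponding derivative for the
  reversed polynomial, and (2 \<rho> + 3)(\<rho> + 2) will be the obstruction in Eisenstein's
  criterion. Each inequality is read off from a combination with the cubic equation that equals 1, 9
  or 27.\<close>

lemma ex_branch_point:
  assumes "(3::'k::alg_closed_field) \<noteq> 0"
  obtains \<rho> :: "'k::alg_closed_field" where "\<rho> ^ 3 = 9 * \<rho> + 9" "\<rho> \<noteq> 0" "\<rho> ^ 2 \<noteq> 3" "2 * \<rho> + 3 \<noteq> 0" "\<rho> + 2 \<noteq> 0"
proof -
  obtain \<rho> :: 'k where "poly [:-9, -9, 0, 1:] \<rho> = 0"
    using alg_closed_imp_poly_has_root[of "[:-9, -9, 0, 1 :: 'k:]"] by auto
  then have r: "\<rho> ^ 3 = 9 * \<rho> + 9" by (simp add: power3_eq_cube algebra_simps)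
  have "(9::'k) = 3 * 3" by simp
  with assms have nine: "(9::'k) \<noteq> 0" by (metis mult_eq_0_iff)
  have "(27::'k) = 3 * 9" by simp
  with assms nine have n27: "(27::'k) \<noteq> 0" by (metis mult_eq_0_iff)
  have "\<rho> \<noteq> 0" using r nine by auto
  moreover have "2 * \<rho> + 3 \<noteq> 0"
  proof
    assume "2 * \<rho> + 3 = 0"
    moreover have "9 = 8 * (\<rho> ^ 3 - 9 * \<rho> - 9) - (2 * \<rho> + 3) * (4 * \<rho> ^ 2 - 6 * \<rho> - 27)"
      by (simp add: algebra_simps power2_eq_square power3_eq_cube)
    ultimately have "(9::'k) = 0" using r by simp
    with nine show False by simp
  qed
  moreover have "\<rho> ^ 2 \<noteq> 3"
  proof
    assume "\<rho> ^ 2 = 3"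
    with r have "6 * \<rho> + 9 = 0" by (simp add: power2_eq_square power3_eq_cube)
    moreover have "(6 * \<rho> + 9) * (6 * \<rho> - 9) = 36 * \<rho> ^ 2 - 81" by (simp add: algebra_simps power2_eq_square)
    ultimately have "(27::'k) = 0" using \<open>\<rho> ^ 2 = 3\<close> by simp
    with n27 show False by simp
  qed
  moreover have "\<rho> + 2 \<noteq> 0"
  proof
    assume "\<rho> + 2 = 0"
    moreover have "1 = (\<rho> ^ 3 - 9 * \<rho> - 9) - (\<rho> + 2) * (\<rho> ^ 2 - 2 * \<rho> - 5)"
      by (simp add: algebra_simps power2_eq_square power3_eq_cube)
    ultimately have "(1::'k) = 0" using r by simp
    then show False by simp
  qed
  ultimately show thesis using that r by blast
qed

text \<open>
  The line \<open>y = \<rho> x\<close> meets the quartic with multiplicity three at \<open>(1 : \<rho> : 3 / \<rho>)\<close>.  Moving this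
  point to \<open>z = 0\<close> makes Eisenstein's criterion applicable to the prime \<open>y - \<rho> x\<close>.
\<close>

lemma irreducible_quartic:
  assumes three: "(3::'k::alg_closed_field) \<noteq> 0"
  shows "Factorial_Ring.irreducible (quartic :: 'k::alg_closed_field poly3)"
proof -
  obtain \<rho> :: 'k where r: "\<rho> ^ 3 = 9 * \<rho> + 9" "\<rho> \<noteq> 0" "2 * \<rho> + 3 \<noteq> 0" "\<rho> + 2 \<noteq> 0"
    using ex_branch_point[OF three] by metis
  define c where "c = 3 / \<rho>"
  have c: "c * \<rho> = 3" using r(2) by (simp add: c_def)
  have c2: "c ^ 2 = \<rho> - 3 * c" 
  proof -
    have "\<rho> ^ 2 * (c ^ 2 - (\<rho> - 3 * c)) = (c * \<rho>) ^ 2 + 3 * \<rho> * (c * \<rho>) - \<rho> ^ 3"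
      by (simp add: algebra_simps power2_eq_square power3_eq_cube)
    then have "\<rho> ^ 2 * (c ^ 2 - (\<rho> - 3 * c)) = 0" using r(1) c by simp
    with r(2) show ?thesis by simp
  qed
  have "\<rho> * (\<rho> ^ 2 - 3 * c - 9) = \<rho> ^ 3 - 3 * (c * \<rho>) - 9 * \<rho>"
    by (simp add: algebra_simps power2_eq_square power3_eq_cube)
  also have "\<dots> = 0" using r(1) c by simp
  finally have r2: "\<rho> ^ 2 = 3 * c + 9" using r(2) by (simp add: diff_diff_eq)
  define x y :: "'k poly poly" where xy: "x = [:[:0, 1:]:]" "y = [:0, 1:]"
  define \<kappa> where "\<kappa> = [:[:0, c:]:]"
  define q where "q = [:0, \<rho>:]"
  define \<pi> where "\<pi> = [:- q, 1:]"
  \<comment> \<open>The \<open>c\<close> are the coefficients of the quartic as a polynomial in Z,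
    the \<open>d\<close> those after the shift of Z by \<kappa>; the leading coefficient does not
    change.\<close>
  define c0 c1 c2' c3 where cs: "c0 = x * y ^ 3 - 9 * x ^ 3 * y - 12 * x ^ 4" "c1 = y ^ 3 - 6 * x ^ 2 * y - 9 * x ^ 3"
    "c2' = - (y ^ 2)" "c3 = x + y"
  define d0 d1 d2 where ds: "d0 = c0 + c1 * \<kappa> + c2' * \<kappa> ^ 2 + c3 * \<kappa> ^ 3"
    "d1 = c1 + 2 * c2' * \<kappa> + 3 * c3 * \<kappa> ^ 2" "d2 = c2' + 3 * c3 * \<kappa>"
  have "pcompose quartic [:\<kappa>, 1:] = [:d0, d1, d2, c3:]"
    unfolding quartic_pCons ds xy[symmetric] cs
    by (simp add: pcompose_pCons algebra_simps power2_eq_square power3_eq_cube)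
  moreover have "Factorial_Ring.irreducible [:d0, d1, d2, c3:]"
  proof (rule eisenstein)
    have dvd: "\<pi> dvd p \<longleftrightarrow> poly p q = 0" for p by (simp add: \<pi>_def poly_eq_0_iff_dvd)
    define m :: "'k poly" where "m = [:0, 1:]"
    have ev: "poly x q = m" "poly y q = [:\<rho>:] * m" "poly \<kappa> q = [:c:] * m" by (simp_all add: xy \<kappa>_def q_def m_def)
    define R C where "R = [:\<rho>:]" and "C = [:c:]"
    have rr: "R ^ 2 - 3 * C - 9 = 0" "C * R - 3 = 0" "C ^ 2 - R + 3 * C = 0"
      using r2 c c2 by (simp_all add: R_def C_def numeral_poly power2_eq_square algebra_simps)
    have m0: "m \<noteq> 0" by (simp add: m_def)
    have "1 + \<rho> \<noteq> 0"
    proof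
      assume "1 + \<rho> = 0"
      moreover have "1 = (1 + \<rho>) * (\<rho> ^ 2 - \<rho> - 8) - (\<rho> ^ 3 - 9 * \<rho> - 9)"
        by (simp add: algebra_simps power2_eq_square power3_eq_cube)
      ultimately have "(1::'k) = 0" using r(1) by simp
      then show False by simp
    qed
    then have c3: "poly c3 q \<noteq> 0" by (simp add: cs xy q_def)
    note ev' = ds cs poly_add poly_diff poly_mult poly_power poly_minus poly_numeral ev R_def[symmetric] C_def[symmetric]
    \<comment> \<open>Triple contact says that on y = \<rho> x the quartic is the leading
      coefficient times (z - \<kappa>)^3, so the three lower shifted coefficients vanish there. Each
      is written as a combination of the three relations \<open>rr\<close> between \<rho> and
      c.\<close>
    have "poly d2 q = m ^ 2 * (3 * (C * R - 3) - (R ^ 2 - 3 * C - 9))"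
      unfolding ev' by (simp add: algebra_simps power2_eq_square)
    then have d2: "poly d2 q = 0" unfolding rr by simp
    have "poly d1 q = m ^ 3 * (R * (R ^ 2 - 3 * C - 9) + 3 * (C * R - 3) - 2 * (R * (C * R - 3))
        + 3 * (C ^ 2 - R + 3 * C) + 3 * (C * (C * R - 3)))"
      unfolding ev' by (simp add: algebra_simps power2_eq_square power3_eq_cube)
    then have d1: "poly d1 q = 0" unfolding rr by simp
    have "poly d0 q = m ^ 4 * ((1 + C) * (R * (R ^ 2 - 3 * C - 9) + 3 * (C * R - 3)) - (C * R - 3) ^ 2 
        - 2 * (C * R - 3) + C * (C ^ 2 - R + 3 * C) + C ^ 2 * (C * R - 3))"
      unfolding ev' by (simp add: algebra_simps power2_eq_square power3_eq_cube power4_eq_xxxx)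
    then have d0: "poly d0 q = 0" unfolding rr by simp
    note d = d0 d1 d2
    show "prime_elem \<pi>" unfolding \<pi>_def by (rule prime_elem_linear)
    have "c3 \<noteq> 0" using c3 by auto
    then show "\<not> \<pi> dvd Polynomial.lead_coeff [:d0, d1, d2, c3:]" using c3 by (simp add: dvd)
    show "\<pi> dvd poly.coeff [:d0, d1, d2, c3:] i" if "i < Polynomial.degree [:d0, d1, d2, c3:]" for i
    proof -
      have "i < 3" using that \<open>c3 \<noteq> 0\<close> by simp
      then consider "i = 0" | "i = 1" | "i = 2" by linarith
      then show ?thesis using d by cases (auto simp: dvd numeral_2_eq_2)
    qed
    show "Polynomial.degree [:d0, d1, d2, c3:] > 0" using \<open>c3 \<noteq> 0\<close> by simp
    show "\<not> \<pi> ^ 2 dvd poly.coeff [:d0, d1, d2, c3:] 0"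
    proof
      assume "\<pi> ^ 2 dvd poly.coeff [:d0, d1, d2, c3:] 0"
      then obtain e where e: "d0 = \<pi> ^ 2 * e" by auto
      \<comment> \<open>A double factor y - \<rho> x of \<open>d0\<close> would also kill its
        derivative in y at y = \<rho> x. The computation below shows that this derivative is not
        zero.\<close>
      have pd0: "poly (pderiv d0) q = 0" unfolding e by (simp add: pderiv_mult pderiv_power \<pi>_def)
      have pd: "pderiv x = 0" "pderiv y = 1" "pderiv \<kappa> = 0" by (simp_all add: xy \<kappa>_def pderiv_pCons)
      have "pderiv d0 = (3 * x * y ^ 2 - 9 * x ^ 3) + (3 * y ^ 2 - 6 * x ^ 2) * \<kappa> - 2 * y * \<kappa> ^ 2 + \<kappa> ^ 3"
        by (simp add: ds cs pderiv_add pderiv_diff pderiv_minus pderiv_mult pderiv_power pderiv_smult pd numeral_poly pderiv_pCons algebra_simps)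
      then have "poly (pderiv d0) q = m ^ 3 * (3 * R ^ 2 - 9 + (3 * R ^ 2 - 6) * C - 2 * R * C ^ 2 + C ^ 3)"
        by (simp only: ev') (simp add: algebra_simps power2_eq_square power3_eq_cube)
      with pd0 m0 have "3 * R ^ 2 - 9 + (3 * R ^ 2 - 6) * C - 2 * R * C ^ 2 + C ^ 3 = 0" by simp
      then have "3 * \<rho> ^ 2 - 9 + (3 * \<rho> ^ 2 - 6) * c - 2 * \<rho> * c ^ 2 + c ^ 3 = 0"
        by (simp add: R_def C_def numeral_poly power2_eq_square power3_eq_cube mult_ac)
      moreover have "3 * \<rho> ^ 2 - 9 + (3 * \<rho> ^ 2 - 6) * c - 2 * \<rho> * c ^ 2 + c ^ 3 = 3 * (\<rho> ^ 2 - (3 * c + 9))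
          + (3 * \<rho> - 2 * c + 1) * (c * \<rho> - 3) + (c - 3) * (c ^ 2 - (\<rho> - 3 * c)) + 3 * (2 * c + 2 * \<rho> + 7)"
        by (simp add: algebra_simps power2_eq_square power3_eq_cube)
      moreover have z: "\<rho> ^ 2 - (3 * c + 9) = 0" "c * \<rho> - 3 = 0" "c ^ 2 - (\<rho> - 3 * c) = 0" using r2 c c2 by simp_all
      ultimately have "3 * (2 * c + 2 * \<rho> + 7) = 0" by (simp only: z mult_zero_right add_0)
      \<comment> \<open>Multiplication by \<rho> eliminates c through c \<rho> = 3 and leaves a
        quadratic in \<rho> that splits into linear factors.\<close>
      then have "\<rho> * (2 * c + 2 * \<rho> + 7) = 0" using three by (simp only: mult_eq_0_iff) simp
      moreover have "\<rho> * (2 * c + 2 * \<rho> + 7) = 2 * (c * \<rho> - 3) + (2 * \<rho> + 3) * (\<rho> + 2)"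
        by (simp add: algebra_simps)
      ultimately have "(2 * \<rho> + 3) * (\<rho> + 2) = 0" using c by simp
      then show False using three r by simp
    qed
    show "a dvd 1" if "\<And>i. a dvd poly.coeff [:d0, d1, d2, c3:] i" for a
    proof -
      \<comment> \<open>Two coefficients suffice for the content: modulo the prime x + y the
        coefficient \<open>d2\<close> is - y^2, which x + y does not divide.\<close>
      have "a dvd d2" "a dvd c3" using that[of 2] that[of 3] by (auto simp: numeral_2_eq_2 numeral_3_eq_3)
      then have "a dvd d2 - 3 * c3 * \<kappa>" by (intro dvd_diff) auto
      then have y2: "a dvd y ^ 2" by (simp add: ds cs)
      have c3': "c3 = [:- [:0, -1:], 1:]" by (simp add: cs xy)
      have "Factorial_Ring.irreducible c3" unfolding c3' by (intro prime_elem_imp_irreducible prime_elem_linear)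
      then consider "c3 dvd a" | "a dvd 1" using Factorial_Ring.irreducibleD' \<open>a dvd c3\<close> by blast
      then show ?thesis
      proof cases
        case 1
        then have "c3 dvd y ^ 2" using y2 dvd_trans by blast
        then have "poly (y ^ 2) [:0, -1:] = 0" unfolding c3' poly_eq_0_iff_dvd .
        then show ?thesis by (simp add: xy)
      qed
    qed
  qed
  ultimately show ?thesis using irreducible_pcompose_shiftD[of quartic \<kappa>] by simp
qed

section \<open>The twisted cubic model and its map to the quartic\<close>

definition twisted :: "'a::comm_ring_1 \<times> 'a \<times> 'a \<Rightarrow> bool" where
  "twisted u = (case u of (h, a, b) \<Rightarrow> h ^ 3 = b ^ 3 - 9 * a ^ 2 * b - 9 * a ^ 3)"

text \<open>
  \<open>chart1\<close> and \<open>chart2\<close> represent the same rational map by conics; their base points on the cubic are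
  distinct.  \<open>chart_inv\<close> recovers \<open>u = - 3 (y + 1) (z + 1) / (y + z + 3)\<close> from the sum \<open>- (u + 3 / u)\<close>
  and the product \<open>(u\<^sup>3 + 9) / (3 u)\<close> of \<open>y\<close> and \<open>z\<close>.
\<close>

definition chart1 :: "'a::comm_ring_1 \<times> 'a \<times> 'a \<Rightarrow> 'a \<times> 'a \<times> 'a" where
  "chart1 u = (case u of (h, a, b) \<Rightarrow> (a * (h - b), b * (h - b), h * b - h ^ 2 - 3 * a ^ 2))"

definition chart2 :: "'a::comm_ring_1 \<times> 'a \<times> 'a \<Rightarrow> 'a \<times> 'a \<times> 'a" where
  "chart2 u = (case u of (h, a, b) \<Rightarrow>
     (a * (h + 3 * a + 2 * b), b * (h + 3 * a + 2 * b), b ^ 2 - 3 * a ^ 2 - 3 * h * a - h * b))"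

definition chart_inv :: "'a::comm_ring_1 \<times> 'a \<times> 'a \<Rightarrow> 'a \<times> 'a \<times> 'a" where
  "chart_inv v = (case v of (x, y, z) \<Rightarrow>
     (y * (y + z + 3 * x) - 3 * (x + y) * (x + z), x * (y + z + 3 * x), y * (y + z + 3 * x)))"

lemmas chart_defs = twisted_def chart1_def chart2_def chart_inv_def

lemma chart_homogeneous:
  fixes c :: "'a::field"
  shows "chart1 (scale3 c u) = scale3 (c ^ 2) (chart1 u)" "chart2 (scale3 c u) = scale3 (c ^ 2) (chart2 u)"
  "chart_inv (scale3 c u) = scale3 (c ^ 2) (chart_inv u)" "c \<noteq> 0 \<Longrightarrow> twisted (scale3 c u) = twisted u"
proof -
  show "c \<noteq> 0 \<Longrightarrow> twisted (scale3 c u) = twisted u"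
  proof (cases u)
    case (fields h a b)
    assume c: "c \<noteq> 0"
    have "(c * h) ^ 3 = (c * b) ^ 3 - 9 * (c * a) ^ 2 * (c * b) - 9 * (c * a) ^ 3 \<longleftrightarrow>
       c ^ 3 * h ^ 3 = c ^ 3 * (b ^ 3 - 9 * a ^ 2 * b - 9 * a ^ 3)"
      by (simp add: algebra_simps power2_eq_square power3_eq_cube)
    then show ?thesis using c by (simp add: fields twisted_def)
  qed
qed (cases u; simp add: chart_defs algebra_simps power2_eq_square)+

text \<open>The first two coordinates are proportional to (a, b) in both charts. The other two
  minors are a and b times one determinant, and this determinant is the equation of the
  cubic.\<close>

lemma charts_agree:
  fixes u :: "'a::field \<times> 'a \<times> 'a"
  assumes "twisted u" 
  shows "cross_zero (chart1 u) (chart2 u)"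
proof (cases u)
  case (fields h a b)
  have e: "h ^ 3 - (b ^ 3 - 9 * a ^ 2 * b - 9 * a ^ 3) = 0" using assms by (simp add: fields twisted_def)
  have "(h - b) * (b ^ 2 - 3 * a ^ 2 - 3 * h * a - h * b) - (h * b - h ^ 2 - 3 * a ^ 2) * (h + 3 * a + 2 * b)
      = h ^ 3 - (b ^ 3 - 9 * a ^ 2 * b - 9 * a ^ 3)"
    by (simp add: algebra_simps eval_nat_numeral)
  then have "(h - b) * (b ^ 2 - 3 * a ^ 2 - 3 * h * a - h * b) = (h * b - h ^ 2 - 3 * a ^ 2) * (h + 3 * a + 2 * b)"
    unfolding e by simp
  then have "a * ((h - b) * (b ^ 2 - 3 * a ^ 2 - 3 * h * a - h * b)) = a * ((h * b - h ^ 2 - 3 * a ^ 2) * (h + 3 * a + 2 * b))"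
    "b * ((h - b) * (b ^ 2 - 3 * a ^ 2 - 3 * h * a - h * b)) = b * ((h * b - h ^ 2 - 3 * a ^ 2) * (h + 3 * a + 2 * b))"
    by simp_all
  then show ?thesis by (simp add: fields chart_defs cross_zero_def mult_ac)
qed

text \<open>(1 : 0 : 1) is the only base point of \<open>chart1\<close> on the cubic;
  \<open>chart2\<close> sends it to (0 : 1 : 0).\<close>

lemma chart1_zero:
  assumes three: "(3::'a::field) \<noteq> 0" and "twisted u" "chart1 u = (0::'a, 0, 0)" 
  obtains b where "u = (b, 0, b)"
proof -
  obtain h a b where u: "u = (h, a, b)" by (metis prod_cases3)
  have e: "a * (h - b) = 0" "b * (h - b) = 0" "h * b - h ^ 2 - 3 * a ^ 2 = 0" using assms by (auto simp: u chart_defs)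
  have "h = b"
  proof (rule ccontr)
    assume "h \<noteq> b"
    with e have "a = 0" "b = 0" by auto
    with e(3) \<open>h \<noteq> b\<close> show False by auto
  qed
  with e(3) three have "a = 0" by (auto simp: power2_eq_square)
  with u \<open>h = b\<close> that show thesis by blast
qed

lemma charts_nonzero:
  assumes three: "(3::'a::field) \<noteq> 0" and "twisted u" "u \<noteq> (0::'a, 0, 0)" "chart1 u = (0, 0, 0)" 
  shows "chart2 u \<noteq> (0, 0, 0)"
proof -
  obtain b where "u = (b, 0, b)" using chart1_zero assms by metis
  with assms(3) three show ?thesis by (auto simp: chart_defs power2_eq_square)
qed

text \<open>The quartic pulled back along the chart is a multiple of the cubic equation; the long
  factor is the quotient of this polynomial division.\<close>

lemma quartic_chart1:
  assumes "twisted u" "chart1 u = (x, y, z)"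
  shows "quartic_fun x y z = 0"
proof (cases u)
  case (fields h a b)
  have e: "h ^ 3 - (b ^ 3 - 9 * a ^ 2 * b - 9 * a ^ 3) = 0" using assms by (simp add: fields twisted_def)
  have "quartic_fun (a * (h - b)) (b * (h - b)) (h * b - h ^ 2 - 3 * a ^ 2)
      = (h ^ 3 - (b ^ 3 - 9 * a ^ 2 * b - 9 * a ^ 3)) * (- (h ^ 4 * a) - h ^ 4 * b + 4 * h ^ 3 * a * b + 3 * h ^ 3 * b ^ 2 - 3 * h ^ 2 * a ^ 2 * b - 6 * h ^ 2 * a * b ^ 2 - 3 * h ^ 2 * b ^ 3 - 3 * h * a ^ 4 + 6 * h * a ^ 2 * b ^ 2 + 4 * h * a * b ^ 3 + h * b ^ 4 + 3 * a ^ 4 * b - 3 * a ^ 2 * b ^ 3 - a * b ^ 4)"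
    unfolding quartic_fun_def by (simp add: algebra_simps eval_nat_numeral)
  then show ?thesis using assms(2) unfolding e by (auto simp: fields chart1_def)
qed

lemma quartic_chart2:
  assumes "twisted u" "chart2 u = (x, y, z)"
  shows "quartic_fun x y z = 0"
proof (cases u)
  case (fields h a b)
  have e: "h ^ 3 - (b ^ 3 - 9 * a ^ 2 * b - 9 * a ^ 3) = 0" using assms by (simp add: fields twisted_def)
  have "quartic_fun (a * (h + 3 * a + 2 * b)) (b * (h + 3 * a + 2 * b)) (b ^ 2 - 3 * a ^ 2 - 3 * h * a - h * b)
      = (h ^ 3 - (b ^ 3 - 9 * a ^ 2 * b - 9 * a ^ 3)) * (- 12 * h * a ^ 4 - 36 * h * a ^ 3 * b - 39 * h * a ^ 2 * b ^ 2 - 18 * h * a * b ^ 3 - 3 * h * b ^ 4 - 36 * a ^ 5 - 132 * a ^ 4 * b - 189 * a ^ 3 * b ^ 2 - 132 * a ^ 2 * b ^ 3 - 45 * a * b ^ 4 - 6 * b ^ 5)"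
    unfolding quartic_fun_def by (simp add: algebra_simps eval_nat_numeral)
  then show ?thesis using assms(2) unfolding e by (auto simp: fields chart2_def)
qed


lemma twisted_chart_inv:
  assumes "quartic_fun x y z = 0"
  shows "twisted (chart_inv (x, y, z))"
proof -
  have "(y * (y + z + 3 * x) - 3 * (x + y) * (x + z)) ^ 3 - ((y * (y + z + 3 * x)) ^ 3
      - 9 * (x * (y + z + 3 * x)) ^ 2 * (y * (y + z + 3 * x)) - 9 * (x * (y + z + 3 * x)) ^ 3)
      = quartic_fun x y z * (- 9 * (x + y) * (2 * x + y))"
    unfolding quartic_fun_def by (simp add: algebra_simps eval_nat_numeral)
  then show ?thesis unfolding assms by (simp add: chart_defs)
qed

lemma chart1_chart_inv:
  assumes "quartic_fun x y z = 0"
  shows "chart1 (chart_inv (x, y, z)) = scale3 (- 3 * (x + y) * (x + z) * (y + z + 3 * x)) (x, y, z)"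
proof -
  have "(y * (y + z + 3 * x) - 3 * (x + y) * (x + z)) * (y * (y + z + 3 * x))
      - (y * (y + z + 3 * x) - 3 * (x + y) * (x + z)) ^ 2 - 3 * (x * (y + z + 3 * x)) ^ 2
      = - 3 * (x + y) * (x + z) * (y + z + 3 * x) * z + 3 * quartic_fun x y z"
    unfolding quartic_fun_def by (simp add: algebra_simps eval_nat_numeral)
  then have "(y * (y + z + 3 * x) - 3 * (x + y) * (x + z)) * (y * (y + z + 3 * x))
      - (y * (y + z + 3 * x) - 3 * (x + y) * (x + z)) ^ 2 - 3 * (x * (y + z + 3 * x)) ^ 2
      = - 3 * (x + y) * (x + z) * (y + z + 3 * x) * z"
    unfolding assms by simp
  moreover have "w * (y + z + 3 * x) * (y * (y + z + 3 * x) - 3 * (x + y) * (x + z) - y * (y + z + 3 * x))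
      = - 3 * (x + y) * (x + z) * (y + z + 3 * x) * w" for w
    by (simp add: algebra_simps)
  ultimately show ?thesis by (simp only: chart_defs prod.case scale3.simps)
qed

lemma chart_inv_chart1:
  assumes "twisted (h, a, b)" 
  shows "chart_inv (chart1 (h, a, b)) = 
    scale3 ((h - b) * (b * (h - b) + (h * b - h ^ 2 - 3 * a ^ 2) + 3 * (a * (h - b)))) (h, a, b)"
proof -
  have e: "h ^ 3 - (b ^ 3 - 9 * a ^ 2 * b - 9 * a ^ 3) = 0" using assms by (simp add: twisted_def)
  define s where "s = b * (h - b) + (h * b - h ^ 2 - 3 * a ^ 2) + 3 * (a * (h - b))"
  have "b * (h - b) * s - 3 * (a * (h - b) + b * (h - b)) * (a * (h - b) + (h * b - h ^ 2 - 3 * a ^ 2))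
     = h * (h - b) * s + (h ^ 3 - (b ^ 3 - 9 * a ^ 2 * b - 9 * a ^ 3)) * (h - b)"
    unfolding s_def by (simp add: algebra_simps eval_nat_numeral)
  then have "b * (h - b) * s - 3 * (a * (h - b) + b * (h - b)) * (a * (h - b) + (h * b - h ^ 2 - 3 * a ^ 2))
     = (h - b) * s * h"
    unfolding e by (simp add: mult_ac)
  then show ?thesis by (simp only: chart_defs prod.case scale3.simps s_def[symmetric]) (simp add: mult_ac)
qed

text \<open>When y + z + 3x = 0, \<open>chart_inv\<close> degenerates to (-3 (x + y)(x + z), 0, 0).
  This triple still satisfies the cubic equation, which then says that its cube is zero.\<close>

lemma quartic_sum_zero:
  fixes x y z :: "'a::field"
  assumes "quartic_fun x y z = 0" "y + z + 3 * x = 0" "(3::'a::field) \<noteq> 0"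
  shows "(x + y) * (x + z) = (0::'a)"
proof -
  have "twisted (- 3 * ((x + y) * (x + z)), 0, 0)"
  proof -
    have "chart_inv (x, y, z) = (- 3 * ((x + y) * (x + z)), 0, 0)"
      by (simp only: chart_inv_def prod.case assms(2)) (simp add: algebra_simps)
    then show ?thesis using twisted_chart_inv[OF assms(1)] by simp
  qed
  moreover have "p = 0" if "twisted (- 3 * p, 0, 0)" for p :: 'a
  proof -
    have "27 * p ^ 3 = 0" using that by (simp add: twisted_def power_mult_distrib)
    moreover have "(27::'a) \<noteq> 0"
    proof
      assume "(27::'a) = 0"
      then have "(3::'a) ^ 3 = 0" by simp
      with assms(3) show False unfolding power_eq_0_iff by blast
    qed
    ultimately show ?thesis by simp
  qed
  ultimately show ?thesis by blast
qed

text \<open>The coefficients of z^3 and y^3 in the quartic are x + y and x + z, so these lines are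
  the tangents at (0 : 0 : 1) and (0 : 1 : 0). Each meets the quartic only in its point of contact
  and in one double point.\<close>

lemma quartic_tangents:
  "quartic_fun x (- x) z = - (x ^ 2 * (2 * x + z) ^ 2)" "quartic_fun x y (- x) = - (x ^ 2 * (2 * x + y) ^ 2)"
  unfolding quartic_fun_def by (simp_all add: algebra_simps eval_nat_numeral)

text \<open>Away from the two tangent lines \<open>chart_inv\<close> gives a preimage. The lines
  contain only four points of the quartic, and these get explicit preimages.\<close>

lemma quartic_point_has_preimage:
  fixes x y z \<omega> :: "'a::field"
  assumes three: "(3::'a::field) \<noteq> 0" and om: "\<omega> ^ 2 + \<omega> + 1 = (0::'a)"
    and q: "quartic_fun x y z = 0" and v: "(x, y, z) \<noteq> (0, 0, 0)"
  obtains u s where "twisted u" "u \<noteq> (0, 0, 0)" "s \<noteq> 0" "chart1 u = scale3 s (x, y, z) \<or> chart2 u = scale3 s (x, y, z)"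
proof -
  have "\<omega> ^ 3 - 1 = (\<omega> - 1) * (\<omega> ^ 2 + \<omega> + 1)" by (simp add: algebra_simps eval_nat_numeral)
  then have om3: "\<omega> ^ 3 = 1" unfolding om by simp
  show thesis
  proof (cases "x + y = 0")
    case True
    then have y: "y = - x" by (simp add: eq_neg_iff_add_eq_0 add.commute)
    show thesis
    proof (cases "x = 0")
      case True
      then have "z \<noteq> 0" using v y by auto
      show thesis
        by (rule that[of "(1, -1, 1)" "- 3 / z"]) (use three \<open>z \<noteq> 0\<close> True y in \<open>auto simp: chart_defs\<close>)
    next
      case False
      \<comment> \<open>This is the double point (1 : -1 : -2). There y + z + 3 = 0, which in terms
        of u reads u^2 - 3u + 3 = 0. The root u = 1 - \<omega> gives the preimage with b = y = -1
        and h = y + u = - \<omega>.\<close>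
      then have "z = - 2 * x" using q quartic_tangents(1)[of x z] by (simp add: y add_eq_0_iff)
      show thesis
        by (rule that[of "(- \<omega>, 1, -1)" "(1 - \<omega>) / x"]) (use three om3 om False y \<open>z = - 2 * x\<close> in \<open>auto simp: chart_defs\<close>)
    qed
  next
    case xy: False
    show thesis
    proof (cases "x + z = 0")
      case True
      then have z: "z = - x" by (simp add: eq_neg_iff_add_eq_0 add.commute)
      show thesis
      proof (cases "x = 0")
        case True
        then have "y \<noteq> 0" using v z by auto
        show thesis
          by (rule that[of "(1, 0, 1)" "3 / y"]) (use three \<open>y \<noteq> 0\<close> True z in \<open>auto simp: chart_defs\<close>)
      next
        case False
        \<comment> \<open>The other double point belongs to the same u = 1 - \<omega> with y = -2,
          hence h = y + u = -1 - \<omega>.\<close>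
        then have "y = - 2 * x" using q quartic_tangents(2)[of x y] by (simp add: z add_eq_0_iff)
        have w2: "\<omega> * \<omega> = - 1 - \<omega>" using om by (simp add: power2_eq_square algebra_simps eq_neg_iff_add_eq_0)
        have w3: "\<omega> * (\<omega> * \<omega>) = 1" using om3 by (simp add: power3_eq_cube mult_ac)
        have "twisted (- 1 - \<omega>, 1, - 2)" by (simp add: chart_defs algebra_simps eval_nat_numeral w2 w3)
        moreover have "chart1 (- 1 - \<omega>, 1, - 2) = scale3 ((1 - \<omega>) / x) (x, y, z)"
          using False by (simp add: chart_defs z \<open>y = - 2 * x\<close>) (simp add: algebra_simps power2_eq_square w2)
        moreover have "\<omega> \<noteq> 1" using om three by auto
        ultimately show thesis using that[of "(- 1 - \<omega>, 1, - 2)" "(1 - \<omega>) / x"] False by auto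
      qed
    next
      case xz: False
      have s: "y + z + 3 * x \<noteq> 0" using quartic_sum_zero[OF q _ three] xy xz by auto
      show thesis
      proof (rule that)
        show "twisted (chart_inv (x, y, z))" by (rule twisted_chart_inv[OF q])
        show "chart_inv (x, y, z) \<noteq> (0, 0, 0)" using s xy by (auto simp: chart_inv_def)
        show "- 3 * (x + y) * (x + z) * (y + z + 3 * x) \<noteq> 0"
          using s xy xz three by (metis mult_eq_0_iff neg_equal_0_iff_equal)
      qed (use chart1_chart_inv[OF q] in blast)
    qed
  qed
qed

section \<open>The morphism from the Fermat cubic\<close>

definition proj_image :: "'a::field \<times> 'a \<times> 'a \<Rightarrow> 'a point" where
  "proj_image u = proj_point (if chart1 u \<noteq> (0, 0, 0) then chart1 u else chart2 u)"

lemma scale3_eq_0: "c \<noteq> 0 \<Longrightarrow> scale3 c v = (0, 0, 0) \<longleftrightarrow> v = (0, 0, 0)"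
  by (cases v) auto

lemma proj_image_scale: 
  assumes "c \<noteq> 0" shows "proj_image (scale3 c u) = proj_image u"
proof -
  have c2: "c ^ 2 \<noteq> 0" using assms by simp
  show ?thesis
    unfolding proj_image_def chart_homogeneous scale3_eq_0[OF c2]
    by (cases "chart1 u = (0, 0, 0)") (simp_all only: if_True if_False simp_thms proj_point_scale[OF c2])
qed

lemma proj_image_eq:
  assumes "twisted u"
  shows "chart1 u \<noteq> (0, 0, 0) \<Longrightarrow> proj_image u = proj_point (chart1 u)"
    "chart2 u \<noteq> (0, 0, 0) \<Longrightarrow> proj_image u = proj_point (chart2 u)"
proof -
  assume 2: "chart2 u \<noteq> (0, 0, 0)"
  show "proj_image u = proj_point (chart2 u)"
  proof (cases "chart1 u = (0, 0, 0)")
    case False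
    then obtain s where "s \<noteq> 0" "chart1 u = scale3 s (chart2 u)"
      using cross_zero_imp[OF charts_agree[OF assms] False 2] by blast
    then have "proj_point (chart1 u) = proj_point (chart2 u)" by (metis proj_point_scale)
    with False show ?thesis unfolding proj_image_def by (simp only: if_True simp_thms)
  next
    case True
    then show ?thesis unfolding proj_image_def by (simp only: if_False simp_thms)
  qed
qed (simp only: proj_image_def if_True if_False simp_thms not_False_eq_True)


lemma proj_image_cases:
  assumes "(3::'a::field) \<noteq> 0" "twisted u" "u \<noteq> (0::'a, 0, 0)"
  obtains t where "t \<noteq> (0, 0, 0)" "proj_image u = proj_point t" "t = chart1 u \<or> t = chart2 u"
proof (cases "chart1 u = (0, 0, 0)")
  case True
  then show ?thesis using charts_nonzero[OF assms] proj_image_eq(2)[OF assms(2)] that by blast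
next
  case False
  then show ?thesis using proj_image_eq(1)[OF assms(2)] that by blast
qed

locale ninth_root =
  fixes w :: "'k::alg_closed_field"
  assumes w: "w ^ 6 + w ^ 3 + 1 = 0" and three: "(3::'k) \<noteq> 0"
begin

definition to_twisted :: "'k \<times> 'k \<times> 'k \<Rightarrow> 'k \<times> 'k \<times> 'k" where
  "to_twisted v = (case v of (x, y, z) \<Rightarrow>
     (w ^ 2 * x, (w + 2 * w ^ 4) / 3 * z - (1 + 2 * w ^ 3) / 3 * y, (1 + w ^ 3) * y - w ^ 4 * z))"

text \<open>The last two entries are linear forms whose cubes sum to - w^3 (b^3 - 9 a^2 b - 9 a^3).
  The factor w^3 is matched by the first entry because (w^7)^3 = w^21 = w^3; this is where a ninth
  root of unity is used.\<close>

definition from_twisted :: "'k \<times> 'k \<times> 'k \<Rightarrow> 'k \<times> 'k \<times> 'k" where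
  "from_twisted u = (case u of (h, a, b) \<Rightarrow>
     (w ^ 7 * h, (2 + w ^ 3) * a + b, - (2 * w ^ 2 + w ^ 5) * a - (w ^ 2 + w ^ 5) * b))"

lemma w9: "w ^ 9 = 1"
proof -
  have "w ^ 9 - 1 = (w ^ 3 - 1) * (w ^ 6 + w ^ 3 + 1)" by (simp add: algebra_simps eval_nat_numeral)
  then show ?thesis unfolding w by simp
qed

lemma w_nonzero: "w \<noteq> 0"
  using w9 by auto

lemma from_to_twisted: "from_twisted (to_twisted v) = v"
proof (cases v)
  case (fields x y z)
  have 1: "w ^ 7 * (w ^ 2 * x) = w ^ 9 * x" by (simp add: eval_nat_numeral)
  have cancel: "p = q" if "3 * p = 3 * q" for p q :: 'k using that three by simp
  define \<alpha> where "\<alpha> = (w + 2 * w ^ 4) / 3 * z - (1 + 2 * w ^ 3) / 3 * y"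
  have \<alpha>: "3 * \<alpha> = (w + 2 * w ^ 4) * z - (1 + 2 * w ^ 3) * y" using three by (simp add: \<alpha>_def right_diff_distrib)
  have "3 * ((2 + w ^ 3) * \<alpha> + ((1 + w ^ 3) * y - w ^ 4 * z)) = (2 + w ^ 3) * (3 * \<alpha>) + 3 * ((1 + w ^ 3) * y - w ^ 4 * z)"
    by (simp add: algebra_simps)
  also have "\<dots> = 3 * y + (w ^ 6 + w ^ 3 + 1) * (2 * w * z - 2 * y)"
    unfolding \<alpha> by (simp add: algebra_simps eval_nat_numeral)
  finally have 2: "(2 + w ^ 3) * \<alpha> + ((1 + w ^ 3) * y - w ^ 4 * z) = y"
    unfolding w mult_zero_left add_0_right by (rule cancel)
  have "3 * (- (2 * w ^ 2 + w ^ 5) * \<alpha> - (w ^ 2 + w ^ 5) * ((1 + w ^ 3) * y - w ^ 4 * z))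
     = - (2 * w ^ 2 + w ^ 5) * (3 * \<alpha>) - 3 * (w ^ 2 + w ^ 5) * ((1 + w ^ 3) * y - w ^ 4 * z)"
    by (simp add: algebra_simps)
  also have "\<dots> = 3 * z + (w ^ 6 + w ^ 3 + 1) * (w ^ 3 * z - w ^ 2 * y - 3 * z)"
    unfolding \<alpha> by (simp add: algebra_simps eval_nat_numeral)
  finally have 3: "- (2 * w ^ 2 + w ^ 5) * \<alpha> - (w ^ 2 + w ^ 5) * ((1 + w ^ 3) * y - w ^ 4 * z) = z"
    unfolding w mult_zero_left add_0_right by (rule cancel)
  show ?thesis using 1 2 3 by (simp only: fields to_twisted_def from_twisted_def prod.case w9 mult_1 \<alpha>_def)
qed

lemma to_from_twisted: "to_twisted (from_twisted u) = u"
proof (cases u)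
  case (fields h a b)
  have 1: "w ^ 2 * (w ^ 7 * h) = w ^ 9 * h" by (simp add: eval_nat_numeral)
  have "(w + 2 * w ^ 4) * (- (2 * w ^ 2 + w ^ 5) * a - (w ^ 2 + w ^ 5) * b) - (1 + 2 * w ^ 3) * ((2 + w ^ 3) * a + b)
     = 3 * a + (w ^ 6 + w ^ 3 + 1) * (- 2 * w ^ 3 * a - 2 * w ^ 3 * b - 5 * a - b)"
    by (simp add: algebra_simps eval_nat_numeral)
  then have 2: "(w + 2 * w ^ 4) / 3 * (- (2 * w ^ 2 + w ^ 5) * a - (w ^ 2 + w ^ 5) * b) - (1 + 2 * w ^ 3) / 3 * ((2 + w ^ 3) * a + b) = a"
    unfolding w using three by (simp add: divide_simps)
  have "(1 + w ^ 3) * ((2 + w ^ 3) * a + b) - w ^ 4 * (- (2 * w ^ 2 + w ^ 5) * a - (w ^ 2 + w ^ 5) * b)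
     = b + (w ^ 6 + w ^ 3 + 1) * (w ^ 3 * a + w ^ 3 * b + 2 * a)"
    by (simp add: algebra_simps eval_nat_numeral)
  then have 3: "(1 + w ^ 3) * ((2 + w ^ 3) * a + b) - w ^ 4 * (- (2 * w ^ 2 + w ^ 5) * a - (w ^ 2 + w ^ 5) * b) = b"
    unfolding w by simp
  show ?thesis using 1 2 3 by (simp only: fields to_twisted_def from_twisted_def prod.case w9 mult_1)
qed

lemma fermat_from_twisted: 
  assumes "from_twisted u = (x, y, z)"
  shows "x ^ 3 + y ^ 3 + z ^ 3 = 0 \<longleftrightarrow> twisted u"
proof -
  obtain h a b where u: "u = (h, a, b)" by (metis prod_cases3)
  have "(w ^ 7 * h) ^ 3 = (w ^ 9) ^ 2 * w ^ 3 * h ^ 3" by (simp add: algebra_simps eval_nat_numeral)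
  then have 1: "(w ^ 7 * h) ^ 3 = w ^ 3 * h ^ 3" unfolding w9 by simp
  have "((2 + w ^ 3) * a + b) ^ 3 + (- (2 * w ^ 2 + w ^ 5) * a - (w ^ 2 + w ^ 5) * b) ^ 3
    = - (w ^ 3 * (b ^ 3 - 9 * a ^ 2 * b - 9 * a ^ 3)) + (w ^ 6 + w ^ 3 + 1) * (- (w ^ 9 * a ^ 3) - 3 * w ^ 9 * a ^ 2 * b - 3 * w ^ 9 * a * b ^ 2 - w ^ 9 * b ^ 3 - 5 * w ^ 6 * a ^ 3 - 12 * w ^ 6 * a ^ 2 * b - 9 * w ^ 6 * a * b ^ 2 - 2 * w ^ 6 * b ^ 3 - 5 * w ^ 3 * a ^ 3 - 9 * w ^ 3 * a ^ 2 * b - 3 * w ^ 3 * a * b ^ 2 + 8 * a ^ 3 + 12 * a ^ 2 * b + 6 * a * b ^ 2 + b ^ 3)"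
    by (simp add: algebra_simps eval_nat_numeral)
  then have 2: "((2 + w ^ 3) * a + b) ^ 3 + (- (2 * w ^ 2 + w ^ 5) * a - (w ^ 2 + w ^ 5) * b) ^ 3
    = - (w ^ 3 * (b ^ 3 - 9 * a ^ 2 * b - 9 * a ^ 3))" unfolding w by simp
  have "x ^ 3 + y ^ 3 + z ^ 3 = w ^ 3 * (h ^ 3 - (b ^ 3 - 9 * a ^ 2 * b - 9 * a ^ 3))"
    using assms 1 2 by (auto simp: u from_twisted_def right_diff_distrib add.assoc)
  then show ?thesis using w_nonzero by (simp add: u twisted_def)
qed

lemma fermat_iff_twisted: "x ^ 3 + y ^ 3 + z ^ 3 = 0 \<longleftrightarrow> twisted (to_twisted (x, y, z))"
  using fermat_from_twisted[of "to_twisted (x, y, z)"] by (simp add: from_to_twisted)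

lemma to_twisted_scale: "to_twisted (scale3 c v) = scale3 c (to_twisted v)"
  by (cases v) (simp add: to_twisted_def algebra_simps)

lemma from_twisted_scale: "from_twisted (scale3 c v) = scale3 c (from_twisted v)"
  by (cases v) (simp add: from_twisted_def algebra_simps)

lemma from_twisted_0: "from_twisted (0, 0, 0) = (0, 0, 0)"
  by (simp add: from_twisted_def)

lemma to_twisted_eq_0: "to_twisted v = (0, 0, 0) \<longleftrightarrow> v = (0, 0, 0)"
  using from_to_twisted[of v] from_twisted_0 by (auto simp: to_twisted_def)

lemma from_twisted_eq_0: "from_twisted v = (0, 0, 0) \<longleftrightarrow> v = (0, 0, 0)"
  using to_from_twisted[of v] from_twisted_0 by (auto simp: to_twisted_def)

definition fermat_form :: "'k poly3" where
  "fermat_form = var_X ^ 3 + var_Y ^ 3 + var_Z ^ 3"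

lemma form_fermat: "form 3 fermat_form"
  unfolding fermat_form_def by (intro form_add; rule form_power'[OF form_vars(1)] form_power'[OF form_vars(2)] form_power'[OF form_vars(3)]; simp)

definition fermat_curve :: "'k point set" where "fermat_curve = zero_locus fermat_form"

lemma proj_point_in_fermat_curve: 
  assumes "v \<noteq> (0, 0, 0)" shows "proj_point v \<in> fermat_curve \<longleftrightarrow> twisted (to_twisted v)"
  unfolding fermat_curve_def proj_point_zero_locus[OF form_fermat assms] 
  by (cases v) (simp add: fermat_form_def eval3_simps eval3_gens fermat_iff_twisted)

lemma fermat_curve_cases:
  assumes "P \<in> fermat_curve"
  obtains v where "v \<noteq> (0, 0, 0)" "P = proj_point v" "twisted (to_twisted v)"
  using assms zero_locusE[OF form_fermat] proj_point_in_fermat_curve unfolding fermat_curve_def by metis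

text \<open>A point is a set of triples, so a representative is chosen; the coordinate change and
  the charts are homogeneous, and the choice does not matter (\<open>\<phi>_proj_point\<close>). The
  same holds for \<open>\<psi>\<close>.\<close>

definition \<phi> :: "'k point \<Rightarrow> 'k point" where
  "\<phi> P = proj_image (to_twisted (SOME v. v \<in> P))"

lemma \<phi>_proj_point: "\<phi> (proj_point v) = proj_image (to_twisted v)"
proof -
  have "(SOME v'. v' \<in> proj_point v) \<in> proj_point v" using proj_point_self by (rule someI)
  then obtain c where "c \<noteq> 0" "(SOME v'. v' \<in> proj_point v) = scale3 c v" by (auto simp: proj_point_def)
  then show ?thesis by (simp add: \<phi>_def to_twisted_scale proj_image_scale)
qed

definition \<psi> :: "'k point \<Rightarrow> 'k point" where
  "\<psi> P = proj_point (from_twisted (chart_inv (SOME v. v \<in> P)))"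

lemma \<psi>_proj_point: "\<psi> (proj_point v) = proj_point (from_twisted (chart_inv v))"
proof -
  have "(SOME v'. v' \<in> proj_point v) \<in> proj_point v" using proj_point_self by (rule someI)
  then obtain c where "c \<noteq> 0" "(SOME v'. v' \<in> proj_point v) = scale3 c v" by (auto simp: proj_point_def)
  then show ?thesis by (simp add: \<psi>_def chart_homogeneous from_twisted_scale proj_point_scale)
qed

text \<open>Equality, not just inclusion, is needed: \<open>curve_equation\<close> demands the full
  zero locus, and vanishing on the quartic will be tested through points of the cubic.\<close>

lemma image_\<phi>: "\<phi> ` fermat_curve = zero_locus quartic"
proof (intro equalityI subsetI)
  fix Q assume "Q \<in> \<phi> ` fermat_curve"
  then obtain P where P: "P \<in> fermat_curve" "Q = \<phi> P" by blast
  obtain v where v: "v \<noteq> (0, 0, 0)" "P = proj_point v" "twisted (to_twisted v)" using fermat_curve_cases[OF P(1)] by blast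
  define u where "u = to_twisted v"
  have u: "u \<noteq> (0, 0, 0)" "twisted u" "Q = proj_image u"
    unfolding u_def to_twisted_eq_0 P(2) v(2) \<phi>_proj_point using v(1,3) by simp_all
  obtain t where t: "t \<noteq> (0, 0, 0)" "Q = proj_point t" "t = chart1 u \<or> t = chart2 u"
    using proj_image_cases[OF three u(2,1)] u(3) by blast
  obtain x y z where xyz: "t = (x, y, z)" by (metis prod_cases3)
  have "quartic_fun x y z = 0" using t(3) quartic_chart1[OF u(2)] quartic_chart2[OF u(2)] xyz by auto
  then show "Q \<in> zero_locus quartic"
    using t(1,2) by (simp add: proj_point_zero_locus[OF form_quartic] xyz eval3_eq_ev ev_quartic ring_map_id)
next
  fix Q assume "Q \<in> zero_locus (quartic :: 'k poly3)"
  then obtain v where v: "v \<noteq> (0, 0, 0)" "Q = proj_point v" "eval3 quartic v = 0" using zero_locusE[OF form_quartic] by blast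
  obtain x y z where xyz: "v = (x, y, z)" by (metis prod_cases3)
  have q: "quartic_fun x y z = 0" using v(3) by (simp add: xyz eval3_eq_ev ev_quartic ring_map_id)
  have "(w ^ 3) ^ 2 + w ^ 3 + 1 = 0" using w by (simp add: eval_nat_numeral mult.assoc)
  from quartic_point_has_preimage[OF three this q] v(1) xyz obtain u s where u: "twisted u" "u \<noteq> (0, 0, 0)" "s \<noteq> 0" 
    "chart1 u = scale3 s v \<or> chart2 u = scale3 s v" by blast
  have "scale3 s v \<noteq> (0, 0, 0)" using scale3_eq_0[OF u(3)] v(1) by blast
  then have "Q = proj_image u" 
    using u(4) proj_image_eq[OF u(1)] v(2) proj_point_scale[OF u(3), of v] by presburger
  then have "Q = \<phi> (proj_point (from_twisted u))" by (simp add: \<phi>_proj_point to_from_twisted)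
  moreover have "proj_point (from_twisted u) \<in> fermat_curve"
    using u by (simp add: proj_point_in_fermat_curve from_twisted_eq_0 to_from_twisted)
  ultimately show "Q \<in> \<phi> ` fermat_curve" by blast
qed

end

section \<open>Morphisms given by triples of forms\<close>

text \<open>For the open neighbourhood one takes as \<open>N\<close> a coordinate form that is
  nonzero at the point: where \<open>N\<close> does not vanish, neither does the triple.\<close>

lemma morphism_to_P2I:
  assumes "\<And>P. P \<in> U \<Longrightarrow> \<exists>d G1 G2 G3 v. form d G1 \<and> form d G2 \<and> form d G3 \<and> 
      P = proj_point v \<and> (eval3 G1 v, eval3 G2 v, eval3 G3 v) \<noteq> (0, 0, 0) \<and>
      (\<forall>v. v \<noteq> (0, 0, 0) \<longrightarrow> proj_point v \<in> U \<longrightarrow> (eval3 G1 v, eval3 G2 v, eval3 G3 v) \<noteq> (0, 0, 0) \<longrightarrow>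
        f (proj_point v) = proj_point (eval3 G1 v, eval3 G2 v, eval3 G3 v))"
  shows "morphism_to_P2 U f"
  unfolding morphism_to_P2_def
proof
  fix P assume "P \<in> U"
  then obtain d G1 G2 G3 v where G: "form d G1" "form d G2" "form d G3" "P = proj_point v"
      "(eval3 G1 v, eval3 G2 v, eval3 G3 v) \<noteq> (0, 0, 0)"
      and f: "\<And>v. v \<noteq> (0, 0, 0) \<Longrightarrow> proj_point v \<in> U \<Longrightarrow> (eval3 G1 v, eval3 G2 v, eval3 G3 v) \<noteq> (0, 0, 0) \<Longrightarrow>
        f (proj_point v) = proj_point (eval3 G1 v, eval3 G2 v, eval3 G3 v)"
    using assms by blast
  from G(5) have "eval3 G1 v \<noteq> 0 \<or> eval3 G2 v \<noteq> 0 \<or> eval3 G3 v \<noteq> 0" by simp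
  then obtain N where N: "N = G1 \<or> N = G2 \<or> N = G3" "eval3 N v \<noteq> 0" by blast
  have fN: "form d N" using N(1) G(1-3) by blast
  have nz: "(eval3 G1 v, eval3 G2 v, eval3 G3 v) \<noteq> (0, 0, 0)" if "eval3 N v \<noteq> 0" for v
    using that N(1) by (metis prod.inject)
  have nv: "\<not> vanishes_at N P" unfolding G(4) vanishes_at_proj_point[OF fN] by (rule N(2))
  show "\<exists>e N d G1 G2 G3. form e N \<and> \<not> vanishes_at N P \<and> form d G1 \<and> form d G2 \<and> form d G3 \<and>
      (\<forall>v. v \<noteq> (0, 0, 0) \<longrightarrow> proj_point v \<in> U \<longrightarrow> eval3 N v \<noteq> 0 \<longrightarrow>
        (eval3 G1 v, eval3 G2 v, eval3 G3 v) \<noteq> (0, 0, 0) \<and>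
        f (proj_point v) = proj_point (eval3 G1 v, eval3 G2 v, eval3 G3 v))"
    by (rule exI[of _ d], rule exI[of _ N], rule exI[of _ d], rule exI[of _ G1], rule exI[of _ G2], rule exI[of _ G3])
      (intro conjI allI impI fN nv G(1-3) nz f)
qed

abbreviation eval_triple :: "'k::field poly3 \<times> 'k poly3 \<times> 'k poly3 \<Rightarrow> 'k \<times> 'k \<times> 'k \<Rightarrow> 'k \<times> 'k \<times> 'k" where
  "eval_triple G v \<equiv> (case G of (G1, G2, G3) \<Rightarrow> (eval3 G1 v, eval3 G2 v, eval3 G3 v))"

text \<open>The charts are polymorphic in the ring, so applied to a triple of forms they yield the
  triple of forms that describes the composed map.\<close>

lemma eval_triple_chart:
  "eval_triple (chart1 u) v = chart1 (eval_triple u v)" "eval_triple (chart2 u) v = chart2 (eval_triple u v)"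
  "eval_triple (chart_inv u) v = chart_inv (eval_triple u v)"
  by (cases u; simp add: chart_defs eval3_simps)+

definition form_triple :: "nat \<Rightarrow> 'k::field poly3 \<times> 'k poly3 \<times> 'k poly3 \<Rightarrow> bool" where
  "form_triple d G = (case G of (G1, G2, G3) \<Rightarrow> form d G1 \<and> form d G2 \<and> form d G3)"

lemma form_triple_chart: 
  assumes "form_triple 1 u"
  shows "form_triple 2 (chart1 u)" "form_triple 2 (chart2 u)" "form_triple 2 (chart_inv u)"
proof -
  obtain h a b where u: "u = (h, a, b)" by (metis prod_cases3)
  have f: "form 1 h" "form 1 a" "form 1 b" using assms by (auto simp: u form_triple_def)
  have m: "form 2 (p * q)" if "form 1 p" "form 1 q" for p q :: "'a poly3" using form_mult[OF that] by (simp add: numeral_2_eq_2)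
  have c: "form d (numeral n * p)" if "form d p" for p :: "'a poly3" and n d using form_mult[OF form_numeral that] by simp
  have s: "form 1 (h + 3 * a + 2 * b)" "form 1 (a + b + 3 * h)" "form 1 (h + a)" "form 1 (h + b)" "form 1 (h - b)"
    by (intro form_add form_diff c f)+
  have q: "form 2 (3 * (p * q))" if "form 1 p" "form 1 q" for p q :: "'a poly3" by (rule c[OF m[OF that]])
  show "form_triple 2 (chart1 u)"
    unfolding form_triple_def u chart1_def prod.case power2_eq_square
    by (intro conjI) (rule m[OF f(2) s(5)] m[OF f(3) s(5)] form_diff[OF form_diff[OF m[OF f(1,3)] m[OF f(1,1)]] q[OF f(2,2)]])+
  show "form_triple 2 (chart2 u)"
    unfolding form_triple_def u chart2_def prod.case power2_eq_square mult.assoc[of 3]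
    by (intro conjI) (rule m[OF f(2) s(1)] m[OF f(3) s(1)]
      form_diff[OF form_diff[OF form_diff[OF m[OF f(3,3)] q[OF f(2,2)]] q[OF f(1,2)]] m[OF f(1,3)]])+
  show "form_triple 2 (chart_inv u)"
    unfolding form_triple_def u chart_inv_def prod.case mult.assoc[of 3]
    by (intro conjI) (rule form_diff[OF m[OF f(2) s(2)] q[OF s(3,4)]] m[OF f(1) s(2)] m[OF f(2) s(2)])+
qed

lemma morphism_to_P2_tripleI:
  assumes "\<And>P. P \<in> U \<Longrightarrow> \<exists>d G v. form_triple d G \<and> P = proj_point v \<and> eval_triple G v \<noteq> (0, 0, 0) \<and>
      (\<forall>v. v \<noteq> (0, 0, 0) \<longrightarrow> proj_point v \<in> U \<longrightarrow> eval_triple G v \<noteq> (0, 0, 0) \<longrightarrow>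
        f (proj_point v) = proj_point (eval_triple G v))"
  shows "morphism_to_P2 U f"
proof (rule morphism_to_P2I, goal_cases)
  case (1 P)
  from assms[OF 1] obtain d G v where "form_triple d G \<and> P = proj_point v \<and> eval_triple G v \<noteq> (0, 0, 0) \<and>
      (\<forall>v. v \<noteq> (0, 0, 0) \<longrightarrow> proj_point v \<in> U \<longrightarrow> eval_triple G v \<noteq> (0, 0, 0) \<longrightarrow>
        f (proj_point v) = proj_point (eval_triple G v))" by blast
  note * = this
  obtain G1 G2 G3 where G: "G = (G1, G2, G3)" by (metis prod_cases3)
  show ?case by (intro exI) (rule *[unfolded G form_triple_def prod.case conj_assoc])
qed

context ninth_root
begin

definition to_twisted_forms :: "'k poly3 \<times> 'k poly3 \<times> 'k poly3" where
  "to_twisted_forms = (const3 (w ^ 2) * var_X,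
     const3 ((w + 2 * w ^ 4) / 3) * var_Z - const3 ((1 + 2 * w ^ 3) / 3) * var_Y,
     const3 (1 + w ^ 3) * var_Y - const3 (w ^ 4) * var_Z)"

lemma eval_to_twisted_forms: "eval_triple to_twisted_forms v = to_twisted v"
  by (cases v) (simp add: to_twisted_forms_def to_twisted_def eval3_simps eval3_gens)

lemma form_to_twisted_forms: "form_triple 1 to_twisted_forms"
  unfolding to_twisted_forms_def form_triple_def prod.case
  by (intro conjI form_diff form_scale form_vars)

definition from_twisted_forms :: "'k poly3 \<times> 'k poly3 \<times> 'k poly3 \<Rightarrow> 'k poly3 \<times> 'k poly3 \<times> 'k poly3" where
  "from_twisted_forms G = (case G of (h, a, b) \<Rightarrow> (const3 (w ^ 7) * h, const3 (2 + w ^ 3) * a + b,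
     const3 (- (2 * w ^ 2 + w ^ 5)) * a - const3 (w ^ 2 + w ^ 5) * b))"

lemma eval_from_twisted_forms: "eval_triple (from_twisted_forms G) v = from_twisted (eval_triple G v)"
  by (cases G; cases v) (simp add: from_twisted_forms_def from_twisted_def eval3_simps eval3_gens)

lemma form_from_twisted_forms: "form_triple d G \<Longrightarrow> form_triple d (from_twisted_forms G)"
  unfolding from_twisted_forms_def form_triple_def prod.case
  by (cases G) (auto intro!: form_add form_diff form_scale)

lemma morphism_\<phi>: "morphism_to_P2 fermat_curve \<phi>"
proof (rule morphism_to_P2_tripleI)
  fix P assume "P \<in> fermat_curve"
  then obtain v where v: "v \<noteq> (0, 0, 0)" "P = proj_point v" "twisted (to_twisted v)" using fermat_curve_cases by blast
  have "to_twisted v \<noteq> (0, 0, 0)" using v(1) by (simp add: to_twisted_eq_0)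
  then obtain t where t: "t \<noteq> (0, 0, 0)" "t = chart1 (to_twisted v) \<or> t = chart2 (to_twisted v)"
    using proj_image_cases[OF three v(3)] by blast
  define G where "G = (if t = chart1 (to_twisted v) then chart1 to_twisted_forms else chart2 to_twisted_forms)"
  have G: "G = chart1 to_twisted_forms \<or> G = chart2 to_twisted_forms" by (simp add: G_def)
  have "eval_triple G v = t" using t(2) by (auto simp: G_def eval_triple_chart eval_to_twisted_forms)
  moreover have "form_triple 2 G" using G form_triple_chart[OF form_to_twisted_forms] by auto
  moreover have "\<phi> (proj_point v') = proj_point (eval_triple G v')" 
    if v': "v' \<noteq> (0, 0, 0)" "proj_point v' \<in> fermat_curve" "eval_triple G v' \<noteq> (0, 0, 0)" for v'
  proof -
    have tw: "twisted (to_twisted v')" using v' proj_point_in_fermat_curve by blast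
    from G show ?thesis
    proof
      assume G: "G = chart1 to_twisted_forms"
      have e: "eval_triple G v' = chart1 (to_twisted v')" unfolding G eval_triple_chart eval_to_twisted_forms ..
      show ?thesis using proj_image_eq(1)[OF tw] v'(3) unfolding e \<phi>_proj_point by blast
    next
      assume G: "G = chart2 to_twisted_forms"
      have e: "eval_triple G v' = chart2 (to_twisted v')" unfolding G eval_triple_chart eval_to_twisted_forms ..
      show ?thesis using proj_image_eq(2)[OF tw] v'(3) unfolding e \<phi>_proj_point by blast
    qed
  qed
  ultimately show "\<exists>d G v. form_triple d G \<and> P = proj_point v \<and> eval_triple G v \<noteq> (0, 0, 0) \<and>
      (\<forall>v. v \<noteq> (0, 0, 0) \<longrightarrow> proj_point v \<in> fermat_curve \<longrightarrow> eval_triple G v \<noteq> (0, 0, 0) \<longrightarrow>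
        \<phi> (proj_point v) = proj_point (eval_triple G v))"
    using v(2) t(1) by blast
qed

lemma chart_inv_nonzero:
  assumes q: "quartic_fun x y z = 0" and V: "x * (x + y) * (x + z) \<noteq> (0 :: 'k)"
  shows "y + z + 3 * x \<noteq> 0" "chart_inv (x, y, z) \<noteq> (0, 0, 0)" "- 3 * (x + y) * (x + z) * (y + z + 3 * x) \<noteq> 0"
proof -
  show s: "y + z + 3 * x \<noteq> 0" using quartic_sum_zero[OF q _ three] V by auto
  show "chart_inv (x, y, z) \<noteq> (0, 0, 0)" using s V by (auto simp: chart_inv_def)
  show "- 3 * (x + y) * (x + z) * (y + z + 3 * x) \<noteq> 0"
    using s V three by (metis mult_eq_0_iff neg_equal_0_iff_equal)
qed

lemma birational_\<phi>: "birational_onto_image fermat_curve \<phi>"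
proof -
  \<comment> \<open>Off x (x + y)(x + z) = 0 the factor y + z + 3x is nonzero too, so
    \<open>chart_inv\<close> is defined there and the scalar in \<open>chart1_chart_inv\<close> does
    not vanish.\<close>
  define N :: "'k poly3" where "N = var_X * (var_X + var_Y) * (var_X + var_Z)"
  define V where "V = \<phi> ` fermat_curve - zero_locus N"
  have fN: "form 3 N" 
    unfolding N_def using form_mult[OF form_mult[OF form_vars(1) form_add[OF form_vars(1,2)]] form_add[OF form_vars(1,3)]]
    by (simp add: numeral_3_eq_3)
  have V: "proj_point (x, y, z) \<in> V \<longleftrightarrow> quartic_fun x y z = 0 \<and> x * (x + y) * (x + z) \<noteq> 0" 
    if "(x, y, z) \<noteq> (0, 0, 0)" for x y z
    unfolding V_def image_\<phi> Diff_iff proj_point_zero_locus[OF form_quartic that] proj_point_zero_locus[OF fN that]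
    by (simp add: N_def eval3_simps eval3_gens eval3_eq_ev[of quartic] ev_quartic ring_map_id)
  have VE: "\<exists>x y z. (x, y, z) \<noteq> (0, 0, 0) \<and> Q = proj_point (x, y, z) \<and> quartic_fun x y z = 0 \<and> x * (x + y) * (x + z) \<noteq> 0"
    if "Q \<in> V" for Q
  proof -
    have "Q \<in> zero_locus quartic" using that by (simp add: V_def image_\<phi>)
    then obtain v where "v \<noteq> (0, 0, 0)" "Q = proj_point v" using zero_locusE[OF form_quartic] by blast
    moreover obtain x y z where "v = (x, y, z)" by (metis prod_cases3)
    ultimately show ?thesis using that V by blast
  qed
  \<comment> \<open>A point with y = 0 and z^3 - 9z - 12 = 0 works unless z = -1, where the cubic
    takes the value -4. In characteristic 2 the point (1 : 0 : 0) lies on the quartic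
    instead.\<close>
  have ne: "V \<noteq> {}"
  proof (cases "(4::'k) = 0")
    case True
    moreover have "(12::'k) = 3 * 4" by simp
    ultimately have "(12::'k) = 0" by (metis mult_zero_right)
    then have "proj_point (1, 0, 0) \<in> V" by (subst V) (auto simp: quartic_fun_def)
    then show ?thesis by blast
  next
    case False
    obtain z :: 'k where "poly [:-12, -9, 0, 1:] z = 0"
      using alg_closed_imp_poly_has_root[of "[:-12, -9, 0, 1 :: 'k:]"] by auto
    then have z: "z ^ 3 - 9 * z - 12 = 0" by (simp add: power3_eq_cube algebra_simps)
    have "1 + z \<noteq> 0"
    proof
      assume "1 + z = 0"
      moreover have "z ^ 3 - 9 * z - 12 = (1 + z) * (z ^ 2 - z - 8) - 4" by (simp add: algebra_simps eval_nat_numeral)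
      ultimately show False using z False by simp
    qed
    then have "proj_point (1, 0, z) \<in> V" using z by (subst V) (auto simp: quartic_fun_def algebra_simps)
    then show ?thesis by blast
  qed
  have mor: "morphism_to_P2 V \<psi>"
  proof (rule morphism_to_P2_tripleI)
    fix P assume "P \<in> V"
    then obtain x y z where v: "(x, y, z) \<noteq> (0, 0, 0)" "P = proj_point (x, y, z)" "quartic_fun x y z = 0" "x * (x + y) * (x + z) \<noteq> 0"
      using VE by blast
    define G :: "'k poly3 \<times> 'k poly3 \<times> 'k poly3" where "G = from_twisted_forms (chart_inv (var_X, var_Y, var_Z))"
    have "form_triple 1 (var_X, var_Y, var_Z :: 'k poly3)"
      unfolding form_triple_def prod.case by (intro conjI form_vars)
    then have "form_triple 2 G" unfolding G_def by (intro form_from_twisted_forms form_triple_chart)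
    moreover have e: "eval_triple G v = from_twisted (chart_inv v)" for v
      unfolding G_def eval_from_twisted_forms eval_triple_chart by (cases v) (simp add: eval3_gens)
    moreover have "from_twisted (chart_inv (x, y, z)) \<noteq> (0, 0, 0)"
      using chart_inv_nonzero(2)[OF v(3,4)] by (simp add: from_twisted_eq_0)
    ultimately have *: "form_triple 2 G \<and> P = proj_point (x, y, z) \<and> eval_triple G (x, y, z) \<noteq> (0, 0, 0) \<and>
      (\<forall>v. v \<noteq> (0, 0, 0) \<longrightarrow> proj_point v \<in> V \<longrightarrow> eval_triple G v \<noteq> (0, 0, 0) \<longrightarrow>
        \<psi> (proj_point v) = proj_point (eval_triple G v))"
      using v(2) \<psi>_proj_point by (simp only: e simp_thms)
    show "\<exists>d G v. form_triple d G \<and> P = proj_point v \<and> eval_triple G v \<noteq> (0, 0, 0) \<and>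
      (\<forall>v. v \<noteq> (0, 0, 0) \<longrightarrow> proj_point v \<in> V \<longrightarrow> eval_triple G v \<noteq> (0, 0, 0) \<longrightarrow>
        \<psi> (proj_point v) = proj_point (eval_triple G v))"
      by (intro exI) (rule *)
  qed
  have inv1: "\<psi> Q \<in> fermat_curve \<and> \<phi> (\<psi> Q) = Q" if Q: "Q \<in> V" for Q
  proof -
    obtain x y z where v: "(x, y, z) \<noteq> (0, 0, 0)" "Q = proj_point (x, y, z)" "quartic_fun x y z = 0" "x * (x + y) * (x + z) \<noteq> 0"
      using VE[OF Q] by blast
    note c = chart_inv_nonzero[OF v(3,4)]
    have "\<psi> Q \<in> fermat_curve" unfolding v(2) \<psi>_proj_point
      using proj_point_in_fermat_curve[of "from_twisted (chart_inv (x, y, z))"] twisted_chart_inv[OF v(3)] c(2) 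
      unfolding from_twisted_eq_0 to_from_twisted by blast
    moreover have "chart1 (chart_inv (x, y, z)) \<noteq> (0, 0, 0)"
      unfolding chart1_chart_inv[OF v(3)] scale3_eq_0[OF c(3)] by (rule v(1))
    from proj_image_eq(1)[OF twisted_chart_inv[OF v(3)] this] have "\<phi> (\<psi> Q) = Q"
      unfolding v(2) \<psi>_proj_point \<phi>_proj_point to_from_twisted chart1_chart_inv[OF v(3)] proj_point_scale[OF c(3)] .
    ultimately show ?thesis ..
  qed
  have inv2: "\<psi> (\<phi> P) = P" if P: "P \<in> fermat_curve" "\<phi> P \<in> V" for P
  proof -
    obtain v where v: "v \<noteq> (0, 0, 0)" "P = proj_point v" "twisted (to_twisted v)" using fermat_curve_cases[OF P(1)] by blast
    obtain h a b where u: "to_twisted v = (h, a, b)" by (metis prod_cases3)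
    have tw: "twisted (h, a, b)" using v(3) by (simp add: u)
    obtain x y z where xyz: "\<phi> P = proj_point (x, y, z)" "(x, y, z) \<noteq> (0, 0, 0)" "quartic_fun x y z = 0" "x * (x + y) * (x + z) \<noteq> 0"
      using VE[OF P(2)] by blast
    \<comment> \<open>At the base point of \<open>chart1\<close> the image is given by
      \<open>chart2\<close> and has x = 0, so it lies outside V.\<close>
    have c1: "chart1 (h, a, b) \<noteq> (0, 0, 0)"
    proof
      assume 0: "chart1 (h, a, b) = (0, 0, 0)"
      obtain c where c: "(h, a, b) = (c, 0, c)" using chart1_zero[OF three tw 0] by blast
      have "\<phi> P = proj_point (chart2 (h, a, b))" unfolding v(2) \<phi>_proj_point u proj_image_def 0 by simp
      then obtain s where "(x, y, z) = scale3 s (chart2 (h, a, b))" unfolding xyz(1) proj_point_eq_iff by blast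
      then have "x = 0" unfolding c by (simp add: chart2_def)
      with xyz(4) show False by simp
    qed
    have ph: "\<phi> P = proj_point (chart1 (h, a, b))" unfolding v(2) \<phi>_proj_point u by (rule proj_image_eq(1)[OF tw c1])
    then have "proj_point (chart1 (h, a, b)) = proj_point (x, y, z)" unfolding xyz(1) by (rule sym)
    then obtain s where s: "s \<noteq> 0" "chart1 (h, a, b) = scale3 s (x, y, z)" unfolding proj_point_eq_iff by blast
    have "chart_inv (chart1 (h, a, b)) \<noteq> (0, 0, 0)"
      unfolding s(2) chart_homogeneous using s(1) chart_inv_nonzero(2)[OF xyz(3,4)] scale3_eq_0[of "s ^ 2"] by simp
    then obtain l where l: "chart_inv (chart1 (h, a, b)) = scale3 l (h, a, b)" "l \<noteq> 0"
      using chart_inv_chart1[OF tw] that by force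
    have "\<psi> (\<phi> P) = proj_point (from_twisted (h, a, b))"
      unfolding ph \<psi>_proj_point l(1) from_twisted_scale proj_point_scale[OF l(2)] ..
    then show ?thesis unfolding u[symmetric] from_to_twisted v(2) .
  qed
  have *: "form 3 N \<and> V = \<phi> ` fermat_curve - zero_locus N \<and> V \<noteq> {} \<and> morphism_to_P2 V \<psi> \<and> \<psi> ` V \<subseteq> fermat_curve \<and>
      (\<forall>Q\<in>V. \<phi> (\<psi> Q) = Q) \<and> (\<forall>P\<in>fermat_curve. \<phi> P \<in> V \<longrightarrow> \<psi> (\<phi> P) = P)"
    by (intro conjI fN V_def ne mor image_subsetI ballI impI inv2) (simp_all only: inv1)
  show ?thesis unfolding birational_onto_image_def by (intro exI) (rule *)
qed

end

section \<open>Cyclic cubic extensions of a rational function field\<close>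

definition is_subfield :: "'a::field set \<Rightarrow> bool" where
  "is_subfield S \<longleftrightarrow> 0 \<in> S \<and> 1 \<in> S \<and> (\<forall>x\<in>S. \<forall>y\<in>S. x + y \<in> S \<and> x * y \<in> S) \<and> (\<forall>x\<in>S. - x \<in> S \<and> inverse x \<in> S)"

lemma is_subfieldD:
  assumes "is_subfield S"
  shows "0 \<in> S" "1 \<in> S" "x \<in> S \<Longrightarrow> y \<in> S \<Longrightarrow> x + y \<in> S" "x \<in> S \<Longrightarrow> y \<in> S \<Longrightarrow> x * y \<in> S"
    "x \<in> S \<Longrightarrow> - x \<in> S" "x \<in> S \<Longrightarrow> inverse x \<in> S" "x \<in> S \<Longrightarrow> y \<in> S \<Longrightarrow> x - y \<in> S"
    "x \<in> S \<Longrightarrow> y \<in> S \<Longrightarrow> x / y \<in> S" "x \<in> S \<Longrightarrow> x ^ n \<in> S" "numeral m \<in> S"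
proof -
  note s = assms[unfolded is_subfield_def]
  show 1: "0 \<in> S" "1 \<in> S" "x \<in> S \<Longrightarrow> y \<in> S \<Longrightarrow> x + y \<in> S" "x \<in> S \<Longrightarrow> y \<in> S \<Longrightarrow> x * y \<in> S"
    "x \<in> S \<Longrightarrow> - x \<in> S" "x \<in> S \<Longrightarrow> inverse x \<in> S" for x y
    using s by auto
  show "x - y \<in> S" if "x \<in> S" "y \<in> S" using 1(3)[OF that(1) 1(5)[OF that(2)]] by simp
  show "x / y \<in> S" if "x \<in> S" "y \<in> S" using 1(4)[OF that(1) 1(6)[OF that(2)]] by (simp add: divide_inverse)
  show "x ^ n \<in> S" if "x \<in> S" by (induction n) (auto intro: 1 that)
  have "of_nat k \<in> S" for k by (induction k) (auto intro: 1)
  from this[of "numeral m"] show "numeral m \<in> S" by simp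
qed

lemma pev_closed:
  assumes "is_subfield S" "ring_map g" "\<And>c. g c \<in> S" "a \<in> S"
  shows "pev g a p \<in> S"
  by (induction p) (auto simp: pev_pCons assms(2) intro: is_subfieldD[OF assms(1)] assms)

lemma ev_closed:
  assumes "is_subfield S" "ring_map g" "\<And>c. g c \<in> S" "x \<in> S" "y \<in> S" "z \<in> S"
  shows "ev g F (x, y, z) \<in> S"
  unfolding ev_def prod.case by (intro pev_closed assms ring_map_pev)

text \<open>If \<open>q\<close> vanishes at \<open>\<tau>\<close>, the quotient is \<open>0\<close>, so no condition on \<open>q\<close> is needed.\<close>

definition simple_ext :: "('k::field \<Rightarrow> 'o::field) \<Rightarrow> 'o \<Rightarrow> 'o set" where
  "simple_ext e \<tau> = {pev e \<tau> p / pev e \<tau> q | p q. True}"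

lemma simple_extI: "x = pev e \<tau> p / pev e \<tau> q \<Longrightarrow> x \<in> simple_ext e \<tau>"
  by (auto simp: simple_ext_def)

lemma simple_extE:
  assumes "ring_map e" "x \<in> simple_ext e \<tau>"
  obtains p q where "x = pev e \<tau> p / pev e \<tau> q" "pev e \<tau> q \<noteq> 0"
proof -
  obtain p q where x: "x = pev e \<tau> p / pev e \<tau> q" using assms(2) by (auto simp: simple_ext_def)
  note s = ring_map_simps[OF ring_map_pev[OF assms(1)]]
  show thesis
  proof (cases "pev e \<tau> q = 0")
    case True
    then show ?thesis using that[of 0 1] x by (simp add: s)
  qed (use that x in blast)
qed

lemma is_subfield_simple_ext:
  assumes "ring_map e"
  shows "is_subfield (simple_ext e \<tau>)"
proof -
  note s = ring_map_simps[OF ring_map_pev[OF assms, of \<tau>]]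
  have "x + y \<in> simple_ext e \<tau> \<and> x * y \<in> simple_ext e \<tau>" if xy: "x \<in> simple_ext e \<tau>" "y \<in> simple_ext e \<tau>" for x y
  proof -
    obtain p q where x: "x = pev e \<tau> p / pev e \<tau> q" "pev e \<tau> q \<noteq> 0" using simple_extE[OF assms xy(1)] by blast
    obtain r t where y: "y = pev e \<tau> r / pev e \<tau> t" "pev e \<tau> t \<noteq> 0" using simple_extE[OF assms xy(2)] by blast
    have "x + y = pev e \<tau> (p * t + r * q) / pev e \<tau> (q * t)" "x * y = pev e \<tau> (p * r) / pev e \<tau> (q * t)"
      using x y by (simp_all add: s add_frac_eq)
    then show ?thesis by (blast intro: simple_extI)
  qed
  moreover have "- x \<in> simple_ext e \<tau> \<and> inverse x \<in> simple_ext e \<tau>" if x': "x \<in> simple_ext e \<tau>" for x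
  proof -
    obtain p q where x: "x = pev e \<tau> p / pev e \<tau> q" "pev e \<tau> q \<noteq> 0" using simple_extE[OF assms x'] by blast
    have "- x = pev e \<tau> (- p) / pev e \<tau> q" "inverse x = pev e \<tau> q / pev e \<tau> p" using x by (simp_all add: s)
    then show ?thesis by (blast intro: simple_extI)
  qed
  moreover have "0 \<in> simple_ext e \<tau>" "1 \<in> simple_ext e \<tau>"
    using simple_extI[of 0 e \<tau> 0 1] simple_extI[of 1 e \<tau> 1 1] by (auto simp: s)
  ultimately show ?thesis unfolding is_subfield_def by blast
qed

lemma pev_simple_ext:
  assumes "ring_map e"
  shows "pev e \<tau> p \<in> simple_ext e \<tau>"
  by (rule simple_extI[of _ _ _ p 1]) (simp add: ring_map_simps[OF ring_map_pev[OF assms]])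

lemma simple_ext_gens:
  assumes "ring_map e"
  shows "\<tau> \<in> simple_ext e \<tau>" "e c \<in> simple_ext e \<tau>"
  using pev_simple_ext[OF assms, of \<tau> "[:0, 1:]"] pev_simple_ext[OF assms, of \<tau> "[:c:]"]
  by (simp_all add: pev_pCons assms ring_map_simps[OF assms])

lemma simple_ext_least:
  assumes "ring_map e" "is_subfield S" "\<And>c. e c \<in> S" "\<tau> \<in> S"
  shows "simple_ext e \<tau> \<subseteq> S"
  using pev_closed[OF assms(2,1,3,4)] is_subfieldD(8)[OF assms(2)] by (auto simp: simple_ext_def)

text \<open>Infinite descent: \<open>\<pi>\<close> divides \<open>r0\<close>, then \<open>r1\<close>, then \<open>r2\<close>, and the quotients solve the same equation.\<close>

lemma cubic_norm_polynomial_eq_0: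
  fixes \<pi> D1 r0 r1 r2 :: "'k::field poly"
  assumes \<pi>: "prime_elem \<pi>" "Polynomial.degree \<pi> > 0" "\<not> \<pi> dvd D1" and D: "D = \<pi> * D1"
  shows "r0 ^ 3 + r1 ^ 3 * D + r2 ^ 3 * D ^ 2 = 3 * r0 * r1 * r2 * D \<Longrightarrow> r0 = 0 \<and> r1 = 0 \<and> r2 = 0"
proof (induction "Polynomial.degree r0 + Polynomial.degree r1 + Polynomial.degree r2" arbitrary: r0 r1 r2 rule: less_induct)
  case (less r0 r1 r2)
  have \<pi>0: "\<pi> \<noteq> 0" using \<pi>(2) by auto
  have "r0 ^ 3 = \<pi> * (3 * r0 * r1 * r2 * D1 - r1 ^ 3 * D1 - r2 ^ 3 * D1 * D)"
    using less.prems by (simp add: D algebra_simps power2_eq_square)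
  then have "\<pi> dvd r0" using \<pi>(1) by (metis dvd_triv_left prime_elem_dvd_power)
  then obtain s0 where s0: "r0 = \<pi> * s0" by auto
  have "\<pi> * (r1 ^ 3 * D1) = \<pi> * (\<pi> * (3 * s0 * r1 * r2 * D1 - r2 ^ 3 * D1 ^ 2 - \<pi> * s0 ^ 3))"
    using less.prems unfolding s0 D by (simp add: algebra_simps power2_eq_square power3_eq_cube)
  then have e1: "r1 ^ 3 * D1 = \<pi> * (3 * s0 * r1 * r2 * D1 - r2 ^ 3 * D1 ^ 2 - \<pi> * s0 ^ 3)" using \<pi>0 by simp
  then have "\<pi> dvd r1 ^ 3" using \<pi>(1,3) by (metis dvd_triv_left prime_elem_dvd_mult_iff)
  then have "\<pi> dvd r1" using \<pi>(1) by (metis prime_elem_dvd_power)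
  then obtain s1 where s1: "r1 = \<pi> * s1" by auto
  have "\<pi> * (r2 ^ 3 * D1 ^ 2) = \<pi> * (\<pi> * (3 * s0 * s1 * r2 * D1 - \<pi> * s1 ^ 3 * D1 - s0 ^ 3))"
    using e1 unfolding s1 by (simp add: algebra_simps power2_eq_square power3_eq_cube)
  then have e2: "r2 ^ 3 * D1 ^ 2 = \<pi> * (3 * s0 * s1 * r2 * D1 - \<pi> * s1 ^ 3 * D1 - s0 ^ 3)" using \<pi>0 by simp
  then have "\<pi> dvd r2 ^ 3" using \<pi>(1,3) by (metis dvd_triv_left prime_elem_dvd_mult_iff prime_elem_dvd_power)
  then have "\<pi> dvd r2" using \<pi>(1) by (metis prime_elem_dvd_power)
  then obtain s2 where s2: "r2 = \<pi> * s2" by auto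
  have "\<pi> * (s0 ^ 3 + s1 ^ 3 * D + s2 ^ 3 * D ^ 2) = \<pi> * (3 * s0 * s1 * s2 * D)"
    using e2 unfolding s2 D by (simp add: algebra_simps power2_eq_square power3_eq_cube)
  then have e: "s0 ^ 3 + s1 ^ 3 * D + s2 ^ 3 * D ^ 2 = 3 * s0 * s1 * s2 * D" using \<pi>0 by simp
  have deg: "Polynomial.degree (\<pi> * s) \<ge> Polynomial.degree s" "s \<noteq> 0 \<Longrightarrow> Polynomial.degree (\<pi> * s) > Polynomial.degree s" for s
    using \<pi>0 \<pi>(2) by (cases "s = 0"; simp add: degree_mult_eq)+
  show ?case
  proof (rule ccontr)
    assume "\<not> ?thesis"
    then have "s0 \<noteq> 0 \<or> s1 \<noteq> 0 \<or> s2 \<noteq> 0" by (auto simp: s0 s1 s2)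
    then have "Polynomial.degree s0 + Polynomial.degree s1 + Polynomial.degree s2 < Polynomial.degree r0 + Polynomial.degree r1 + Polynomial.degree r2"
      unfolding s0 s1 s2 using deg[of s0] deg[of s1] deg[of s2] by linarith
    from less.hyps[OF this e] \<open>s0 \<noteq> 0 \<or> s1 \<noteq> 0 \<or> s2 \<noteq> 0\<close> show False by blast
  qed
qed

definition pev2 :: "('k::comm_ring_1 \<Rightarrow> 'o::comm_ring_1) \<Rightarrow> 'o \<Rightarrow> 'o \<Rightarrow> 'k poly poly \<Rightarrow> 'o" where
  "pev2 e \<tau> \<chi> P = pev (pev e \<tau>) \<chi> P"

lemma ring_map_pev2: "ring_map e \<Longrightarrow> ring_map (pev2 e \<tau> \<chi>)"
  unfolding pev2_def[abs_def] by (intro ring_map_pev)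

lemma division_by_cubic:
  fixes P :: "'a::comm_ring_1 poly"
  obtains Q r0 r1 r2 where "P = Q * [:- D, 0, 0, 1:] + [:r0, r1, r2:]"
proof (induction P arbitrary: thesis)
  case 0
  show ?case by (rule 0[of 0 0 0 0]) simp
next
  case (pCons c P)
  obtain Q r0 r1 r2 where P: "P = Q * [:- D, 0, 0, 1:] + [:r0, r1, r2:]" using pCons(2) by blast
  have "pCons c P = (pCons r2 Q) * [:- D, 0, 0, 1:] + [:c + r2 * D, r0, r1:]" 
    unfolding P by simp
  then show ?case by (rule pCons(3))
qed

text \<open>The polynomial p + 1 takes only the value 1, so it has no root and must be
  constant.\<close>

lemma infinite_alg_closed_zero:
  fixes p :: "'k::alg_closed_field poly"
  assumes "\<And>x. poly p x = 0"
  shows "p = 0"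
proof -
  have "Polynomial.degree (p + 1) = 0"
    using alg_closed_imp_poly_has_root[of "p + 1"] assms by fastforce
  then have "Polynomial.degree p = 0" by (metis degree_0 degree_add_eq_right degree_1 add_diff_cancel_right' degree_diff_le le_zero_eq)
  then obtain c where "p = [:c:]" using degree_eq_zeroE by blast
  with assms[of 0] show ?thesis by simp
qed

text \<open>(\<tau>, \<chi>) is a generic point of the curve h^3 = D(b). The simple root \<rho> of D
  supplies the prime for the descent, and \<omega> is a primitive cube root of unity since 3 is
  nonzero.\<close>

locale generic_pair =
  fixes e :: "'k::alg_closed_field \<Rightarrow> 'o::field" and D :: "'k poly" and \<rho> \<omega> :: 'k and \<tau> \<chi> :: 'o
  assumes e: "ring_map e" and transc: "\<And>p. pev e \<tau> p = 0 \<Longrightarrow> p = 0"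
    and \<chi>: "\<chi> ^ 3 = pev e \<tau> D"
    and root: "poly D \<rho> = 0" "poly (pderiv D) \<rho> \<noteq> 0"
    and three: "(3::'k) \<noteq> 0" and \<omega>: "\<omega> ^ 2 + \<omega> + 1 = 0"
begin

lemmas ev_rules = ring_map_simps[OF ring_map_pev[OF e, of \<tau>]]

text \<open>The linear combination divides its norm r0^3 + r1^3 D + r2^3 D^2 - 3 r0 r1 r2 D. As
  \<tau> is transcendental, the vanishing of the norm is an identity of polynomials, to which the
  descent applies.\<close>

lemma independent:
  assumes "pev e \<tau> r0 + pev e \<tau> r1 * \<chi> + pev e \<tau> r2 * \<chi> ^ 2 = 0"
  shows "r0 = 0 \<and> r1 = 0 \<and> r2 = 0"
proof -
  define \<pi> where "\<pi> = [:- \<rho>, 1:]"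
  obtain D1 where D1: "D = \<pi> * D1" using root(1) unfolding poly_eq_0_iff_dvd \<pi>_def by auto
  have "poly (pderiv D) \<rho> = poly D1 \<rho>" unfolding D1 pderiv_mult by (simp add: \<pi>_def pderiv_pCons)
  then have nd: "\<not> \<pi> dvd D1" using root(2) unfolding \<pi>_def poly_eq_0_iff_dvd[symmetric] by simp
  define a b c where abc: "a = pev e \<tau> r0" "b = pev e \<tau> r1" "c = pev e \<tau> r2"
  have "pev e \<tau> (r0 ^ 3 + r1 ^ 3 * D + r2 ^ 3 * D ^ 2 - 3 * r0 * r1 * r2 * D) = 
      a ^ 3 + b ^ 3 * \<chi> ^ 3 + c ^ 3 * (\<chi> ^ 3) ^ 2 - 3 * a * b * c * \<chi> ^ 3"
    by (simp add: ev_rules abc \<chi>)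
  also have "\<dots> = (a + b * \<chi> + c * \<chi> ^ 2) * (a ^ 2 + b ^ 2 * \<chi> ^ 2 + c ^ 2 * \<chi> ^ 4 - a * b * \<chi> - a * c * \<chi> ^ 2 - b * c * \<chi> ^ 3)"
    by (simp add: algebra_simps eval_nat_numeral)
  also have "\<dots> = 0" using assms by (simp add: abc)
  finally have "r0 ^ 3 + r1 ^ 3 * D + r2 ^ 3 * D ^ 2 - 3 * r0 * r1 * r2 * D = 0" by (rule transc)
  then show ?thesis
    by (intro cubic_norm_polynomial_eq_0[of \<pi> D1 D] nd D1) (simp_all add: \<pi>_def prime_elem_linear_field_poly)
qed

text \<open>Transfer between the generic point and the points over k. Modulo \<chi>^3 - D only r0 +
  r1 \<chi> + r2 \<chi>^2 matters. Generically its coefficients vanish by independence; at points,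
  averaging over h, \<omega> h and \<omega>^2 h separates the three terms.\<close>

lemma pev2_eq_0_iff:
  "pev2 e \<tau> \<chi> P = 0 \<longleftrightarrow> (\<forall>b h. h ^ 3 = poly D b \<longrightarrow> pev2 (\<lambda>c. c) b h P = 0)"
proof -
  obtain Q r0 r1 r2 where P: "P = Q * [:- D, 0, 0, 1:] + [:r0, r1, r2:]" using division_by_cubic by blast
  have r: "pev2 e \<tau> \<chi> P = pev e \<tau> r0 + pev e \<tau> r1 * \<chi> + pev e \<tau> r2 * \<chi> ^ 2"
    unfolding P ring_map_simps[OF ring_map_pev2[OF e]] 
    by (simp add: pev2_def pev_pCons ring_map_pev e ev_rules \<chi>[symmetric] algebra_simps eval_nat_numeral)
  have pid: "pev (\<lambda>c. c) b p = poly p b" for b :: 'k and p by (simp add: pev_def)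
  have rk: "pev2 (\<lambda>c. c) b h P = poly r0 b + poly r1 b * h + poly r2 b * h ^ 2" if "h ^ 3 = poly D b" for b h
    unfolding P ring_map_simps[OF ring_map_pev2[OF ring_map_id]] 
    by (simp add: pev2_def pev_pCons ring_map_pev ring_map_id pid that[symmetric] algebra_simps eval_nat_numeral)
  have om3: "\<omega> ^ 3 = 1"
  proof -
    have "\<omega> ^ 3 - 1 = (\<omega> - 1) * (\<omega> ^ 2 + \<omega> + 1)" by (simp add: algebra_simps eval_nat_numeral)
    then show ?thesis unfolding \<omega> by simp
  qed
  show ?thesis
  proof
    assume "pev2 e \<tau> \<chi> P = 0"
    then have "r0 = 0 \<and> r1 = 0 \<and> r2 = 0" unfolding r by (rule independent)
    then show "\<forall>b h. h ^ 3 = poly D b \<longrightarrow> pev2 (\<lambda>c. c) b h P = 0" by (simp add: rk)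
  next
    assume "\<forall>b h. h ^ 3 = poly D b \<longrightarrow> pev2 (\<lambda>c. c) b h P = 0"
    then have z: "poly r0 b + poly r1 b * h + poly r2 b * h ^ 2 = 0" if "h ^ 3 = poly D b" for b h
      using rk that by metis
    \<comment> \<open>Averaging yields r1(b) h = 0 and r2(b) h^2 = 0, which says nothing at branch
      points, where h = 0. Multiplying up to h^3 = D(b) gives statements valid for every b, and D is
      not the zero polynomial.\<close>
    have "poly r0 b = 0 \<and> poly (r1 * D) b = 0 \<and> poly (r2 * D) b = 0" for b
    proof -
      obtain h where h: "h ^ 3 = poly D b" using nth_root_exists[of 3 "poly D b"] by auto
      have h': "(\<omega> * h) ^ 3 = poly D b" "(\<omega> ^ 2 * h) ^ 3 = poly D b"
        using h om3 power_mult[of \<omega> 3 2] by (simp_all add: power_mult_distrib)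
      define A B C where "A = poly r0 b" "B = poly r1 b" "C = poly r2 b"
      have zz: "A + B * h + C * h ^ 2 = 0" "A + B * (\<omega> * h) + C * (\<omega> * h) ^ 2 = 0" "A + B * (\<omega> ^ 2 * h) + C * (\<omega> ^ 2 * h) ^ 2 = 0"
        using z[OF h] z[OF h'(1)] z[OF h'(2)] by (simp_all add: A_B_C_def)
      have w2: "\<omega> ^ 2 = - 1 - \<omega>" using \<omega> by (simp add: algebra_simps eq_neg_iff_add_eq_0)
      have "3 * A = (A + B * h + C * h ^ 2) + (A + B * (\<omega> * h) + C * (\<omega> * h) ^ 2) + (A + B * (\<omega> ^ 2 * h) + C * (\<omega> ^ 2 * h) ^ 2)
          - (\<omega> ^ 2 + \<omega> + 1) * (B * h + C * h ^ 2 * (\<omega> ^ 2 - \<omega> + 1))"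
        by (simp add: algebra_simps eval_nat_numeral)
      then have A: "A = 0" unfolding zz \<omega> using three by simp
      have "3 * (B * h) = (A + B * h + C * h ^ 2) + \<omega> ^ 2 * (A + B * (\<omega> * h) + C * (\<omega> * h) ^ 2) + \<omega> * (A + B * (\<omega> ^ 2 * h) + C * (\<omega> ^ 2 * h) ^ 2)
          - (\<omega> ^ 3 - 1) * (2 * B * h + (\<omega> ^ 2 + \<omega>) * C * h ^ 2) - (\<omega> ^ 2 + \<omega> + 1) * (A + C * h ^ 2)"
        by (simp add: algebra_simps eval_nat_numeral)
      then have B: "B * h = 0" unfolding zz \<omega> om3 using three by simp
      have C: "C * h ^ 2 = 0" using zz(1) A B by simp
      have "B * h ^ 3 = (B * h) * h ^ 2" "C * h ^ 3 = (C * h ^ 2) * h" by (simp_all add: eval_nat_numeral)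
      then have "B * h ^ 3 = 0" "C * h ^ 3 = 0" using B C by simp_all
      with A show ?thesis unfolding h by (simp add: A_B_C_def)
    qed
    then have "r0 = 0" "r1 * D = 0" "r2 * D = 0" by (blast intro: infinite_alg_closed_zero)+
    moreover have "D \<noteq> 0" using root(2) by auto
    ultimately show "pev2 e \<tau> \<chi> P = 0" by (simp add: r ev_rules)
  qed
qed

abbreviation k\<tau> :: "'o set" where "k\<tau> \<equiv> simple_ext e \<tau>"

lemmas k\<tau> = is_subfieldD[OF is_subfield_simple_ext[OF e]]

lemma independent_over:
  assumes abc: "a \<in> k\<tau>" "b \<in> k\<tau>" "c \<in> k\<tau>" and z: "a + b * \<chi> + c * \<chi> ^ 2 = 0"
  shows "a = 0 \<and> b = 0 \<and> c = 0"
proof -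
  obtain p0 q0 where a: "a = pev e \<tau> p0 / pev e \<tau> q0" "pev e \<tau> q0 \<noteq> 0" using simple_extE[OF e abc(1)] by blast
  obtain p1 q1 where b: "b = pev e \<tau> p1 / pev e \<tau> q1" "pev e \<tau> q1 \<noteq> 0" using simple_extE[OF e abc(2)] by blast
  obtain p2 q2 where c: "c = pev e \<tau> p2 / pev e \<tau> q2" "pev e \<tau> q2 \<noteq> 0" using simple_extE[OF e abc(3)] by blast
  have "pev e \<tau> (p0 * (q1 * q2)) + pev e \<tau> (p1 * (q0 * q2)) * \<chi> + pev e \<tau> (p2 * (q0 * q1)) * \<chi> ^ 2
     = (a + b * \<chi> + c * \<chi> ^ 2) * (pev e \<tau> q0 * pev e \<tau> q1 * pev e \<tau> q2)"
    using a(2) b(2) c(2) by (simp add: ev_rules a(1) b(1) c(1) distrib_right)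
  then have "p0 * (q1 * q2) = 0 \<and> p1 * (q0 * q2) = 0 \<and> p2 * (q0 * q1) = 0"
    unfolding z mult_zero_left by (rule independent)
  moreover have "q0 \<noteq> 0" "q1 \<noteq> 0" "q2 \<noteq> 0" using a(2) b(2) c(2) by (auto simp: ev_rules)
  ultimately show ?thesis by (simp add: a(1) b(1) c(1))
qed

definition K :: "'o set" where
  "K = {a + b * \<chi> + c * \<chi> ^ 2 | a b c. a \<in> k\<tau> \<and> b \<in> k\<tau> \<and> c \<in> k\<tau>}"

lemma KI: "a \<in> k\<tau> \<Longrightarrow> b \<in> k\<tau> \<Longrightarrow> c \<in> k\<tau> \<Longrightarrow> a + b * \<chi> + c * \<chi> ^ 2 \<in> K"
  by (auto simp: K_def)

lemma KE:
  assumes "x \<in> K"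
  obtains a b c where "a \<in> k\<tau>" "b \<in> k\<tau>" "c \<in> k\<tau>" "x = a + b * \<chi> + c * \<chi> ^ 2"
  using assms by (auto simp: K_def)

lemma coordinates_unique:
  assumes "a \<in> k\<tau>" "b \<in> k\<tau>" "c \<in> k\<tau>" "a' \<in> k\<tau>" "b' \<in> k\<tau>" "c' \<in> k\<tau>"
    and "a + b * \<chi> + c * \<chi> ^ 2 = a' + b' * \<chi> + c' * \<chi> ^ 2"
  shows "a = a' \<and> b = b' \<and> c = c'"
proof -
  have "(a - a') + (b - b') * \<chi> + (c - c') * \<chi> ^ 2 = 0" using assms(7) by (simp add: algebra_simps)
  from independent_over[OF k\<tau>(7)[OF assms(1,4)] k\<tau>(7)[OF assms(2,5)] k\<tau>(7)[OF assms(3,6)] this] show ?thesis by simp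
qed

definition \<delta> :: 'o where "\<delta> = \<chi> ^ 3"

lemma \<delta>: "\<delta> \<in> k\<tau>"
  unfolding \<delta>_def \<chi> by (rule pev_simple_ext[OF e])

definition om :: 'o where "om = e \<omega>"

lemma om: "om ^ 2 + om + 1 = 0" "om ^ 3 = 1" "om \<in> k\<tau>" "om \<noteq> 0"
proof -
  note s = ring_map_simps[OF e]
  show 1: "om ^ 2 + om + 1 = 0" using \<omega> by (metis om_def s(1,2,3,7))
  have "om ^ 3 - 1 = (om - 1) * (om ^ 2 + om + 1)" by (simp add: algebra_simps eval_nat_numeral)
  then show 3: "om ^ 3 = 1" unfolding 1 by simp
  show "om \<in> k\<tau>" unfolding om_def by (rule simple_ext_gens[OF e])
  show "om \<noteq> 0" using 3 by auto
qed

lemma three': "(3::'o) \<noteq> 0"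
  using ring_map_eq_0[OF e, of 3] three by (simp add: ring_map_simps[OF e])

text \<open>The generator of the Galois group: it fixes \<open>k\<tau>\<close> and multiplies \<chi>
  by the cube root of unity \<open>om\<close>. The description is unambiguous because coordinates
  are unique.\<close>

definition s :: "'o \<Rightarrow> 'o" where
  "s x = (THE y. \<exists>a b c. a \<in> k\<tau> \<and> b \<in> k\<tau> \<and> c \<in> k\<tau> \<and> x = a + b * \<chi> + c * \<chi> ^ 2 \<and> y = a + b * om * \<chi> + c * om ^ 2 * \<chi> ^ 2)"

lemma s_eq: 
  assumes "a \<in> k\<tau>" "b \<in> k\<tau>" "c \<in> k\<tau>"
  shows "s (a + b * \<chi> + c * \<chi> ^ 2) = a + (b * om) * \<chi> + (c * om ^ 2) * \<chi> ^ 2"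
  unfolding s_def
proof (rule the_equality)
  show "\<exists>a' b' c'. a' \<in> k\<tau> \<and> b' \<in> k\<tau> \<and> c' \<in> k\<tau> \<and> a + b * \<chi> + c * \<chi> ^ 2 = a' + b' * \<chi> + c' * \<chi> ^ 2 \<and> 
      a + b * om * \<chi> + c * om ^ 2 * \<chi> ^ 2 = a' + b' * om * \<chi> + c' * om ^ 2 * \<chi> ^ 2"
    using assms by blast
  fix y assume "\<exists>a' b' c'. a' \<in> k\<tau> \<and> b' \<in> k\<tau> \<and> c' \<in> k\<tau> \<and> a + b * \<chi> + c * \<chi> ^ 2 = a' + b' * \<chi> + c' * \<chi> ^ 2 \<and> 
      y = a' + b' * om * \<chi> + c' * om ^ 2 * \<chi> ^ 2"
  then show "y = a + b * om * \<chi> + c * om ^ 2 * \<chi> ^ 2" using coordinates_unique[OF assms] by blast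
qed

lemma K_mult:
  "(a + b * \<chi> + c * \<chi> ^ 2) * (a' + b' * \<chi> + c' * \<chi> ^ 2) = 
   (a * a' + (b * c' + c * b') * \<delta>) + (a * b' + b * a' + c * c' * \<delta>) * \<chi> + (a * c' + b * b' + c * a') * \<chi> ^ 2"
  unfolding \<delta>_def by (simp add: algebra_simps eval_nat_numeral)

text \<open>The second factor is the product of the two other conjugates, with \<chi>^3 and \<chi>^4
  rewritten through \<delta>.\<close>

lemma K_norm:
  "(a + b * \<chi> + c * \<chi> ^ 2) * ((a ^ 2 - b * c * \<delta>) + (c ^ 2 * \<delta> - a * b) * \<chi> + (b ^ 2 - a * c) * \<chi> ^ 2)
     = a ^ 3 + b ^ 3 * \<delta> + c ^ 3 * \<delta> ^ 2 - 3 * a * b * c * \<delta>"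
  unfolding \<delta>_def by (simp add: algebra_simps eval_nat_numeral)

text \<open>The norm is the product of the three conjugates. If a conjugate vanished, independence
  would make its coordinates zero, and they differ from a, b, c only by powers of
  \<open>om\<close>.\<close>

lemma norm_nonzero:
  assumes abc: "a \<in> k\<tau>" "b \<in> k\<tau>" "c \<in> k\<tau>" and nz: "a + b * \<chi> + c * \<chi> ^ 2 \<noteq> 0"
  shows "a ^ 3 + b ^ 3 * \<delta> + c ^ 3 * \<delta> ^ 2 - 3 * a * b * c * \<delta> \<noteq> 0"
proof
  assume z: "a ^ 3 + b ^ 3 * \<delta> + c ^ 3 * \<delta> ^ 2 - 3 * a * b * c * \<delta> = 0"
  define b1 c1 b2 c2 where bc: "b1 = b * om" "c1 = c * om ^ 2" "b2 = b * om ^ 2" "c2 = c * om ^ 4"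
  have mem: "b1 \<in> k\<tau>" "c1 \<in> k\<tau>" "b2 \<in> k\<tau>" "c2 \<in> k\<tau>" using abc om(3) by (auto simp: bc intro!: k\<tau>)
  have w2: "om * om = - 1 - om" using om(1) by (simp add: algebra_simps power2_eq_square eq_neg_iff_add_eq_0)
  then have w2': "om * (om * z) = - z - om * z" for z by (simp add: mult.assoc[symmetric] left_diff_distrib)
  have prod: "(a + b1 * \<chi> + c1 * \<chi> ^ 2) * (a + b2 * \<chi> + c2 * \<chi> ^ 2) = 
      a ^ 2 + b ^ 2 * \<chi> ^ 2 + c ^ 2 * \<chi> ^ 4 - a * b * \<chi> - a * c * \<chi> ^ 2 - b * c * \<chi> ^ 3"
    unfolding bc by (simp add: algebra_simps eval_nat_numeral w2 w2')
  have "(a + b * \<chi> + c * \<chi> ^ 2) * ((a + b1 * \<chi> + c1 * \<chi> ^ 2) * (a + b2 * \<chi> + c2 * \<chi> ^ 2))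
      = a ^ 3 + b ^ 3 * \<chi> ^ 3 + c ^ 3 * (\<chi> ^ 3) ^ 2 - 3 * a * b * c * \<chi> ^ 3"
    unfolding prod by (simp add: algebra_simps eval_nat_numeral)
  also have "\<dots> = 0" using z by (simp add: \<delta>_def)
  finally have "(a + b * \<chi> + c * \<chi> ^ 2) * ((a + b1 * \<chi> + c1 * \<chi> ^ 2) * (a + b2 * \<chi> + c2 * \<chi> ^ 2)) = 0" .
  then consider "a + b1 * \<chi> + c1 * \<chi> ^ 2 = 0" | "a + b2 * \<chi> + c2 * \<chi> ^ 2 = 0" using nz by auto
  then have "a = 0 \<and> b = 0 \<and> c = 0"
  proof cases
    case 1
    from independent_over[OF abc(1) mem(1,2) 1] show ?thesis using om(4) by (simp add: bc)
  next
    case 2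
    from independent_over[OF abc(1) mem(3,4) 2] show ?thesis using om(4) by (simp add: bc)
  qed
  with nz show False by simp
qed

lemma inverse_in_K:
  assumes abc: "a \<in> k\<tau>" "b \<in> k\<tau>" "c \<in> k\<tau>" 
  shows "inverse (a + b * \<chi> + c * \<chi> ^ 2) \<in> K"
proof (cases "a + b * \<chi> + c * \<chi> ^ 2 = 0")
  case True
  then show ?thesis using KI[OF k\<tau>(1) k\<tau>(1) k\<tau>(1)] by simp
next
  case False
  define n where "n = a ^ 3 + b ^ 3 * \<delta> + c ^ 3 * \<delta> ^ 2 - 3 * a * b * c * \<delta>"
  have n: "n \<noteq> 0" "n \<in> k\<tau>" unfolding n_def using norm_nonzero[OF abc False] abc \<delta> by (auto intro!: k\<tau>)
  define x where "x = a + b * \<chi> + c * \<chi> ^ 2"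
  have "x * (((a ^ 2 - b * c * \<delta>) + (c ^ 2 * \<delta> - a * b) * \<chi> + (b ^ 2 - a * c) * \<chi> ^ 2) / n) = 1"
    using K_norm[of a b c] n(1) unfolding x_def[symmetric] n_def[symmetric] by simp
  then have "inverse x = ((a ^ 2 - b * c * \<delta>) + (c ^ 2 * \<delta> - a * b) * \<chi> + (b ^ 2 - a * c) * \<chi> ^ 2) / n"
    by (rule inverse_unique)
  also have "\<dots> = (a ^ 2 - b * c * \<delta>) / n + (c ^ 2 * \<delta> - a * b) / n * \<chi> + (b ^ 2 - a * c) / n * \<chi> ^ 2"
    by (simp add: add_divide_distrib)
  also have "\<dots> \<in> K" using abc n(2) \<delta> by (intro KI) (auto intro!: k\<tau>)
  finally show ?thesis unfolding x_def .
qed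

lemma is_subfield_K: "is_subfield K"
proof -
  have "x + y \<in> K \<and> x * y \<in> K" if xy: "x \<in> K" "y \<in> K" for x y
  proof -
    obtain a b c where x: "a \<in> k\<tau>" "b \<in> k\<tau>" "c \<in> k\<tau>" "x = a + b * \<chi> + c * \<chi> ^ 2" using KE[OF xy(1)] by blast
    obtain a' b' c' where y: "a' \<in> k\<tau>" "b' \<in> k\<tau>" "c' \<in> k\<tau>" "y = a' + b' * \<chi> + c' * \<chi> ^ 2" using KE[OF xy(2)] by blast
    have "x + y = (a + a') + (b + b') * \<chi> + (c + c') * \<chi> ^ 2" by (simp add: x(4) y(4) algebra_simps)
    also have "\<dots> \<in> K" using x(1-3) y(1-3) by (intro KI k\<tau>)
    finally have 1: "x + y \<in> K" .
    have "x * y \<in> K" unfolding x(4) y(4) K_mult using x(1-3) y(1-3) \<delta> by (intro KI k\<tau>)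
    with 1 show ?thesis ..
  qed
  moreover have "- x \<in> K \<and> inverse x \<in> K" if x': "x \<in> K" for x
  proof -
    obtain a b c where x: "a \<in> k\<tau>" "b \<in> k\<tau>" "c \<in> k\<tau>" "x = a + b * \<chi> + c * \<chi> ^ 2" using KE[OF x'] by blast
    have "- x = (- a) + (- b) * \<chi> + (- c) * \<chi> ^ 2" by (simp add: x(4))
    also have "\<dots> \<in> K" using x(1-3) by (intro KI k\<tau>)
    finally show ?thesis using inverse_in_K[OF x(1-3)] x(4) by simp
  qed
  moreover have "0 \<in> K" "1 \<in> K" using KI[OF k\<tau>(1) k\<tau>(1) k\<tau>(1)] KI[OF k\<tau>(2) k\<tau>(1) k\<tau>(1)] by simp_all
  ultimately show ?thesis unfolding is_subfield_def by blast
qed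

lemma k\<tau>_subset_K: "x \<in> k\<tau> \<Longrightarrow> x \<in> K"
  using KI[of x 0 0] k\<tau>(1) by simp

lemma \<chi>_in_K: "\<chi> \<in> K"
  using KI[of 0 1 0] k\<tau>(1,2) by simp

lemma K_least:
  assumes "is_subfield S" "\<And>c. e c \<in> S" "\<tau> \<in> S" "\<chi> \<in> S"
  shows "K \<subseteq> S"
proof
  fix x assume "x \<in> K"
  then obtain a b c where x: "a \<in> k\<tau>" "b \<in> k\<tau>" "c \<in> k\<tau>" "x = a + b * \<chi> + c * \<chi> ^ 2" using KE by blast
  have "k\<tau> \<subseteq> S" by (rule simple_ext_least[OF e assms(1-3)])
  with x assms(4) show "x \<in> S" by (auto intro!: is_subfieldD[OF assms(1)])
qed

lemma s_in_K: "x \<in> K \<Longrightarrow> s x \<in> K"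
  by (elim KE) (auto simp: s_eq intro!: KI k\<tau> om)

lemma s_fixes: "x \<in> k\<tau> \<Longrightarrow> s x = x"
  using s_eq[of x 0 0] k\<tau>(1) by simp

lemma s_add: 
  assumes "x \<in> K" "y \<in> K" shows "s (x + y) = s x + s y"
proof -
  obtain a b c where x: "a \<in> k\<tau>" "b \<in> k\<tau>" "c \<in> k\<tau>" "x = a + b * \<chi> + c * \<chi> ^ 2" using KE[OF assms(1)] by blast
  obtain a' b' c' where y: "a' \<in> k\<tau>" "b' \<in> k\<tau>" "c' \<in> k\<tau>" "y = a' + b' * \<chi> + c' * \<chi> ^ 2" using KE[OF assms(2)] by blast
  have "x + y = (a + a') + (b + b') * \<chi> + (c + c') * \<chi> ^ 2" by (simp add: x(4) y(4) algebra_simps)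
  also have "s \<dots> = (a + a') + ((b + b') * om) * \<chi> + ((c + c') * om ^ 2) * \<chi> ^ 2"
    using x(1-3) y(1-3) by (intro s_eq k\<tau>)
  also have "\<dots> = s x + s y" unfolding x(4) y(4) s_eq[OF x(1-3)] s_eq[OF y(1-3)] by (simp add: algebra_simps)
  finally show ?thesis .
qed

lemma s_mult: 
  assumes "x \<in> K" "y \<in> K" shows "s (x * y) = s x * s y"
proof -
  obtain a b c where x: "a \<in> k\<tau>" "b \<in> k\<tau>" "c \<in> k\<tau>" "x = a + b * \<chi> + c * \<chi> ^ 2" using KE[OF assms(1)] by blast
  obtain a' b' c' where y: "a' \<in> k\<tau>" "b' \<in> k\<tau>" "c' \<in> k\<tau>" "y = a' + b' * \<chi> + c' * \<chi> ^ 2" using KE[OF assms(2)] by blast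
  have w3: "om * (om * om) = 1" using om(2) by (simp add: power3_eq_cube mult.assoc)
  then have w4: "om * (om * (om * z)) = z" for z by (metis mult.assoc mult_1)
  have "s (x * y) = (a * a' + (b * c' + c * b') * \<delta>) + ((a * b' + b * a' + c * c' * \<delta>) * om) * \<chi> + ((a * c' + b * b' + c * a') * om ^ 2) * \<chi> ^ 2"
    unfolding x(4) y(4) K_mult using x(1-3) y(1-3) \<delta> by (intro s_eq k\<tau>)
  also have "\<dots> = s x * s y" unfolding x(4) y(4) s_eq[OF x(1-3)] s_eq[OF y(1-3)] K_mult 
    by (simp add: algebra_simps power2_eq_square w3 w4)
  finally show ?thesis .
qed

lemma s_cubed: 
  assumes "x \<in> K" shows "s (s (s x)) = x"
proof -
  obtain a b c where x: "a \<in> k\<tau>" "b \<in> k\<tau>" "c \<in> k\<tau>" "x = a + b * \<chi> + c * \<chi> ^ 2" using KE[OF assms(1)] by blast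
  have w3: "om * (om * om) = 1" using om(2) by (simp add: power3_eq_cube mult.assoc)
  then have w4: "om * (om * (om * z)) = z" for z by (metis mult.assoc mult_1)
  have m: "b * om \<in> k\<tau>" "c * om ^ 2 \<in> k\<tau>" "b * om * om \<in> k\<tau>" "c * om ^ 2 * om ^ 2 \<in> k\<tau>" using x om(3) by (auto intro!: k\<tau>)
  show ?thesis unfolding x(4) s_eq[OF x(1-3)] s_eq[OF x(1) m(1,2)] s_eq[OF x(1) m(3,4)]
    by (simp add: mult_ac power2_eq_square w3 w4)
qed

lemma s_fixed:
  assumes "x \<in> K" "s x = x" shows "x \<in> k\<tau>"
proof -
  obtain a b c where x: "a \<in> k\<tau>" "b \<in> k\<tau>" "c \<in> k\<tau>" "x = a + b * \<chi> + c * \<chi> ^ 2" using KE[OF assms(1)] by blast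
  have m: "b * om \<in> k\<tau>" "c * om ^ 2 \<in> k\<tau>" using x om(3) by (auto intro!: k\<tau>)
  have "b * om = b \<and> c * om ^ 2 = c" 
    using coordinates_unique[OF x(1) m x(1-3)] assms(2) unfolding x(4) s_eq[OF x(1-3)] by blast
  moreover have "om \<noteq> 1" "om ^ 2 \<noteq> 1"
  proof -
    show 1: "om \<noteq> 1" using om(1) three' by auto
    show "om ^ 2 \<noteq> 1" using om(2) 1 by (auto simp: eval_nat_numeral)
  qed
  ultimately have "b = 0" "c = 0" by simp_all
  then show ?thesis using x by simp
qed

text \<open>The polynomial is the characteristic polynomial of x, with trace 3a and the norm as
  constant term up to sign.\<close>

lemma cubic_over:
  assumes "x \<in> K"
  obtains p q r where "p \<in> k\<tau>" "q \<in> k\<tau>" "r \<in> k\<tau>" "x ^ 3 + p * x ^ 2 + q * x + r = 0"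
proof -
  obtain a b c where x: "a \<in> k\<tau>" "b \<in> k\<tau>" "c \<in> k\<tau>" "x = a + b * \<chi> + c * \<chi> ^ 2" using KE[OF assms(1)] by blast
  show thesis
  proof (rule that)
    show "- (3 * a) \<in> k\<tau>" "3 * a ^ 2 - 3 * b * c * \<delta> \<in> k\<tau>" "- (a ^ 3 + b ^ 3 * \<delta> + c ^ 3 * \<delta> ^ 2 - 3 * a * b * c * \<delta>) \<in> k\<tau>"
      using x(1-3) \<delta> by (auto intro!: k\<tau>)
    show "x ^ 3 + - (3 * a) * x ^ 2 + (3 * a ^ 2 - 3 * b * c * \<delta>) * x + - (a ^ 3 + b ^ 3 * \<delta> + c ^ 3 * \<delta> ^ 2 - 3 * a * b * c * \<delta>) = 0"
      unfolding x(4) \<delta>_def by (simp add: algebra_simps eval_nat_numeral)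
  qed
qed

end

section \<open>The function field of a curve with a generic point\<close>

text \<open>The bridge from type-class fields to ring records: \<open>\<Theta>\<close> identifies
  the set \<open>K\<close> with the record \<open>FF\<close>. Keeping \<open>K0\<close> and
  \<open>s\<close> as parameters lets one function field be used for both projections.\<close>

locale cyclic_cubic_model =
  fixes FF :: "'x ring" and \<Theta> :: "'o::field \<Rightarrow> 'x" and K K0 :: "'o set" and s :: "'o \<Rightarrow> 'o"
  assumes K: "is_subfield K" and K0: "is_subfield K0" "K0 \<subseteq> K"
    and inj: "inj_on \<Theta> K" and carrier: "carrier FF = \<Theta> ` K"
    and mult: "\<And>x y. x \<in> K \<Longrightarrow> y \<in> K \<Longrightarrow> \<Theta> x \<otimes>\<^bsub>FF\<^esub> \<Theta> y = \<Theta> (x * y)"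
    and add: "\<And>x y. x \<in> K \<Longrightarrow> y \<in> K \<Longrightarrow> \<Theta> x \<oplus>\<^bsub>FF\<^esub> \<Theta> y = \<Theta> (x + y)"
    and one: "\<one>\<^bsub>FF\<^esub> = \<Theta> 1" and zero: "\<zero>\<^bsub>FF\<^esub> = \<Theta> 0"
    and cubic: "\<And>x. x \<in> K \<Longrightarrow> \<exists>p\<in>K0. \<exists>q\<in>K0. \<exists>r\<in>K0. x ^ 3 + p * x ^ 2 + q * x + r = 0"
    and s_closed: "\<And>x. x \<in> K \<Longrightarrow> s x \<in> K"
    and s_add: "\<And>x y. x \<in> K \<Longrightarrow> y \<in> K \<Longrightarrow> s (x + y) = s x + s y"
    and s_mult: "\<And>x y. x \<in> K \<Longrightarrow> y \<in> K \<Longrightarrow> s (x * y) = s x * s y"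
    and s_cubed: "\<And>x. x \<in> K \<Longrightarrow> s (s (s x)) = x"
    and s_fixes: "\<And>x. x \<in> K0 \<Longrightarrow> s x = x"
    and s_fixed: "\<And>x. x \<in> K \<Longrightarrow> s x = x \<Longrightarrow> x \<in> K0"
begin

lemmas K_rules = is_subfieldD[OF K]
lemmas K0_rules = is_subfieldD[OF K0(1)]

lemma \<Theta>_eq_iff: "x \<in> K \<Longrightarrow> y \<in> K \<Longrightarrow> \<Theta> x = \<Theta> y \<longleftrightarrow> x = y"
  using inj by (auto dest: inj_onD)

lemma carrierE:
  assumes "a \<in> carrier FF" obtains x where "x \<in> K" "a = \<Theta> x"
  using assms carrier by auto

lemma closed: "x \<in> K \<Longrightarrow> \<Theta> x \<in> carrier FF"
  using carrier by auto

lemma cring_FF: "cring FF"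
proof (rule cringI)
  show "abelian_group FF"
  proof (rule abelian_groupI)
    fix a assume "a \<in> carrier FF"
    then obtain x where "x \<in> K" "a = \<Theta> x" by (rule carrierE)
    then show "\<exists>b\<in>carrier FF. b \<oplus>\<^bsub>FF\<^esub> a = \<zero>\<^bsub>FF\<^esub>"
      using K_rules(5)[of x] by (intro bexI[of _ "\<Theta> (- x)"]) (simp_all add: add zero closed)
  qed (auto elim!: carrierE simp: add zero closed K_rules add_ac)
  show "Group.comm_monoid FF"
    by (rule comm_monoidI) (auto elim!: carrierE simp: mult one closed K_rules mult_ac)
qed (auto elim!: carrierE simp: mult add K_rules distrib_right)

lemma field_FF: "field FF"
proof (rule cring.cring_fieldI2[OF cring_FF])
  show "\<zero>\<^bsub>FF\<^esub> \<noteq> \<one>\<^bsub>FF\<^esub>" by (simp add: zero one \<Theta>_eq_iff K_rules)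
  fix a assume "a \<in> carrier FF" "a \<noteq> \<zero>\<^bsub>FF\<^esub>"
  then obtain x where "x \<in> K" "a = \<Theta> x" "x \<noteq> 0" by (metis carrierE zero)
  then show "\<exists>b\<in>carrier FF. a \<otimes>\<^bsub>FF\<^esub> b = \<one>\<^bsub>FF\<^esub>"
    by (intro bexI[of _ "\<Theta> (inverse x)"]) (simp_all add: mult one closed K_rules)
qed

interpretation FF: field FF by (rule field_FF)

lemma minus: "x \<in> K \<Longrightarrow> \<ominus>\<^bsub>FF\<^esub> \<Theta> x = \<Theta> (- x)"
  by (rule FF.minus_equality) (simp_all add: add zero closed K_rules)

lemma inverse: "x \<in> K \<Longrightarrow> x \<noteq> 0 \<Longrightarrow> inv\<^bsub>FF\<^esub> \<Theta> x = \<Theta> (inverse x)"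
  by (rule FF.comm_inv_char) (simp_all add: mult one closed K_rules)

lemma power: "x \<in> K \<Longrightarrow> \<Theta> x [^]\<^bsub>FF\<^esub> (n::nat) = \<Theta> (x ^ n)"
  by (induction n) (simp_all add: one mult K_rules mult.commute)

lemma subfield_K0: "subfield (\<Theta> ` K0) FF"
proof (rule FF.subfieldI')
  show "subring (\<Theta> ` K0) FF"
    using K0(2) by (intro FF.subringI) (auto simp: closed one minus mult add K0_rules subset_eq)
  fix k assume "k \<in> \<Theta> ` K0 - {\<zero>\<^bsub>FF\<^esub>}"
  then obtain x where "x \<in> K0" "x \<noteq> 0" "k = \<Theta> x" using zero by auto
  then show "inv\<^bsub>FF\<^esub> k \<in> \<Theta> ` K0" using K0(2) by (auto simp: inverse K0_rules subset_eq)
qed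

lemma algebraic_FF: 
  assumes "a \<in> carrier FF"
  shows "ring.algebraic FF (\<Theta> ` K0) a"
proof -
  obtain x where x: "x \<in> K" "a = \<Theta> x" using assms by (rule carrierE)
  obtain p q r where pqr: "p \<in> K0" "q \<in> K0" "r \<in> K0" "x ^ 3 + p * x ^ 2 + q * x + r = 0" using cubic[OF x(1)] by blast
  then have K: "p \<in> K" "q \<in> K" "r \<in> K" using K0(2) by auto
  \<comment> \<open>Coefficient lists here start with the leading coefficient.\<close>
  have "FF.eval [\<one>\<^bsub>FF\<^esub>, \<Theta> p, \<Theta> q, \<Theta> r] a = \<Theta> (x ^ 3 + (p * x ^ 2 + (q * x + r)))"
    unfolding x(2) using x(1) K by (simp add: power one zero mult add K_rules power3_eq_cube power2_eq_square)
  also have "\<dots> = \<zero>\<^bsub>FF\<^esub>" using pqr(4) by (simp add: zero add.assoc)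
  finally have "FF.eval [\<one>\<^bsub>FF\<^esub>, \<Theta> p, \<Theta> q, \<Theta> r] a = \<zero>\<^bsub>FF\<^esub>" .
  moreover have "[\<one>\<^bsub>FF\<^esub>, \<Theta> p, \<Theta> q, \<Theta> r] \<in> carrier (univ_poly FF (\<Theta> ` K0))"
    unfolding univ_poly_carrier[symmetric] polynomial_def using pqr(1-3) by (auto simp: one zero \<Theta>_eq_iff K0_rules K_rules)
  ultimately show ?thesis using FF.algebraicI[of _ "\<Theta> ` K0" a] by (simp add: over_def)
qed

definition conj :: "'x \<Rightarrow> 'x" where "conj a = \<Theta> (s (the_inv_into K \<Theta> a))"

lemma conj_eq: "x \<in> K \<Longrightarrow> conj (\<Theta> x) = \<Theta> (s x)"
  by (simp add: conj_def the_inv_into_f_f inj)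

lemma s_one: "s 1 = 1"
  by (rule s_fixes) (rule K0_rules)

lemma conj_ring_iso: "conj \<in> ring_iso FF FF"
proof (rule ring_iso_memI)
  show "bij_betw conj (carrier FF) (carrier FF)"
    by (rule bij_betw_byWitness[of _ "\<lambda>a. conj (conj a)"]) (auto elim!: carrierE simp: conj_eq s_closed s_cubed closed)
qed (auto elim!: carrierE simp: conj_eq s_closed closed mult add one s_mult s_add s_one K_rules)

text \<open>One automorphism is enough for the nontrivial inclusion: whatever all automorphisms over
  \<open>K0\<close> fix is fixed by \<open>conj\<close>, hence comes from \<open>K0\<close>.\<close>

theorem galois: "galois_extension FF (\<Theta> ` K0)"
  unfolding galois_extension_def
proof (intro conjI ballI field_FF subfield_K0 algebraic_FF equalityI subsetI)
  fix a assume a: "a \<in> {x \<in> carrier FF. \<forall>\<sigma>\<in>ring_iso FF FF. (\<forall>a\<in>\<Theta> ` K0. \<sigma> a = a) \<longrightarrow> \<sigma> x = x}"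
  then obtain x where x: "x \<in> K" "a = \<Theta> x" using carrierE by blast
  have "\<forall>b\<in>\<Theta> ` K0. conj b = b" using K0(2) by (auto simp: conj_eq s_fixes subset_eq)
  then have "conj a = a" using a conj_ring_iso by blast
  then have "s x = x" using x by (simp add: conj_eq \<Theta>_eq_iff s_closed)
  then show "a \<in> \<Theta> ` K0" using x s_fixed by blast
next
  fix a assume "a \<in> \<Theta> ` K0"
  then show "a \<in> {x \<in> carrier FF. \<forall>\<sigma>\<in>ring_iso FF FF. (\<forall>a\<in>\<Theta> ` K0. \<sigma> a = a) \<longrightarrow> \<sigma> x = x}"
    using K0(2) closed by blast
qed

end

section \<open>Quotients of binary forms\<close>

lemma form_subst2:
  assumes "binary_form d A" "form 1 L1" "form 1 L2"
  shows "form d (subst2 A L1 L2)"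
  unfolding subst2_eq pev_altdef[OF ring_map_const3] pev_altdef[OF ring_map_pev[OF ring_map_const3]] sum_distrib_right
proof (intro form_sum)
  fix j i
  have f: "form (0 + 1 * i + 1 * j) (const3 (poly.coeff (poly.coeff A j) i) * L1 ^ i * L2 ^ j)"
    by (intro form_mult form_power form_const3 assms)
  show "form d (const3 (poly.coeff (poly.coeff A j) i) * L1 ^ i * L2 ^ j)"
  proof (cases "i + j = d")
    case True
    then show ?thesis using f by auto
  next
    case False
    then have "poly.coeff (poly.coeff A j) i = 0" using assms(1) by (auto simp: binary_form_def)
    then show ?thesis by (simp add: ring_map_simps[OF ring_map_const3])
  qed
qed

lemma binary_form_add: "binary_form d A \<Longrightarrow> binary_form d B \<Longrightarrow> binary_form d (A + B)"
  by (auto simp: binary_form_def) (metis add.right_neutral)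

lemma binary_form_uminus: "binary_form d A \<Longrightarrow> binary_form d (- A)"
  by (auto simp: binary_form_def)

lemma binary_form_mult:
  assumes "binary_form d A" "binary_form d' B"
  shows "binary_form (d + d') (A * B)"
  unfolding binary_form_def
proof (intro allI impI)
  fix i j
  assume "poly.coeff (poly.coeff (A * B) j) i \<noteq> 0"
  then have "(\<Sum>j'\<le>j. \<Sum>i'\<le>i. poly.coeff (poly.coeff A j') i' * poly.coeff (poly.coeff B (j - j')) (i - i')) \<noteq> 0"
    by (simp add: coeff_mult coeff_sum)
  then obtain j' where "j' \<le> j" "(\<Sum>i'\<le>i. poly.coeff (poly.coeff A j') i' * poly.coeff (poly.coeff B (j - j')) (i - i')) \<noteq> 0"
    by (auto elim: sum.not_neutral_contains_not_neutral)
  moreover from this obtain i' where "i' \<le> i" "poly.coeff (poly.coeff A j') i' * poly.coeff (poly.coeff B (j - j')) (i - i') \<noteq> 0"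
    by (auto elim: sum.not_neutral_contains_not_neutral)
  moreover from this(2) have "i' + j' = d" "(i - i') + (j - j') = d'"
    using assms unfolding binary_form_def by (metis mult_zero_left, metis mult_zero_right)
  ultimately show "i + j = d + d'" by linarith
qed

definition binary_ratios :: "('k::field \<Rightarrow> 'o::field) \<Rightarrow> 'o \<Rightarrow> 'o \<Rightarrow> 'o set" where
  "binary_ratios e a b = {pev (pev e a) b A / pev (pev e a) b B | A B. 
     (\<exists>d. binary_form d A \<and> binary_form d B) \<and> pev (pev e a) b B \<noteq> 0}"

lemma binary_ratiosI:
  "x = pev (pev e a) b A / pev (pev e a) b B \<Longrightarrow> binary_form d A \<Longrightarrow> binary_form d B \<Longrightarrow> pev (pev e a) b B \<noteq> 0 \<Longrightarrow> x \<in> binary_ratios e a b"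
  by (auto simp: binary_ratios_def)

lemma binary_ratiosE:
  assumes "x \<in> binary_ratios e a b"
  obtains A B d where "x = pev (pev e a) b A / pev (pev e a) b B" "binary_form d A" "binary_form d B" "pev (pev e a) b B \<noteq> 0"
  using assms by (auto simp: binary_ratios_def)

lemma binary_form_const: "binary_form 0 [:[:c:]:]"
  by (auto simp: binary_form_def coeff_pCons split: nat.splits)

lemma is_subfield_binary_ratios:
  assumes "ring_map e"
  shows "is_subfield (binary_ratios e a b)"
proof -
  note s = ring_map_simps[OF ring_map_pev[OF ring_map_pev[OF assms]]]
  define v where "v = pev (pev e a) b"
  have "x + y \<in> binary_ratios e a b \<and> x * y \<in> binary_ratios e a b" 
    if xy: "x \<in> binary_ratios e a b" "y \<in> binary_ratios e a b" for x y
  proof -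
    obtain A B d where x: "x = v A / v B" "binary_form d A" "binary_form d B" "v B \<noteq> 0" 
      using binary_ratiosE[OF xy(1)] unfolding v_def by blast
    obtain A' B' d' where y: "y = v A' / v B'" "binary_form d' A'" "binary_form d' B'" "v B' \<noteq> 0" 
      using binary_ratiosE[OF xy(2)] unfolding v_def by blast
    have "x + y = v (A * B' + A' * B) / v (B * B')" "x * y = v (A * A') / v (B * B')" "v (B * B') \<noteq> 0"
      using x y by (simp_all add: v_def s add_frac_eq)
    moreover have "binary_form (d + d') (A * B' + A' * B)" "binary_form (d + d') (A * A')" "binary_form (d + d') (B * B')"
      using binary_form_mult[OF x(2) y(3)] binary_form_mult[OF y(2) x(3)] binary_form_mult[OF x(2) y(2)] binary_form_mult[OF x(3) y(3)]
      by (auto intro: binary_form_add simp: add.commute)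
    ultimately show ?thesis unfolding v_def by (blast intro: binary_ratiosI)
  qed
  moreover have "- x \<in> binary_ratios e a b \<and> inverse x \<in> binary_ratios e a b" if x': "x \<in> binary_ratios e a b" for x
  proof -
    obtain A B d where x: "x = v A / v B" "binary_form d A" "binary_form d B" "v B \<noteq> 0" 
      using binary_ratiosE[OF x'] unfolding v_def by blast
    have "- x = v (- A) / v B" using x by (simp add: v_def s)
    then have 1: "- x \<in> binary_ratios e a b" using x binary_form_uminus unfolding v_def by (blast intro: binary_ratiosI)
    have 2: "inverse x \<in> binary_ratios e a b"
    proof (cases "v A = 0")
      case True
      then show ?thesis using x' by (simp add: x(1))
    next
      case False
      have "inverse x = v B / v A" by (simp add: x(1))
      then show ?thesis using x False unfolding v_def by (blast intro: binary_ratiosI)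
    qed
    show ?thesis using 1 2 ..
  qed
  moreover have "e c \<in> binary_ratios e a b" for c
    by (rule binary_ratiosI[OF _ binary_form_const[of c] binary_form_const[of 1]])
      (simp_all add: pev_pCons ring_map_pev assms ring_map_simps[OF assms] ring_map_simps[OF ring_map_pev[OF assms]])
  then have "0 \<in> binary_ratios e a b" "1 \<in> binary_ratios e a b" by (metis ring_map_simps(1,2) assms)+
  ultimately show ?thesis unfolding is_subfield_def by blast
qed


lemma binary_ratios_gens:
  assumes "ring_map e"
  shows "e c \<in> binary_ratios e a b" "b \<noteq> 0 \<Longrightarrow> a / b \<in> binary_ratios e a b"
proof -
  note r = pev_pCons ring_map_pev assms ring_map_simps[OF assms] ring_map_simps[OF ring_map_pev[OF assms]]
  show "e c \<in> binary_ratios e a b"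
    by (rule binary_ratiosI[OF _ binary_form_const[of c] binary_form_const[of 1]]) (simp_all add: r)
  have "binary_form 1 [:[:0, 1:] :: 'a poly:]" "binary_form 1 [:0, 1 :: 'a poly:]"
    by (auto simp: binary_form_def coeff_pCons split: nat.splits)
  then show "a / b \<in> binary_ratios e a b" if "b \<noteq> 0"
    by (rule binary_ratiosI[rotated]) (use that in \<open>simp_all add: r\<close>)
qed

text \<open>A form of degree d satisfies A(a, b) = b^d A(a / b, 1), and the powers of b cancel in
  the quotient. Conversely the quotients form a field containing the constants and a / b.\<close>

lemma binary_ratios_eq_simple_ext:
  assumes "ring_map e" "b \<noteq> 0"
  shows "binary_ratios e a b = simple_ext e (a / b)"
proof
  show "simple_ext e (a / b) \<subseteq> binary_ratios e a b"
    using assms by (intro simple_ext_least is_subfield_binary_ratios binary_ratios_gens)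
  note sub = is_subfield_simple_ext[OF assms(1), of "a / b"]
  show "binary_ratios e a b \<subseteq> simple_ext e (a / b)"
  proof
    fix x assume "x \<in> binary_ratios e a b"
    then obtain A B d where x: "x = pev (pev e a) b A / pev (pev e a) b B" "binary_form d A" "binary_form d B" by (rule binary_ratiosE)
    have h: "pev (pev e a) b A = b ^ d * pev (pev e (a / b)) 1 A" if "binary_form d A" for A
    proof -
      have t: "e (poly.coeff (poly.coeff A j) i) * a ^ i * b ^ j = b ^ d * (e (poly.coeff (poly.coeff A j) i) * (a / b) ^ i)" for i j
      proof (cases "i + j = d")
        case True
        then show ?thesis using assms(2) by (auto simp: power_add power_divide)
      next
        case False
        then have "poly.coeff (poly.coeff A j) i = 0" using that by (auto simp: binary_form_def)
        then show ?thesis by (simp add: ring_map_simps[OF assms(1)])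
      qed
      show ?thesis
        unfolding pev_altdef[OF assms(1)] pev_altdef[OF ring_map_pev[OF assms(1)]] sum_distrib_right t
        by (simp add: sum_distrib_left)
    qed
    have "x = pev (pev e (a / b)) 1 A / pev (pev e (a / b)) 1 B"
      using x assms(2) by (simp add: h)
    also have "\<dots> \<in> simple_ext e (a / b)"
      by (intro is_subfieldD[OF sub] pev_closed[OF sub] ring_map_pev assms simple_ext_gens)
    finally show "x \<in> simple_ext e (a / b)" .
  qed
qed

text \<open>\<eta> is generic in the sense that no form distinguishes it from the whole of C. The
  class of A / B in the function field can then be replaced by the value of A / B at \<eta>.\<close>

locale generic_point =
  fixes C :: "'k::field point set" and e :: "'k \<Rightarrow> 'o::field" and \<eta> :: "'o \<times> 'o \<times> 'o"
  assumes e: "ring_map e" and vanishes: "\<And>d A. form d A \<Longrightarrow> vanishes_on A C \<longleftrightarrow> ev e A \<eta> = 0"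
begin

lemmas ev_rules = ring_map_simps[OF ring_map_ev[OF e]]

definition K :: "'o set" where
  "K = {ev e A \<eta> / ev e B \<eta> | A B. (A, B) \<in> fractions C}"

text \<open>For x in \<open>K\<close> this is the equivalence class of all fractions with value x at
  \<eta>, that is, an element of the function field; outside \<open>K\<close> it is empty.\<close>

definition \<Theta> :: "'o \<Rightarrow> ('k poly3 \<times> 'k poly3) set" where
  "\<Theta> x = {(A, B) \<in> fractions C. ev e A \<eta> / ev e B \<eta> = x}"

lemma fractions_iff: "(A, B) \<in> fractions C \<longleftrightarrow> (\<exists>d. form d A \<and> form d B) \<and> ev e B \<eta> \<noteq> 0"
  unfolding fractions_def using vanishes by blast

lemma fractionsE:
  assumes "(A, B) \<in> fractions C" 
  obtains d where "form d A" "form d B" "ev e B \<eta> \<noteq> 0"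
  using assms fractions_iff that by blast

lemma fractionsI: "form d A \<Longrightarrow> form d B \<Longrightarrow> ev e B \<eta> \<noteq> 0 \<Longrightarrow> (A, B) \<in> fractions C"
  using fractions_iff by blast

lemma fraction_rel_iff:
  "((A, B), (A', B')) \<in> fraction_rel C \<longleftrightarrow> 
    (A, B) \<in> fractions C \<and> (A', B') \<in> fractions C \<and> ev e A \<eta> / ev e B \<eta> = ev e A' \<eta> / ev e B' \<eta>"
proof -
  have "vanishes_on (A * B' - A' * B) C \<longleftrightarrow> ev e A \<eta> / ev e B \<eta> = ev e A' \<eta> / ev e B' \<eta>"
    if AB: "(A, B) \<in> fractions C" "(A', B') \<in> fractions C"
  proof -
    obtain d where d: "form d A" "form d B" "ev e B \<eta> \<noteq> 0" using AB(1) by (rule fractionsE)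
    obtain d' where d': "form d' A'" "form d' B'" "ev e B' \<eta> \<noteq> 0" using AB(2) by (rule fractionsE)
    have "form (d + d') (A * B' - A' * B)"
      using form_mult[OF d(1) d'(2)] form_mult[OF d'(1) d(2)] by (auto intro: form_diff simp: add.commute)
    then show ?thesis using d(3) d'(3) by (simp add: vanishes ev_rules frac_eq_eq)
  qed
  then show ?thesis by (auto simp: fraction_rel_def)
qed

lemma rat_fun_eq: "(A, B) \<in> fractions C \<Longrightarrow> rat_fun C A B = \<Theta> (ev e A \<eta> / ev e B \<eta>)"
  by (auto simp: rat_fun_def \<Theta>_def fraction_rel_iff)

lemma KE:
  assumes "x \<in> K"
  obtains A B d where "form d A" "form d B" "ev e B \<eta> \<noteq> 0" "(A, B) \<in> fractions C" "x = ev e A \<eta> / ev e B \<eta>" 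
proof -
  obtain A B where AB: "(A, B) \<in> fractions C" "x = ev e A \<eta> / ev e B \<eta>" using assms by (auto simp: K_def)
  show ?thesis using fractionsE[OF AB(1)] that AB by metis
qed

lemma KI: "form d A \<Longrightarrow> form d B \<Longrightarrow> ev e B \<eta> \<noteq> 0 \<Longrightarrow> ev e A \<eta> / ev e B \<eta> \<in> K"
  unfolding K_def using fractionsI by blast

lemma is_subfield_K: "is_subfield K"
proof -
  have "x + y \<in> K \<and> x * y \<in> K" if xy: "x \<in> K" "y \<in> K" for x y
  proof -
    obtain A B d where x: "form d A" "form d B" "ev e B \<eta> \<noteq> 0" "x = ev e A \<eta> / ev e B \<eta>" using KE[OF xy(1)] by blast
    obtain A' B' d' where y: "form d' A'" "form d' B'" "ev e B' \<eta> \<noteq> 0" "y = ev e A' \<eta> / ev e B' \<eta>" using KE[OF xy(2)] by blast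
    have "x + y = ev e (A * B' + A' * B) \<eta> / ev e (B * B') \<eta>" "x * y = ev e (A * A') \<eta> / ev e (B * B') \<eta>" "ev e (B * B') \<eta> \<noteq> 0"
      using x y by (simp_all add: ev_rules add_frac_eq)
    moreover have "form (d + d') (A * B' + A' * B)" "form (d + d') (A * A')" "form (d + d') (B * B')"
      using form_mult[OF x(1) y(2)] form_mult[OF y(1) x(2)] form_mult[OF x(1) y(1)] form_mult[OF x(2) y(2)]
      by (auto intro: form_add simp: add.commute)
    ultimately show ?thesis by (metis KI)
  qed
  moreover have "- x \<in> K \<and> inverse x \<in> K" if x': "x \<in> K" for x
  proof -
    obtain A B d where x: "form d A" "form d B" "ev e B \<eta> \<noteq> 0" "x = ev e A \<eta> / ev e B \<eta>" using KE[OF x'] by blast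
    have "- x = ev e (- A) \<eta> / ev e B \<eta>" by (simp add: x(4) ev_rules)
    then have 1: "- x \<in> K" using KI[OF form_uminus[OF x(1)] x(2,3)] by simp
    have 2: "inverse x \<in> K" using KI[OF x(2,1)] x' by (cases "ev e A \<eta> = 0") (auto simp: x(4))
    show ?thesis using 1 2 ..
  qed
  moreover have "0 \<in> K" "1 \<in> K"
    using KI[OF form_0 form_1] KI[OF form_1 form_1] by (simp_all add: ev_rules)
  ultimately show ?thesis unfolding is_subfield_def by blast
qed

lemma const_in_K: "e c \<in> K"
  using KI[OF form_const3[of c] form_1] by (cases \<eta>) (simp add: ev_rules ev_gens e)

lemma inj_\<Theta>: "inj_on \<Theta> K"
proof (rule inj_onI)
  fix x y assume xy: "x \<in> K" "y \<in> K" "\<Theta> x = \<Theta> y"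
  obtain A B where x: "(A, B) \<in> fractions C" "x = ev e A \<eta> / ev e B \<eta>" using KE[OF xy(1)] by metis
  then have "(A, B) \<in> \<Theta> y" using xy(3) by (auto simp: \<Theta>_def)
  then show "x = y" using x(2) by (simp add: \<Theta>_def)
qed

lemma carrier_function_field: "carrier (function_field C) = \<Theta> ` K"
proof -
  have "carrier (function_field C) = {rat_fun C A B | A B. (A, B) \<in> fractions C}"
    unfolding function_field_def quotient_def rat_fun_def by auto
  also have "\<dots> = \<Theta> ` K" unfolding K_def using rat_fun_eq by (auto intro!: imageI) blast
  finally show ?thesis .
qed

lemma \<Theta>_nonempty:
  assumes "x \<in> K" obtains A B d where "form d A" "form d B" "ev e B \<eta> \<noteq> 0" "(A, B) \<in> \<Theta> x"
proof -
  obtain A B d where "form d A" "form d B" "ev e B \<eta> \<noteq> 0" "(A, B) \<in> fractions C" "x = ev e A \<eta> / ev e B \<eta>"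
    using KE[OF assms] by blast
  then show thesis using that unfolding \<Theta>_def by blast
qed

lemma \<Theta>_D: 
  assumes "(A, B) \<in> \<Theta> x" 
  obtains d where "form d A" "form d B" "ev e B \<eta> \<noteq> 0" "x = ev e A \<eta> / ev e B \<eta>"
  using assms fractionsE unfolding \<Theta>_def by blast

text \<open>The operations of the function field are unions over representatives. They collapse
  because every representative gives the same class and classes are nonempty.\<close>

lemma Union_const: 
  assumes "\<And>p. p \<in> S \<Longrightarrow> f p = c" "S \<noteq> {}" 
  shows "(\<Union>p\<in>S. f p) = c"
  using assms by auto

lemma mult_function_field:
  assumes "x \<in> K" "y \<in> K"
  shows "\<Theta> x \<otimes>\<^bsub>function_field C\<^esub> \<Theta> y = \<Theta> (x * y)"
proof -
  have 1: "rat_fun C (A * A') (B * B') = \<Theta> (x * y)" if x: "(A, B) \<in> \<Theta> x" and y: "(A', B') \<in> \<Theta> y" for A B A' B'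
  proof -
    obtain d where d: "form d A" "form d B" "ev e B \<eta> \<noteq> 0" "x = ev e A \<eta> / ev e B \<eta>" using \<Theta>_D[OF x] by blast
    obtain d' where d': "form d' A'" "form d' B'" "ev e B' \<eta> \<noteq> 0" "y = ev e A' \<eta> / ev e B' \<eta>" using \<Theta>_D[OF y] by blast
    have "(A * A', B * B') \<in> fractions C"
      by (rule fractionsI[OF form_mult[OF d(1) d'(1)] form_mult[OF d(2) d'(2)]]) (simp add: ev_rules d d')
    from rat_fun_eq[OF this] show ?thesis by (simp add: ev_rules d d')
  qed
  have ne: "\<Theta> x \<noteq> {}" "\<Theta> y \<noteq> {}" using \<Theta>_nonempty assms by blast+
  show ?thesis unfolding function_field_def monoid.simps
    by (intro Union_const ne) (auto intro!: Union_const ne simp: 1)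
qed

lemma add_function_field:
  assumes "x \<in> K" "y \<in> K"
  shows "\<Theta> x \<oplus>\<^bsub>function_field C\<^esub> \<Theta> y = \<Theta> (x + y)"
proof -
  have 1: "rat_fun C (A * B' + A' * B) (B * B') = \<Theta> (x + y)" if x: "(A, B) \<in> \<Theta> x" and y: "(A', B') \<in> \<Theta> y" for A B A' B'
  proof -
    obtain d where d: "form d A" "form d B" "ev e B \<eta> \<noteq> 0" "x = ev e A \<eta> / ev e B \<eta>" using \<Theta>_D[OF x] by blast
    obtain d' where d': "form d' A'" "form d' B'" "ev e B' \<eta> \<noteq> 0" "y = ev e A' \<eta> / ev e B' \<eta>" using \<Theta>_D[OF y] by blast
    have "form (d + d') (A * B' + A' * B)"
      using form_mult[OF d(1) d'(2)] form_mult[OF d'(1) d(2)] by (auto intro: form_add simp: add.commute)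
    then have "(A * B' + A' * B, B * B') \<in> fractions C"
      by (rule fractionsI[OF _ form_mult[OF d(2) d'(2)]]) (simp add: ev_rules d d')
    from rat_fun_eq[OF this] show ?thesis by (simp add: ev_rules d d' add_frac_eq)
  qed
  have ne: "\<Theta> x \<noteq> {}" "\<Theta> y \<noteq> {}" using \<Theta>_nonempty assms by blast+
  show ?thesis unfolding function_field_def ring.simps
    by (intro Union_const ne) (auto intro!: Union_const ne simp: 1)
qed

lemma one_function_field: "\<one>\<^bsub>function_field C\<^esub> = \<Theta> 1"
  using rat_fun_eq[OF fractionsI[OF form_1 form_1]] by (simp add: function_field_def ev_rules)

lemma zero_function_field: "\<zero>\<^bsub>function_field C\<^esub> = \<Theta> 0"
  using rat_fun_eq[OF fractionsI[OF form_0 form_1]] by (simp add: function_field_def ev_rules)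

lemma projection_pullback_eq:
  assumes "form 1 L1" "form 1 L2"
  shows "projection_pullback C L1 L2 = \<Theta> ` binary_ratios e (ev e L1 \<eta>) (ev e L2 \<eta>)"
proof -
  have iff: "(\<exists>d. binary_form d A \<and> binary_form d B) \<and> \<not> vanishes_on (subst2 B L1 L2) C \<longleftrightarrow>
     (\<exists>d. binary_form d A \<and> binary_form d B) \<and> pev (pev e (ev e L1 \<eta>)) (ev e L2 \<eta>) B \<noteq> 0" for A B
    using vanishes[OF form_subst2[OF _ assms]] ev_subst2[OF e] by metis
  have rat: "rat_fun C (subst2 A L1 L2) (subst2 B L1 L2) = \<Theta> (pev (pev e (ev e L1 \<eta>)) (ev e L2 \<eta>) A / pev (pev e (ev e L1 \<eta>)) (ev e L2 \<eta>) B)"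
    if "(\<exists>d. binary_form d A \<and> binary_form d B) \<and> pev (pev e (ev e L1 \<eta>)) (ev e L2 \<eta>) B \<noteq> 0" for A B
  proof -
    have "(subst2 A L1 L2, subst2 B L1 L2) \<in> fractions C"
      using that form_subst2[OF _ assms] ev_subst2[OF e, of B L1 L2 \<eta>] unfolding fractions_iff by metis
    from rat_fun_eq[OF this] show ?thesis unfolding ev_subst2[OF e] .
  qed
  show ?thesis unfolding projection_pullback_def binary_ratios_def iff
  proof (intro equalityI subsetI, goal_cases)
    case (1 f)
    then obtain A B where AB: "f = rat_fun C (subst2 A L1 L2) (subst2 B L1 L2)"
      "(\<exists>d. binary_form d A \<and> binary_form d B) \<and> pev (pev e (ev e L1 \<eta>)) (ev e L2 \<eta>) B \<noteq> 0" by blast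
    show ?case unfolding AB(1) rat[OF AB(2)] using AB(2) by blast
  next
    case (2 f)
    then obtain A B where AB: "f = \<Theta> (pev (pev e (ev e L1 \<eta>)) (ev e L2 \<eta>) A / pev (pev e (ev e L1 \<eta>)) (ev e L2 \<eta>) B)"
      "(\<exists>d. binary_form d A \<and> binary_form d B) \<and> pev (pev e (ev e L1 \<eta>)) (ev e L2 \<eta>) B \<noteq> 0" by blast
    show ?case unfolding AB(1) rat[OF AB(2), symmetric] using AB(2) by blast
  qed
qed

end

section \<open>The generic point of the quartic\<close>

definition transcendental_over :: "('k::field \<Rightarrow> 'o::field) \<Rightarrow> 'o \<Rightarrow> bool" where
  "transcendental_over e \<tau> \<longleftrightarrow> (\<forall>p. pev e \<tau> p = 0 \<longrightarrow> p = 0)"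

text \<open>Over an algebraically closed field p splits into linear factors: either \<tau> is one of
  the roots, or a factor can be removed and the degree drops.\<close>

lemma algebraic_imp_constant:
  fixes e :: "'k::alg_closed_field \<Rightarrow> 'o::field"
  assumes e: "ring_map e" 
  shows "pev e \<tau> p = 0 \<Longrightarrow> p \<noteq> 0 \<Longrightarrow> \<exists>c. \<tau> = e c"
proof (induction "Polynomial.degree p" arbitrary: p)
  case 0
  then obtain c where "p = [:c:]" using degree_eq_zeroE by metis
  with 0 show ?case by (simp add: pev_pCons e ring_map_eq_0)
next
  case (Suc n)
  then obtain c where "poly p c = 0" using alg_closed_imp_poly_has_root[of p] by auto
  then obtain q where q: "p = [:- c, 1:] * q" unfolding poly_eq_0_iff_dvd by auto
  have "pev e \<tau> p = (\<tau> - e c) * pev e \<tau> q"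
    unfolding q ring_map_simps[OF ring_map_pev[OF e]] by (simp add: pev_pCons e ring_map_simps[OF e])
  then consider "\<tau> = e c" | "pev e \<tau> q = 0" using Suc.prems(1) by auto
  then show ?case
  proof cases
    case 2
    have "q \<noteq> 0" using Suc.prems(2) q by auto
    then have "Polynomial.degree p = Suc (Polynomial.degree q)" unfolding q by (simp add: degree_mult_eq del: mult_pCons_left)
    then show ?thesis using Suc.hyps(1)[OF _ 2 \<open>q \<noteq> 0\<close>] Suc.hyps(2) by simp
  qed blast
qed

lemma transcendental_over_iff:
  fixes e :: "'k::alg_closed_field \<Rightarrow> 'o::field"
  assumes e: "ring_map e" 
  shows "transcendental_over e \<tau> \<longleftrightarrow> (\<forall>c. \<tau> \<noteq> e c)"
proof
  assume t: "transcendental_over e \<tau>"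
  have "pev e (e c) [:- c, 1:] = 0" for c by (simp add: pev_pCons e ring_map_simps[OF e])
  then show "\<forall>c. \<tau> \<noteq> e c" using t unfolding transcendental_over_def by fastforce
next
  assume "\<forall>c. \<tau> \<noteq> e c"
  then show "transcendental_over e \<tau>" unfolding transcendental_over_def using algebraic_imp_constant[OF e] by blast
qed

lemma ring_map_charts:
  assumes "ring_map f" 
  shows "chart1 (h, a, b) = (x, y, z) \<Longrightarrow> chart1 (f h, f a, f b) = (f x, f y, f z)"
    "chart2 (h, a, b) = (x, y, z) \<Longrightarrow> chart2 (f h, f a, f b) = (f x, f y, f z)"
  by (auto simp: chart_defs ring_map_simps[OF assms])

text \<open>(h : 1 : t) is the generic point of the twisted cubic. It carries three descriptions as
  a \<open>generic_pair\<close>: over t, over z, and in the chart b = 1.\<close>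

locale generic_twisted = ninth_root w for w :: "'k::alg_closed_field" +
  fixes e :: "'k \<Rightarrow> 'o::field" and \<rho> :: 'k and t h :: 'o
  assumes e: "ring_map e" and t: "transcendental_over e t" and h: "h ^ 3 = t ^ 3 - 9 * t - 9"
    and \<rho>: "\<rho> ^ 3 = 9 * \<rho> + 9" "\<rho> \<noteq> 0" "\<rho> ^ 2 \<noteq> 3" "2 * \<rho> + 3 \<noteq> 0"
begin

lemma three': "(3::'o) \<noteq> 0"
  using ring_map_eq_0[OF e, of 3] three by (simp add: ring_map_simps[OF e])

definition D1 :: "'k poly" where "D1 = [:-9, -9, 0, 1:]"
definition D2 :: "'k poly" where "D2 = [:1, 0, -9, -9:]"

lemma D1: "pev e \<tau> D1 = \<tau> ^ 3 - 9 * \<tau> - 9" "poly D1 b = b ^ 3 - 9 * b - 9"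
  by (simp_all add: D1_def pev_pCons e ring_map_simps[OF e] algebra_simps eval_nat_numeral)

lemma D2: "pev e \<tau> D2 = 1 - 9 * \<tau> ^ 2 - 9 * \<tau> ^ 3" "poly D2 b = 1 - 9 * b ^ 2 - 9 * b ^ 3"
  by (simp_all add: D2_def pev_pCons e ring_map_simps[OF e] algebra_simps eval_nat_numeral)

lemma cube_root_of_unity: "(w ^ 3) ^ 2 + w ^ 3 + 1 = 0"
  using w by (simp add: eval_nat_numeral mult.assoc)

lemma generic_pairI:
  assumes "transcendental_over e \<tau>" "\<chi> ^ 3 = \<tau> ^ 3 - 9 * \<tau> - 9"
  shows "generic_pair e D1 \<rho> (w ^ 3) \<tau> \<chi>"
proof
  show "poly D1 \<rho> = 0" unfolding D1 using \<rho>(1) by simp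
  have "poly (pderiv D1) \<rho> = 3 * (\<rho> ^ 2 - 3)" by (simp add: D1_def pderiv_pCons algebra_simps power2_eq_square)
  moreover have "3 * (\<rho> ^ 2 - 3) \<noteq> 0" using \<rho>(3) three unfolding mult_eq_0_iff by simp
  ultimately show "poly (pderiv D1) \<rho> \<noteq> 0" by simp
  show "(w ^ 3) ^ 2 + w ^ 3 + 1 = 0" by (rule cube_root_of_unity)
qed (use assms in \<open>auto simp: transcendental_over_def D1 e three\<close>)

lemma t_nonconstant: "t \<noteq> e c"
  using t transcendental_over_iff[OF e] by blast

lemma t_nonzero: "t \<noteq> 0"
  using t_nonconstant[of 0] by (simp add: ring_map_simps[OF e])

sublocale p1: generic_pair e D1 \<rho> "w ^ 3" t h
  by (rule generic_pairI[OF t h])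

text \<open>The same generic point in the chart \<open>b = 1\<close>, needed for the points of the cubic with \<open>a = 0\<close>.\<close>

sublocale p3: generic_pair e D2 "1 / \<rho>" "w ^ 3" "1 / t" "h / t"
proof
  show "p = 0" if "pev e (1 / t) p = 0" for p
  proof (rule ccontr)
    assume "p \<noteq> 0"
    with algebraic_imp_constant[OF e that] obtain c where "1 / t = e c" by blast
    then have "t = e (inverse c)" using ring_map_inverse[OF e, of c] by (metis inverse_eq_divide inverse_inverse_eq)
    then show False using t_nonconstant by blast
  qed
  show "(h / t) ^ 3 = pev e (1 / t) D2" unfolding D2 power_divide h using t_nonzero by (simp add: field_simps eval_nat_numeral)
  have "\<rho> ^ 3 * poly D2 (1 / \<rho>) = \<rho> ^ 3 - 9 * \<rho> - 9" unfolding D2 using \<rho>(2) by (simp add: field_simps eval_nat_numeral)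
  also have "\<dots> = 0" using \<rho>(1) by simp
  finally show "poly D2 (1 / \<rho>) = 0" using \<rho>(2) by (simp only: mult_eq_0_iff power_eq_0_iff simp_thms)
  have "\<rho> ^ 2 * poly (pderiv D2) (1 / \<rho>) = - (3 * (3 * (2 * \<rho> + 3)))"
    using \<rho>(2) by (simp add: D2_def pderiv_pCons field_simps eval_nat_numeral)
  moreover have "3 * (3 * (2 * \<rho> + 3)) \<noteq> 0" using three \<rho>(4) by (simp only: mult_eq_0_iff simp_thms)
  ultimately have "\<rho> ^ 2 * poly (pderiv D2) (1 / \<rho>) \<noteq> 0" by (simp only: neg_equal_0_iff_equal not_False_eq_True)
  then show "poly (pderiv D2) (1 / \<rho>) \<noteq> 0" by (metis mult_zero_right)
  show "(w ^ 3) ^ 2 + w ^ 3 + 1 = 0" by (rule cube_root_of_unity)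
qed (use three e in auto)

definition u :: 'o where "u = h - t"
definition z :: 'o where "z = - h - 3 / u"

lemma u_nonzero: "u \<noteq> 0"
proof
  assume "u = 0"
  then have "pev e t [:0, -1:] + pev e t 1 * h + pev e t 0 * h ^ 2 = 0"
    by (simp add: u_def p1.ev_rules pev_pCons e ring_map_simps[OF e])
  from p1.independent[OF this] show False by simp
qed

lemma twisted_ht: "twisted (h, 1, t)"
  using h by (simp add: twisted_def)

lemma chart1_ht: "chart1 (h, 1, t) = scale3 u (1, t, z)"
  using u_nonzero by (simp add: chart1_def u_def[symmetric] z_def right_diff_distrib) (simp add: u_def algebra_simps power2_eq_square)

lemma quartic_fun_scale: "quartic_fun (c * x) (c * y) (c * z) = c ^ 4 * quartic_fun x y z" for c x y z :: 'o
  by (simp add: quartic_fun_def algebra_simps eval_nat_numeral)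

lemma quartic_tz: "quartic_fun 1 t z = 0"
  using quartic_chart1[OF twisted_ht, of "u * 1" "u * t" "u * z"] chart1_ht u_nonzero
  unfolding quartic_fun_scale by simp

lemma z_nonconstant: "z \<noteq> e c"
proof
  assume z: "z = e c"
  \<comment> \<open>The quartic at x = 1, z = c as a polynomial in y. It is nonzero because - c^2
    and 1 + c cannot both vanish, so a constant z would make t algebraic.\<close>
  define p where "p = [:c ^ 3 - 9 * c - 12, c ^ 3 - 6 * c - 9, - (c ^ 2), 1 + c:]"
  have "pev e t p = quartic_fun 1 t z" 
    unfolding p_def z quartic_fun_def
    by (simp add: pev_pCons e ring_map_simps[OF e] algebra_simps eval_nat_numeral)
  then have "p = 0" using t quartic_tz unfolding transcendental_over_def by simp
  then show False by (auto simp: p_def)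
qed

lemma z_transcendental: "transcendental_over e z"
  using z_nonconstant transcendental_over_iff[OF e] by blast

text \<open>The image of h under the involution that exchanges t and z and fixes u; since h = t + u,
  it equals z + u.\<close>

definition h' :: 'o where "h' = - t - 3 / u"

lemma h': "h' ^ 3 = z ^ 3 - 9 * z - 9"
proof -
  define v where "v = u"
  have v0: "v \<noteq> 0" using u_nonzero by (simp add: v_def)
  have hv: "t + v = h" by (simp add: v_def u_def)
  have "(t + v) ^ 3 = t ^ 3 - 9 * t - 9" unfolding hv by (rule h)
  then have r: "3 * t ^ 2 * v + 3 * t * v ^ 2 + v ^ 3 + 9 * t + 9 = 0"
    by (simp add: algebra_simps eval_nat_numeral)
  have "z = - (t + v) - 3 / v" unfolding hv by (simp add: z_def v_def)
  then have vz: "v * z = - (t * v) - v ^ 2 - 3" using v0 by (simp add: field_simps power2_eq_square)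
  have "h' = - t - 3 / v" by (simp add: h'_def v_def)
  then have vh: "v * h' = - (t * v) - 3" using v0 by (simp add: field_simps)
  have "v ^ 3 * (h' ^ 3 - (z ^ 3 - 9 * z - 9)) = (v * h') ^ 3 - (v * z) ^ 3 + 9 * v ^ 2 * (v * z) + 9 * v ^ 3"
    by (simp add: algebra_simps eval_nat_numeral)
  also have "\<dots> = v ^ 3 * (3 * t ^ 2 * v + 3 * t * v ^ 2 + v ^ 3 + 9 * t + 9)"
    unfolding vz vh by (simp add: algebra_simps eval_nat_numeral)
  finally show ?thesis unfolding r using v0 by simp
qed

sublocale p2: generic_pair e D1 \<rho> "w ^ 3" z h'
  by (rule generic_pairI[OF z_transcendental h'])

text \<open>The relations are symmetric: u = h' - z, t = - h' - 3 / u and h = - z - 3 / u recover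
  the first pair from the second.\<close>

lemma K_eq: "p2.K = p1.K"
proof
  note c = is_subfieldD[OF p1.is_subfield_K] and c2 = is_subfieldD[OF p2.is_subfield_K]
  have 1: "t \<in> p1.K" "e k \<in> p1.K" "h \<in> p1.K" for k 
    using p1.k\<tau>_subset_K simple_ext_gens[OF e] p1.\<chi>_in_K by auto
  have "u \<in> p1.K" unfolding u_def by (intro c 1)
  then have "z \<in> p1.K" "h' \<in> p1.K" unfolding z_def h'_def using 1 by (auto intro!: c)
  then show "p2.K \<subseteq> p1.K" by (intro p2.K_least p1.is_subfield_K 1)
  have 2: "z \<in> p2.K" "e k \<in> p2.K" "h' \<in> p2.K" for k 
    using p2.k\<tau>_subset_K simple_ext_gens[OF e] p2.\<chi>_in_K by auto
  have u: "u = h' - z" by (simp add: h'_def z_def u_def)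
  then have 3: "u \<in> p2.K" using c2(7)[OF 2(3) 2(1)] by simp
  have "t = - h' - 3 / u" "h = - z - 3 / u" by (simp_all add: h'_def z_def)
  then have "t \<in> p2.K" "h \<in> p2.K" using 2 3 by (metis c2(5,7,8,10))+
  then show "p1.K \<subseteq> p2.K" by (intro p1.K_least p2.is_subfield_K 2)
qed

section \<open>Vanishing on the quartic and vanishing at the generic point\<close>

text \<open>Over k[T][H] a form composed with a chart becomes a single polynomial in the coordinates
  of the cubic. It can be evaluated both at the generic point and at points over k, as
  \<open>pev2_eq_0_iff\<close> requires.\<close>

definition lift :: "'k \<Rightarrow> 'k poly poly" where "lift c = [:[:c:]:]"

lemma ring_map_lift: "ring_map lift"
  by (rule ring_mapI) (auto simp: lift_def one_pCons)

lemma pev2_lift: "ring_map g \<Longrightarrow> pev2 g \<tau> \<chi> (lift c) = g c"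
  by (simp add: pev2_def lift_def pev_pCons ring_map_pev)

abbreviation H :: "'k poly poly" where "H \<equiv> [:0, 1:]"
abbreviation T :: "'k poly poly" where "T \<equiv> [:[:0, 1:]:]"

lemma pev2_gens: "ring_map g \<Longrightarrow> pev2 g \<tau> \<chi> H = \<chi>" "ring_map g \<Longrightarrow> pev2 g \<tau> \<chi> T = \<tau>" "ring_map g \<Longrightarrow> pev2 g \<tau> \<chi> 1 = 1"
  by (simp_all add: pev2_def pev_pCons ring_map_pev ring_map_simps[OF ring_map_pev[OF ring_map_pev]] ring_map_simps)

lemma pev2_ev:
  assumes g: "ring_map g"
  shows "pev2 g \<tau> \<chi> (ev lift A (chart1 (a, b, c))) = ev g A (chart1 (pev2 g \<tau> \<chi> a, pev2 g \<tau> \<chi> b, pev2 g \<tau> \<chi> c))"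
    "pev2 g \<tau> \<chi> (ev lift A (chart2 (a, b, c))) = ev g A (chart2 (pev2 g \<tau> \<chi> a, pev2 g \<tau> \<chi> b, pev2 g \<tau> \<chi> c))"
proof -
  have ge: "(\<lambda>c. pev2 g \<tau> \<chi> (lift c)) = g" using pev2_lift[OF g] by blast
  obtain x y z where 1: "chart1 (a, b, c) = (x, y, z)" by (metis prod_cases3)
  show "pev2 g \<tau> \<chi> (ev lift A (chart1 (a, b, c))) = ev g A (chart1 (pev2 g \<tau> \<chi> a, pev2 g \<tau> \<chi> b, pev2 g \<tau> \<chi> c))"
    unfolding ring_map_charts(1)[OF ring_map_pev2[OF g] 1] 1 ring_map_comp_ev[OF ring_map_pev2[OF g] ring_map_lift] ge ..
  obtain x y z where 2: "chart2 (a, b, c) = (x, y, z)" by (metis prod_cases3)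
  show "pev2 g \<tau> \<chi> (ev lift A (chart2 (a, b, c))) = ev g A (chart2 (pev2 g \<tau> \<chi> a, pev2 g \<tau> \<chi> b, pev2 g \<tau> \<chi> c))"
    unfolding ring_map_charts(2)[OF ring_map_pev2[OF g] 2] 2 ring_map_comp_ev[OF ring_map_pev2[OF g] ring_map_lift] ge ..
qed

abbreviation C :: "'k point set" where "C \<equiv> zero_locus quartic"

lemma ev_scale: "form d A \<Longrightarrow> ev e A (scale3 c v) = c ^ d * ev e A v"
  by (cases v) (simp add: ev_form_scale[OF e])

lemma proj_image_in_C:
  assumes "twisted v" "v \<noteq> (0, 0, 0 :: 'k)"
  shows "proj_image v \<in> C"
proof -
  have "proj_image v = \<phi> (proj_point (from_twisted v))" by (simp add: \<phi>_proj_point to_from_twisted)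
  moreover have "proj_point (from_twisted v) \<in> fermat_curve"
    using assms by (simp add: proj_point_in_fermat_curve from_twisted_eq_0 to_from_twisted)
  ultimately show ?thesis using image_\<phi> by blast
qed

lemma C_cases:
  assumes "Q \<in> C"
  obtains v where "twisted v" "v \<noteq> (0, 0, 0 :: 'k)" "Q = proj_image v"
proof -
  obtain P where P: "P \<in> fermat_curve" "Q = \<phi> P" using assms image_\<phi> by blast
  obtain v where v: "v \<noteq> (0, 0, 0)" "P = proj_point v" "twisted (to_twisted v)" using fermat_curve_cases[OF P(1)] by blast
  show thesis
    by (rule that[OF v(3)]) (use v(1) in \<open>simp_all add: to_twisted_eq_0 P(2) v(2) \<phi>_proj_point\<close>)
qed

text \<open>Every point of the quartic comes from the cubic. Points with a nonzero are reached by
  \<open>chart1\<close> in the piece a = 1, where it has no base point. Points with a = 0 need the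
  piece b = 1, and \<open>chart2\<close> where \<open>chart1\<close> vanishes.\<close>

lemma vanishes_on_C:
  assumes A: "form d A"
  shows "vanishes_on A C \<longleftrightarrow> ev e A (1, t, z) = 0"
proof
  assume van: "vanishes_on A C"
  have "pev2 (\<lambda>c. c) b k (ev lift A (chart1 (H, 1, T))) = 0" if k: "k ^ 3 = poly D1 b" for b k
  proof -
    have tw: "twisted (k, 1, b)" using k by (simp add: twisted_def D1)
    have nz: "chart1 (k, 1, b) \<noteq> (0, 0, 0)" using chart1_zero[OF three tw] by force
    have "proj_image (k, 1, b) \<in> C" by (rule proj_image_in_C[OF tw]) simp
    then have "vanishes_at A (proj_point (chart1 (k, 1, b)))" 
      unfolding proj_image_eq(1)[OF tw nz] using van by (simp add: vanishes_on_def)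
    then show ?thesis 
      unfolding vanishes_at_proj_point[OF A] eval3_eq_ev pev2_ev(1)[OF ring_map_id] pev2_gens[OF ring_map_id] .
  qed
  then have "pev2 e t h (ev lift A (chart1 (H, 1, T))) = 0" using p1.pev2_eq_0_iff by blast
  then have "u ^ d * ev e A (1, t, z) = 0"
    unfolding pev2_ev(1)[OF e] pev2_gens[OF e] chart1_ht ev_scale[OF A] .
  then show "ev e A (1, t, z) = 0" using u_nonzero by simp
next
  assume 0: "ev e A (1, t, z) = 0"
  have "pev2 e t h (ev lift A (chart1 (H, 1, T))) = 0"
    unfolding pev2_ev(1)[OF e] pev2_gens[OF e] chart1_ht ev_scale[OF A] 0 by simp
  then have c1: "ev (\<lambda>c. c) A (chart1 (k, 1, b)) = 0" if "twisted (k, 1, b)" for k b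
    using that unfolding p1.pev2_eq_0_iff pev2_ev(1)[OF ring_map_id] pev2_gens[OF ring_map_id] by (simp add: twisted_def D1)
  have sc: "(h / t, 1 / t, 1) = scale3 (1 / t) (h, 1, t)" using t_nonzero by simp
  have t1: "1 / t \<noteq> 0" using t_nonzero by simp
  \<comment> \<open>Scaling the generic point by 1 / t moves it to the piece b = 1 and changes the
    value of a form only by a nonzero factor.\<close>
  have "pev2 e (1 / t) (h / t) (ev lift A (chart1 (H, T, 1))) = 0"
    unfolding pev2_ev(1)[OF e] pev2_gens[OF e] sc chart_homogeneous chart1_ht ev_scale[OF A] 0 by simp
  then have c2: "ev (\<lambda>c. c) A (chart1 (k, a, 1)) = 0" if "twisted (k, a, 1)" for k a
    using that unfolding p3.pev2_eq_0_iff pev2_ev(1)[OF ring_map_id] pev2_gens[OF ring_map_id] by (simp add: twisted_def D2)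
  \<comment> \<open>The first coordinate h + 3 + 2t is nonzero by independence. So both charts give
    proportional nonzero triples at the generic point, and A vanishes at one with the other.\<close>
  have "chart2 (h, 1, t) \<noteq> (0, 0, 0)"
  proof
    assume "chart2 (h, 1, t) = (0, 0, 0)"
    then have "pev e t [:3, 2:] + pev e t 1 * h + pev e t 0 * h ^ 2 = 0"
      by (simp add: chart2_def p1.ev_rules pev_pCons e ring_map_simps[OF e] algebra_simps)
    from p1.independent[OF this] show False by simp
  qed
  moreover have "chart1 (h, 1, t) \<noteq> (0, 0, 0)" unfolding chart1_ht using u_nonzero by simp
  ultimately obtain r where r: "r \<noteq> 0" "chart1 (h, 1, t) = scale3 r (chart2 (h, 1, t))"
    using cross_zero_imp[OF charts_agree[OF twisted_ht]] by blast
  have "r ^ d * ev e A (chart2 (h, 1, t)) = 0" unfolding ev_scale[OF A, symmetric] r(2)[symmetric] chart1_ht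
    unfolding ev_scale[OF A] 0 by simp
  then have zero2: "ev e A (chart2 (h, 1, t)) = 0" using r(1) by simp
  have "pev2 e (1 / t) (h / t) (ev lift A (chart2 (H, T, 1))) = 0"
    unfolding pev2_ev(2)[OF e] pev2_gens[OF e] sc chart_homogeneous ev_scale[OF A] zero2 by simp
  then have c3: "ev (\<lambda>c. c) A (chart2 (k, a, 1)) = 0" if "twisted (k, a, 1)" for k a
    using that unfolding p3.pev2_eq_0_iff pev2_ev(2)[OF ring_map_id] pev2_gens[OF ring_map_id] by (simp add: twisted_def D2)
  show "vanishes_on A C" unfolding vanishes_on_def
  proof
    fix Q assume "Q \<in> C"
    then obtain v where v: "twisted v" "v \<noteq> (0, 0, 0)" "Q = proj_image v" using C_cases by blast
    obtain k a b where vk: "v = (k, a, b)" by (metis prod_cases3)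
    have "\<exists>v'. twisted v' \<and> v' \<noteq> (0, 0, 0) \<and> Q = proj_image v' \<and> ev (\<lambda>c. c) A (chart1 v') = 0 \<and> (chart1 v' = (0, 0, 0) \<longrightarrow> ev (\<lambda>c. c) A (chart2 v') = 0)"
    proof (cases "a = 0")
      case False
      have v': "v = scale3 a (k / a, 1, b / a)" using False by (simp add: vk)
      have tw: "twisted (k / a, 1, b / a)" using v(1) chart_homogeneous(4)[OF False] unfolding v' by blast
      have "chart1 (k / a, 1, b / a) \<noteq> (0, 0, 0)" using chart1_zero[OF three tw] by force
      then show ?thesis using tw c1[OF tw] proj_image_scale[OF False, of "(k / a, 1, b / a)"] v(3) unfolding v'
        by (intro exI[of _ "(k / a, 1, b / a)"]) simp
    next
      case True
      then have "b \<noteq> 0" using v(1,2) by (auto simp: vk twisted_def)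
      have v': "v = scale3 b (k / b, 0, 1)" using True \<open>b \<noteq> 0\<close> by (simp add: vk)
      have tw: "twisted (k / b, 0, 1)" using v(1) chart_homogeneous(4)[OF \<open>b \<noteq> 0\<close>] unfolding v' by blast
      then show ?thesis using c2[OF tw] c3[OF tw] proj_image_scale[OF \<open>b \<noteq> 0\<close>, of "(k / b, 0, 1)"] v(3) unfolding v'
        by (intro exI[of _ "(k / b, 0, 1)"]) simp
    qed
    then obtain v' where v': "twisted v'" "v' \<noteq> (0, 0, 0)" "Q = proj_image v'" "ev (\<lambda>c. c) A (chart1 v') = 0" 
       "chart1 v' = (0, 0, 0) \<Longrightarrow> ev (\<lambda>c. c) A (chart2 v') = 0" by blast
    show "vanishes_at A Q"
    proof (cases "chart1 v' = (0, 0, 0)")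
      case True
      show ?thesis unfolding v'(3) proj_image_eq(2)[OF v'(1) charts_nonzero[OF three v'(1,2) True]] vanishes_at_proj_point[OF A] eval3_eq_ev
        by (rule v'(5)[OF True])
    next
      case False
      show ?thesis unfolding v'(3) proj_image_eq(1)[OF v'(1) False] vanishes_at_proj_point[OF A] eval3_eq_ev by (rule v'(4))
    qed
  qed
qed

sublocale G: generic_point C e "(1, t, z)"
  by standard (rule e, rule vanishes_on_C)

lemma ratio_in_G_K:
  assumes "form 1 A" "form 1 B" "ev e B (1, t, z) \<noteq> 0"
  shows "ev e A (1, t, z) / ev e B (1, t, z) \<in> G.K"
  by (rule G.KI[OF assms])

lemma sum_nonzero: "t + z + 3 \<noteq> 0"
proof
  assume "t + z + 3 = 0"
  then have "(1 + t) * (1 + z) = 0" using quartic_sum_zero[OF quartic_tz _ three'] by simp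
  then have "t = - 1 \<or> z = - 1" by (auto simp: eq_neg_iff_add_eq_0 add.commute)
  then show False using t_nonconstant[of "- 1"] z_nonconstant[of "- 1"] by (simp add: ring_map_simps[OF e])
qed

text \<open>Birationality at the generic point: h lies in k(t, z), so the function field of the
  quartic is all of k(t, h). The formula is \<open>chart_inv\<close> at (1, t, z).\<close>

lemma h_rational: "h = (t * (t + z + 3) - 3 * ((1 + t) * (1 + z))) / (t + z + 3)"
proof -
  define S where "S = t + z + 3"
  define l where "l = (h - t) * (t * (h - t) + (h * t - h ^ 2 - 3 * 1 ^ 2) + 3 * (1 * (h - t)))"
  have "scale3 (u ^ 2) (chart_inv (1, t, z)) = scale3 l (h, 1, t)"
    using chart_inv_chart1[OF twisted_ht] unfolding chart1_ht chart_homogeneous l_def .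
  then have 1: "u ^ 2 * (t * S - 3 * ((1 + t) * (1 + z))) = l * h" and 2: "u ^ 2 * S = l"
    by (simp_all only: chart_inv_def S_def prod.case scale3.simps prod.inject mult.assoc mult_1_right mult_1_left)
  have "u ^ 2 * (t * S - 3 * ((1 + t) * (1 + z))) = u ^ 2 * (S * h)" using 1 unfolding 2[symmetric] by (simp add: mult.assoc)
  then have "t * S - 3 * ((1 + t) * (1 + z)) = S * h" using u_nonzero by simp
  then show ?thesis using sum_nonzero unfolding S_def[symmetric] by (simp add: field_simps)
qed

lemma G_K_eq: "G.K = p1.K"
proof
  note c = is_subfieldD[OF G.is_subfield_K]
  have x: "ev e var_X (1, t, z) = 1" "ev e var_Y (1, t, z) = t" "ev e var_Z (1, t, z) = z" by (simp_all add: ev_gens e)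
  have t: "t \<in> G.K" using ratio_in_G_K[OF form_vars(2,1)] by (simp add: x)
  have z: "z \<in> G.K" using ratio_in_G_K[OF form_vars(3,1)] by (simp add: x)
  have "h \<in> G.K" by (subst h_rational) (use t z in \<open>auto intro!: c\<close>)
  then show "p1.K \<subseteq> G.K" by (intro p1.K_least G.is_subfield_K G.const_in_K t)
  show "G.K \<subseteq> p1.K"
  proof
    fix x assume "x \<in> G.K"
    then obtain A B d where x: "x = ev e A (1, t, z) / ev e B (1, t, z)" by (rule G.KE)
    note c = is_subfieldD[OF p1.is_subfield_K]
    have "e k \<in> p1.K" "t \<in> p1.K" for k using p1.k\<tau>_subset_K simple_ext_gens[OF e] by auto
    moreover have "z \<in> p1.K" using p2.k\<tau>_subset_K simple_ext_gens[OF e] K_eq by auto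
    ultimately show "x \<in> p1.K" unfolding x by (intro c ev_closed p1.is_subfield_K e)
  qed
qed

text \<open>L1 / L2 pulls the field of the projective line back to k(\<tau>). The two uses differ
  only in the pair (\<tau>, \<chi>), which must generate the same field K.\<close>

lemma galois_point_if:
  assumes gp: "generic_pair e D \<sigma> \<omega> \<tau> \<chi>" and K: "generic_pair.K e \<tau> \<chi> = p1.K"
    and L: "projection_forms P L1 L2" and \<tau>: "ev e L2 (1, t, z) \<noteq> 0" "\<tau> = ev e L1 (1, t, z) / ev e L2 (1, t, z)"
  shows "galois_point P C"
proof -
  interpret p: generic_pair e D \<sigma> \<omega> \<tau> \<chi> by (rule gp)
  interpret cyclic_cubic_model "function_field C" G.\<Theta> p.K "simple_ext e \<tau>" p.s
  proof
    have KG: "p.K = G.K" using K G_K_eq by simp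
    show "inj_on G.\<Theta> p.K" "carrier (function_field C) = G.\<Theta> ` p.K"
      unfolding KG by (rule G.inj_\<Theta>, rule G.carrier_function_field)
    show "x \<in> p.K \<Longrightarrow> y \<in> p.K \<Longrightarrow> G.\<Theta> x \<otimes>\<^bsub>function_field C\<^esub> G.\<Theta> y = G.\<Theta> (x * y)" 
      "x \<in> p.K \<Longrightarrow> y \<in> p.K \<Longrightarrow> G.\<Theta> x \<oplus>\<^bsub>function_field C\<^esub> G.\<Theta> y = G.\<Theta> (x + y)" for x y
      unfolding KG by (rule G.mult_function_field, assumption+, rule G.add_function_field, assumption+)
    show "\<exists>a\<in>simple_ext e \<tau>. \<exists>b\<in>simple_ext e \<tau>. \<exists>c\<in>simple_ext e \<tau>. x ^ 3 + a * x ^ 2 + b * x + c = 0" if "x \<in> p.K" for x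
      using p.cubic_over[OF that] by metis
    show "is_subfield p.K" by (rule p.is_subfield_K)
    show "is_subfield (simple_ext e \<tau>)" by (rule is_subfield_simple_ext[OF e])
    show "simple_ext e \<tau> \<subseteq> p.K" using p.k\<tau>_subset_K by blast
    show "\<one>\<^bsub>function_field C\<^esub> = G.\<Theta> 1" "\<zero>\<^bsub>function_field C\<^esub> = G.\<Theta> 0"
      by (rule G.one_function_field, rule G.zero_function_field)
    show "x \<in> p.K \<Longrightarrow> p.s x \<in> p.K" "x \<in> p.K \<Longrightarrow> p.s (p.s (p.s x)) = x" "x \<in> simple_ext e \<tau> \<Longrightarrow> p.s x = x"
      "x \<in> p.K \<Longrightarrow> p.s x = x \<Longrightarrow> x \<in> simple_ext e \<tau>" for x
      by (rule p.s_in_K, assumption, rule p.s_cubed, assumption, rule p.s_fixes, assumption, rule p.s_fixed, assumption+)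
    show "x \<in> p.K \<Longrightarrow> y \<in> p.K \<Longrightarrow> p.s (x + y) = p.s x + p.s y" "x \<in> p.K \<Longrightarrow> y \<in> p.K \<Longrightarrow> p.s (x * y) = p.s x * p.s y" for x y
      by (rule p.s_add, assumption+, rule p.s_mult, assumption+)
  qed
  have f: "form 1 L1" "form 1 L2" using L by (auto simp: projection_forms_def)
  have "projection_pullback C L1 L2 = G.\<Theta> ` simple_ext e \<tau>"
    unfolding G.projection_pullback_eq[OF f] binary_ratios_eq_simple_ext[OF e \<tau>(1)] \<tau>(2) ..
  then show ?thesis unfolding galois_point_def using L galois by metis
qed

section \<open>The two inner Galois points\<close>

definition P1 :: "'k point" where "P1 = proj_point (0, 0, 1)"
definition P2 :: "'k point" where "P2 = proj_point (0, 1, 0)"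

lemma in_var_locus:
  assumes "(a, b, c) \<noteq> (0, 0, 0 :: 'k)"
  shows "proj_point (a, b, c) \<in> zero_locus var_X \<longleftrightarrow> a = 0" "proj_point (a, b, c) \<in> zero_locus var_Y \<longleftrightarrow> b = 0"
    "proj_point (a, b, c) \<in> zero_locus var_Z \<longleftrightarrow> c = 0"
  by (simp_all only: proj_point_zero_locus[OF form_vars(1) assms] proj_point_zero_locus[OF form_vars(2) assms]
      proj_point_zero_locus[OF form_vars(3) assms] eval3_gens)

lemma projection_forms_P1: "projection_forms P1 var_Y var_X"
proof -
  have "Q = P1" if Q: "Q \<in> zero_locus var_Y \<inter> zero_locus var_X" for Q
  proof -
    obtain v where v: "v \<noteq> (0, 0, 0)" "Q = proj_point v" using Q zero_locusE[OF form_vars(1)] by blast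
    obtain x y z where xyz: "v = (x, y, z)" by (metis prod_cases3)
    have nz: "(x, y, z) \<noteq> (0, 0, 0)" using v(1) unfolding xyz .
    have "x = 0" "y = 0" using Q unfolding v(2) xyz Int_iff in_var_locus[OF nz] by simp_all
    then have "z \<noteq> 0" "v = scale3 z (0, 0, 1)" using v(1) by (auto simp: xyz)
    then show ?thesis unfolding P1_def v(2) by (metis proj_point_scale)
  qed
  moreover have "P1 \<in> zero_locus var_Y \<inter> zero_locus var_X" unfolding P1_def by (simp add: in_var_locus)
  ultimately show ?thesis unfolding projection_forms_def by (intro conjI form_vars) blast
qed

lemma projection_forms_P2: "projection_forms P2 var_Z var_X"
proof -
  have "Q = P2" if Q: "Q \<in> zero_locus var_Z \<inter> zero_locus var_X" for Q
  proof -
    obtain v where v: "v \<noteq> (0, 0, 0)" "Q = proj_point v" using Q zero_locusE[OF form_vars(1)] by blast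
    obtain x y z where xyz: "v = (x, y, z)" by (metis prod_cases3)
    have nz: "(x, y, z) \<noteq> (0, 0, 0)" using v(1) unfolding xyz .
    have "x = 0" "z = 0" using Q unfolding v(2) xyz Int_iff in_var_locus[OF nz] by simp_all
    then have "y \<noteq> 0" "v = scale3 y (0, 1, 0)" using v(1) by (auto simp: xyz)
    then show ?thesis unfolding P2_def v(2) by (metis proj_point_scale)
  qed
  moreover have "P2 \<in> zero_locus var_Z \<inter> zero_locus var_X" unfolding P2_def by (simp add: in_var_locus)
  ultimately show ?thesis unfolding projection_forms_def by (intro conjI form_vars) blast
qed

lemma galois_P1: "galois_point P1 C"
  by (rule galois_point_if[OF p1.generic_pair_axioms refl projection_forms_P1]) (simp_all add: ev_gens e)

lemma galois_P2: "galois_point P2 C"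
  by (rule galois_point_if[OF p2.generic_pair_axioms K_eq projection_forms_P2]) (simp_all add: ev_gens e)

lemma curve_equation_C: "curve_equation C 4 quartic"
  unfolding curve_equation_def using irreducible_quartic[OF three] form_quartic by simp

lemma smooth_pointI:
  assumes "v \<noteq> (0, 0, 0)" "eval3 quartic v = 0" "eval3 (diff_X quartic) v \<noteq> 0"
  shows "smooth_point (proj_point v) C"
proof -
  have "\<not> vanishes_at (diff_X quartic) (proj_point v)" using assms(3) proj_point_self unfolding vanishes_at_def by blast
  then show ?thesis unfolding smooth_point_def
    using curve_equation_C assms(2) proj_point_zero_locus[OF form_quartic assms(1)] by blast
qed

lemma quartic_coeffs:
  "(quartic :: 'k poly3) = [:[:[:0, 0, 0, 0, -12:], [:0, 0, 0, -9:], 0, [:0, 1:]:],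
     [:[:0, 0, 0, -9:], [:0, 0, -6:], 0, [:1:]:], [:0, 0, [:-1:]:], [:[:0, 1:], [:1:]:]:]"
  unfolding quartic_pCons by (simp add: eval_nat_numeral numeral_poly one_pCons)

text \<open>Smoothness is visible from the terms x z^3 and x y^3, whose coefficient 1 is nonzero in
  every characteristic.\<close>

lemma diff_X_quartic: "eval3 (diff_X quartic) (0, 0, 1 :: 'k) = 1" "eval3 (diff_X quartic) (0, 1, 0 :: 'k) = 1"
  unfolding diff_X_def quartic_coeffs by (simp_all add: map_poly_pCons pderiv_pCons eval3.simps)

lemma inner_P1: "inner_galois_point P1 C"
  unfolding inner_galois_point_def
proof
  show "smooth_point P1 C" unfolding P1_def
    by (rule smooth_pointI) (simp_all add: eval3_eq_ev[of quartic] ev_quartic ring_map_id quartic_fun_def diff_X_quartic)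
qed (rule galois_P1)

lemma inner_P2: "inner_galois_point P2 C"
  unfolding inner_galois_point_def
proof
  show "smooth_point P2 C" unfolding P2_def
    by (rule smooth_pointI) (simp_all add: eval3_eq_ev[of quartic] ev_quartic ring_map_id quartic_fun_def diff_X_quartic)
qed (rule galois_P2)

lemma P1_neq_P2: "P1 \<noteq> P2"
  unfolding P1_def P2_def proj_point_eq_iff by simp

end

text \<open>t is the variable of k(t). The algebraic closure is taken so that the cube root h of t^3
  - 9t - 9 exists in the same field.\<close>

lemma generic_element:
  obtains e :: "'k::alg_closed_field \<Rightarrow> 'k poly fract alg_closure" and t where "ring_map e" "transcendental_over e t"
proof
  define e :: "'k \<Rightarrow> 'k poly fract alg_closure" where "e c = to_ac (to_fract [:c:])" for c
  define t :: "'k poly fract alg_closure" where "t = to_ac (to_fract [:0, 1:])"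
  show e: "ring_map e"
  proof (rule ring_mapI)
    have "[:x + y:] = [:x:] + [:y:]" "[:x * y:] = [:x:] * [:y:]" for x y :: 'k by simp_all
    then show "e (x + y) = e x + e y" "e (x * y) = e x * e y" for x y 
      unfolding e_def by (simp_all only: to_fract_add to_fract_mult to_ac_add to_ac_mult)
  qed (simp_all add: e_def one_pCons[symmetric])
  have "pev e t p = to_ac (to_fract p)" for p
  proof (induction p)
    case (pCons c p)
    have "pCons c p = [:c:] + [:0, 1:] * p" by simp
    then have "to_ac (to_fract (pCons c p)) = e c + t * to_ac (to_fract p)"
      unfolding e_def t_def by (simp only: to_fract_add to_fract_mult to_ac_add to_ac_mult)
    then show ?case by (simp add: pev_pCons e pCons)
  qed simp
  moreover have "p = 0" if "to_ac (to_fract p) = 0" for p :: "'k poly"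
    using that to_ac_eq_iff[of "to_fract p" 0] by simp
  ultimately show "transcendental_over e t" unfolding transcendental_over_def by metis
qed

theorem theorem3:
  fixes E :: "'k::alg_closed_field point set"
  assumes char_not_3: "CHAR('k) \<noteq> 3"
    and E_def: "E = zero_locus (var_X ^ 3 + var_Y ^ 3 + var_Z ^ 3)"
  shows "\<exists>\<phi>. morphism_to_P2 E \<phi> \<and> birational_onto_image E \<phi> \<and>
    plane_curve_of_degree (\<phi> ` E) 4 \<and>
    (\<exists>P1 P2. P1 \<noteq> P2 \<and> inner_galois_point P1 (\<phi> ` E) \<and> inner_galois_point P2 (\<phi> ` E))"
proof -
  have three: "(3::'k) \<noteq> 0"
  proof
    assume "(3::'k) = 0"
    then have "CHAR('k) dvd 3" using of_nat_eq_0_iff_char_dvd[of 3, where 'a = 'k] by simp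
    moreover have "n = 1 \<or> n = 3" if n: "n dvd 3" for n :: nat
    proof -
      have "n \<le> 3" using n by (rule dvd_imp_le) simp
      then consider "n = 0" | "n = 1" | "n = 2" | "n = 3" by linarith
      then show ?thesis using n by cases auto
    qed
    ultimately have "CHAR('k) = 1" using char_not_3 by blast
    then show False using of_nat_CHAR[where 'a = 'k] by simp
  qed
  \<comment> \<open>The ninth cyclotomic polynomial: its roots satisfy w^9 = 1, and w^3 is a
    primitive cube root of unity since 3 is nonzero.\<close>
  have "Polynomial.degree [:1, 0, 0, 1, 0, 0, 1 :: 'k:] > 0" by simp
  then obtain w :: 'k where "poly [:1, 0, 0, 1, 0, 0, 1:] w = 0" using alg_closed_imp_poly_has_root by blast
  then have w: "w ^ 6 + w ^ 3 + 1 = 0" by (simp add: eval_nat_numeral algebra_simps)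
  obtain \<rho> :: 'k where \<rho>: "\<rho> ^ 3 = 9 * \<rho> + 9" "\<rho> \<noteq> 0" "\<rho> ^ 2 \<noteq> 3" "2 * \<rho> + 3 \<noteq> 0"
    using ex_branch_point[OF three] by metis
  obtain e :: "'k \<Rightarrow> 'k poly fract alg_closure" and t where e: "ring_map e" "transcendental_over e t"
    using generic_element by blast
  obtain h where h: "h ^ 3 = t ^ 3 - 9 * t - 9" using nth_root_exists[of 3 "t ^ 3 - 9 * t - 9"] by auto
  interpret generic_twisted w e \<rho> t h by unfold_locales (fact w three e h \<rho>)+
  have E: "E = fermat_curve" unfolding E_def fermat_curve_def fermat_form_def ..
  have C: "plane_curve_of_degree (zero_locus (quartic :: 'k poly3)) 4"
    unfolding plane_curve_of_degree_def using curve_equation_C by blast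
  show ?thesis unfolding E
    by (rule exI[of _ \<phi>], unfold image_\<phi>, intro conjI exI[of _ P1] exI[of _ P2])
      (fact morphism_\<phi> birational_\<phi> C P1_neq_P2 inner_P1 inner_P2)+
qed

end
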